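(* Every locally residually torsion-free nilpotent group $G$ admits an essentially free (orientation-preserving) affine action on some ordered abelian group $\Lambda$. In particular, right-angled Artin groups, residually free groups and free products of residually free groups are $\mathrm{ATF}^e$, i.e. each such group admits an essentially free affine action on a $\Lambda$-tree for some ordered abelian group $\Lambda$.
   Context: A group is residually torsion-free nilpotent (respectively residually free) if every non-trivial element has non-trivial image in some torsion-free nilpotent (respectively free) quotient. It is locally residually torsion-free nilpotent if each of its finitely generated subgroups is residually torsion-free nilpotent. A right-angled Artin group is a group with a presentation whose only relations are that certain pairs of generators commute. An ordered abelian group $\Lambda$ is an additively written abelian group with a translation-invariant linear order; $\mathrm{Aut}^+(\Lambda)$ is the group of its order-preserving automorphisms. A $\Lambda$-metric space is defined like an ordinary metric space, but with distances in $\Lambda$. A segment in it is an isometric image of an interval $[a,b]=\{\mu\in\Lambda: a\le\mu\le b\}$ of $\Lambda$. A $\Lambda$-tree is a $\Lambda$-metric space in which any two points are the endpoints of a segment, the intersection of two segments with a common endpoint is a segment, and the union of two segments meeting only in a common endpoint is a segment. In particular $\Lambda$ itself, with $d(x,y)=|x-y|=\max\{x-y,y-x\}$, is a $\Lambda$-tree (a "linear" $\Lambda$-tree); an action "on $\Lambda$" means an action on this $\Lambda$-tree. Given a group $G$ and a homomorphism $\alpha:G\to\mathrm{Aut}^+(\Lambda)$, $g\mapsto\alpha_g$, an $\alpha$-affine action of $G$ on a $\Lambda$-tree $X$ is an action with $d(gx,gy)=\alpha_g d(x,y)$ for all $x,y\in X$, $g\in G$. An affine action is an $\alpha$-affine action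 for some $\alpha$. Affine actions on $\Lambda$ itself are assumed to be orientation-preserving: $x\le y$ implies $gx\le gy$. An orientation-preserving affine automorphism $g$ of $\Lambda$ is hyperbolic if it fixes no point of $\Lambda$, and rigid if no set $[\lambda_1,\lambda_2]=\{\mu\in\Lambda:\lambda_1\le\mu\le\lambda_2\}$ is mapped properly into itself by $g$ or $g^{-1}$; equivalently, if $g^{\epsilon}\lambda>\lambda$ for some $\lambda\in\Lambda$ and $\epsilon=\pm1$, then $g^{\epsilon}\lambda'>\lambda'$ for all $\lambda'\in\Lambda$. An affine action of $G$ on $\Lambda$ is essentially free if every non-trivial $g\in G$ acts as a rigid and hyperbolic automorphism. For affine actions on general $\Lambda$-trees, "essentially free" is the notion introduced in O Rourke's earlier work on affine actions on $\Lambda$-trees: it is a strengthening of freeness that implies rigidity (no segment is mapped properly into itself by a group element), it is preserved under base change and $\Lambda$-fulfilment, and it reduces to the condition just given when the $\Lambda$-tree is $\Lambda$ itself. A group is $\mathrm{ATF}^e$ if it admits an essentially free affine action on a $\Lambda$-tree (not required to be linear) for some ordered abelian group $\Lambda$. *)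

theory Defs
  imports "HOL-Algebra.Bij" "HOL-Algebra.Generated_Groups" "HOL-Algebra.Group_Action"
begin

section \<open>Residual properties of groups\<close>

definition torsion_free :: "('a, 'm) monoid_scheme \<Rightarrow> bool" where
  "torsion_free G \<longleftrightarrow>
     (\<forall>x\<in>carrier G. \<forall>n::nat. n > 0 \<longrightarrow> x [^]\<^bsub>G\<^esub> n = \<one>\<^bsub>G\<^esub> \<longrightarrow> x = \<one>\<^bsub>G\<^esub>)"

fun lower_central :: "('a, 'm) monoid_scheme \<Rightarrow> nat \<Rightarrow> 'a set" where
  "lower_central G 0 = carrier G"
| "lower_central G (Suc n) = generate G
     {x \<otimes>\<^bsub>G\<^esub> y \<otimes>\<^bsub>G\<^esub> inv\<^bsub>G\<^esub> x \<otimes>\<^bsub>G\<^esub> inv\<^bsub>G\<^esub> y | x y. x \<in> lower_central G n \<and> y \<in> carrier G}"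

definition nilpotent_group :: "('a, 'm) monoid_scheme \<Rightarrow> bool" where
  "nilpotent_group G \<longleftrightarrow> group G \<and> (\<exists>n. lower_central G n = {\<one>\<^bsub>G\<^esub>})"

definition residually ::
    "('a set monoid \<Rightarrow> bool) \<Rightarrow> ('a, 'm) monoid_scheme \<Rightarrow> bool" where
  "residually P G \<longleftrightarrow> group G \<and>
     (\<forall>g\<in>carrier G. g \<noteq> \<one>\<^bsub>G\<^esub> \<longrightarrow>
        (\<exists>N. N \<lhd> G \<and> P (G Mod N) \<and> N #>\<^bsub>G\<^esub> g \<noteq> \<one>\<^bsub>G Mod N\<^esub>))"

definition residually_torsion_free_nilpotent :: "('a, 'm) monoid_scheme \<Rightarrow> bool" where
  "residually_torsion_free_nilpotent G \<longleftrightarrow>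
     residually (\<lambda>Q. torsion_free Q \<and> nilpotent_group Q) G"

definition locally_residually_torsion_free_nilpotent :: "('a, 'm) monoid_scheme \<Rightarrow> bool" where
  "locally_residually_torsion_free_nilpotent G \<longleftrightarrow> group G \<and>
     (\<forall>S. finite S \<and> S \<subseteq> carrier G \<longrightarrow>
        residually_torsion_free_nilpotent (G\<lparr>carrier := generate G S\<rparr>))"


section \<open>Presentations\<close>

text \<open>A letter \<open>(True, x)\<close> stands for the generator \<open>x\<close>, and \<open>(False, x)\<close> for its formal inverse.
  A relator pair \<open>(r, s)\<close> stands for the relation \<open>r = s\<close>.\<close>

type_synonym 'x word = "(bool \<times> 'x) list"

definition words_on :: "'x set \<Rightarrow> 'x word set" where
  "words_on X = lists (UNIV \<times> X)"

inductive word_eq :: "'x set \<Rightarrow> ('x word \<times> 'x word) set \<Rightarrow> 'x word \<Rightarrow> 'x word \<Rightarrow> bool"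
  for X :: "'x set" and R :: "('x word \<times> 'x word) set" where
  refl: "w \<in> words_on X \<Longrightarrow> word_eq X R w w"
| sym: "word_eq X R v w \<Longrightarrow> word_eq X R w v"
| trans: "word_eq X R u v \<Longrightarrow> word_eq X R v w \<Longrightarrow> word_eq X R u w"
| cancel: "x \<in> X \<Longrightarrow> u \<in> words_on X \<Longrightarrow> v \<in> words_on X \<Longrightarrow>
    word_eq X R (u @ [(b, x), (\<not> b, x)] @ v) (u @ v)"
| relation: "(r, s) \<in> R \<Longrightarrow> r \<in> words_on X \<Longrightarrow> s \<in> words_on X \<Longrightarrow>
    u \<in> words_on X \<Longrightarrow> v \<in> words_on X \<Longrightarrow> word_eq X R (u @ r @ v) (u @ s @ v)"

definition presented_group ::
    "'x set \<Rightarrow> ('x word \<times> 'x word) set \<Rightarrow> 'x word set monoid" where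
  "presented_group X R =
     \<lparr>carrier = words_on X // {(u, v). word_eq X R u v},
      mult = (\<lambda>A B. {w. \<exists>a\<in>A. \<exists>b\<in>B. word_eq X R (a @ b) w}),
      one = {w. word_eq X R [] w}\<rparr>"

text \<open>Taking the basis in the type of the group elements loses no generality, since a basis
  of a free group is a subset of it.\<close>

definition free_group :: "('a, 'm) monoid_scheme \<Rightarrow> bool" where
  "free_group G \<longleftrightarrow> group G \<and> (\<exists>X::'a set. presented_group X {} \<cong> G)"

definition residually_free :: "('a, 'm) monoid_scheme \<Rightarrow> bool" where
  "residually_free G \<longleftrightarrow> residually free_group G"

text \<open>\<open>E\<close> is the set of pairs of generators that are required to commute.\<close>

definition right_angled_artin_group ::
    "'v set \<Rightarrow> ('v \<times> 'v) set \<Rightarrow> ('a, 'm) monoid_scheme \<Rightarrow> bool" where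
  "right_angled_artin_group V E G \<longleftrightarrow> group G \<and> E \<subseteq> V \<times> V \<and>
     presented_group V {([(True, u), (True, v)], [(True, v), (True, u)]) | u v. (u, v) \<in> E} \<cong> G"

text \<open>The free product of the groups \<open>H i\<close> is generated by the disjoint union of their
  carriers, subject to their multiplication tables.\<close>

definition free_product ::
    "'i set \<Rightarrow> ('i \<Rightarrow> ('h, 'k) monoid_scheme) \<Rightarrow> ('a, 'm) monoid_scheme \<Rightarrow> bool" where
  "free_product I H G \<longleftrightarrow> group G \<and> (\<forall>i\<in>I. group (H i)) \<and>
     presented_group (SIGMA i:I. carrier (H i))
       {([(True, (i, a)), (True, (i, b))], [(True, (i, a \<otimes>\<^bsub>H i\<^esub> b))]) | i a b.
          i \<in> I \<and> a \<in> carrier (H i) \<and> b \<in> carrier (H i)} \<cong> G"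


section \<open>Ordered abelian groups\<close>

text \<open>The group operation is written multiplicatively, as for every \<^const>\<open>monoid\<close> record:
  \<open>\<otimes>\<close> is the addition of \<open>\<Lambda>\<close>, \<open>\<one>\<close> its zero and \<open>inv\<close> its negation.\<close>

record 'l ogroup = "'l monoid" +
  le :: "'l \<Rightarrow> 'l \<Rightarrow> bool" (infixl "\<preceq>\<index>" 50)

definition lt :: "('l, 'k) ogroup_scheme \<Rightarrow> 'l \<Rightarrow> 'l \<Rightarrow> bool" (infixl "\<prec>\<index>" 50) where
  "x \<prec>\<^bsub>\<Lambda>\<^esub> y \<longleftrightarrow> x \<preceq>\<^bsub>\<Lambda>\<^esub> y \<and> x \<noteq> y"

locale ordered_abelian_group = comm_group \<Lambda> for \<Lambda> :: "('l, 'k) ogroup_scheme" (structure) +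
  assumes le_antisym:
      "\<lbrakk>x \<in> carrier \<Lambda>; y \<in> carrier \<Lambda>; x \<preceq> y; y \<preceq> x\<rbrakk> \<Longrightarrow> x = y"
    and le_trans:
      "\<lbrakk>x \<in> carrier \<Lambda>; y \<in> carrier \<Lambda>; z \<in> carrier \<Lambda>; x \<preceq> y; y \<preceq> z\<rbrakk> \<Longrightarrow> x \<preceq> z"
    and le_total:
      "\<lbrakk>x \<in> carrier \<Lambda>; y \<in> carrier \<Lambda>\<rbrakk> \<Longrightarrow> x \<preceq> y \<or> y \<preceq> x"
    and translation_invariant:
      "\<lbrakk>x \<in> carrier \<Lambda>; y \<in> carrier \<Lambda>; z \<in> carrier \<Lambda>; x \<preceq> y\<rbrakk> \<Longrightarrow> z \<otimes> x \<preceq> z \<otimes> y"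

definition ogroup_abs :: "('l, 'k) ogroup_scheme \<Rightarrow> 'l \<Rightarrow> 'l" where
  "ogroup_abs \<Lambda> x = (if \<one>\<^bsub>\<Lambda>\<^esub> \<preceq>\<^bsub>\<Lambda>\<^esub> x then x else inv\<^bsub>\<Lambda>\<^esub> x)"

definition ogroup_dist :: "('l, 'k) ogroup_scheme \<Rightarrow> 'l \<Rightarrow> 'l \<Rightarrow> 'l" where
  "ogroup_dist \<Lambda> x y = ogroup_abs \<Lambda> (x \<otimes>\<^bsub>\<Lambda>\<^esub> inv\<^bsub>\<Lambda>\<^esub> y)"

definition ogroup_interval :: "('l, 'k) ogroup_scheme \<Rightarrow> 'l \<Rightarrow> 'l \<Rightarrow> 'l set" where
  "ogroup_interval \<Lambda> a b = {\<mu> \<in> carrier \<Lambda>. a \<preceq>\<^bsub>\<Lambda>\<^esub> \<mu> \<and> \<mu> \<preceq>\<^bsub>\<Lambda>\<^esub> b}"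

definition Aut_plus :: "('l, 'k) ogroup_scheme \<Rightarrow> ('l \<Rightarrow> 'l) monoid" where
  "Aut_plus \<Lambda> = AutoGroup \<Lambda>\<lparr>carrier :=
     {f \<in> auto \<Lambda>. \<forall>x\<in>carrier \<Lambda>. \<forall>y\<in>carrier \<Lambda>. x \<preceq>\<^bsub>\<Lambda>\<^esub> y \<longrightarrow> f x \<preceq>\<^bsub>\<Lambda>\<^esub> f y}\<rparr>"


section \<open>Metric spaces and trees over an ordered abelian group\<close>

definition Lambda_metric_space ::
    "('l, 'k) ogroup_scheme \<Rightarrow> 'x set \<Rightarrow> ('x \<Rightarrow> 'x \<Rightarrow> 'l) \<Rightarrow> bool" where
  "Lambda_metric_space \<Lambda> X d \<longleftrightarrow>
     (\<forall>x\<in>X. \<forall>y\<in>X. d x y \<in> carrier \<Lambda> \<and> \<one>\<^bsub>\<Lambda>\<^esub> \<preceq>\<^bsub>\<Lambda>\<^esub> d x y \<and>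
        (d x y = \<one>\<^bsub>\<Lambda>\<^esub> \<longleftrightarrow> x = y) \<and> d x y = d y x) \<and>
     (\<forall>x\<in>X. \<forall>y\<in>X. \<forall>z\<in>X. d x z \<preceq>\<^bsub>\<Lambda>\<^esub> d x y \<otimes>\<^bsub>\<Lambda>\<^esub> d y z)"

definition segment_between ::
    "('l, 'k) ogroup_scheme \<Rightarrow> 'x set \<Rightarrow> ('x \<Rightarrow> 'x \<Rightarrow> 'l) \<Rightarrow> 'x \<Rightarrow> 'x \<Rightarrow> 'x set \<Rightarrow> bool" where
  "segment_between \<Lambda> X d x y S \<longleftrightarrow>
     (\<exists>a\<in>carrier \<Lambda>. \<exists>b\<in>carrier \<Lambda>. \<exists>f. a \<preceq>\<^bsub>\<Lambda>\<^esub> b \<and>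
        f \<in> ogroup_interval \<Lambda> a b \<rightarrow> X \<and>
        (\<forall>\<mu>\<in>ogroup_interval \<Lambda> a b. \<forall>\<nu>\<in>ogroup_interval \<Lambda> a b.
           d (f \<mu>) (f \<nu>) = ogroup_dist \<Lambda> \<mu> \<nu>) \<and>
        S = f ` ogroup_interval \<Lambda> a b \<and> f a = x \<and> f b = y)"

definition is_segment ::
    "('l, 'k) ogroup_scheme \<Rightarrow> 'x set \<Rightarrow> ('x \<Rightarrow> 'x \<Rightarrow> 'l) \<Rightarrow> 'x set \<Rightarrow> bool" where
  "is_segment \<Lambda> X d S \<longleftrightarrow> (\<exists>x y. segment_between \<Lambda> X d x y S)"

text \<open>Trees are non-empty; otherwise every group would act freely on the empty tree.\<close>

definition Lambda_tree ::
    "('l, 'k) ogroup_scheme \<Rightarrow> 'x set \<Rightarrow> ('x \<Rightarrow> 'x \<Rightarrow> 'l) \<Rightarrow> bool" where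
  "Lambda_tree \<Lambda> X d \<longleftrightarrow> X \<noteq> {} \<and> Lambda_metric_space \<Lambda> X d \<and>
     (\<forall>x\<in>X. \<forall>y\<in>X. \<exists>S. segment_between \<Lambda> X d x y S) \<and>
     (\<forall>x y z S T. segment_between \<Lambda> X d x y S \<and> segment_between \<Lambda> X d x z T \<longrightarrow>
        is_segment \<Lambda> X d (S \<inter> T)) \<and>
     (\<forall>x y z S T. segment_between \<Lambda> X d x y S \<and> segment_between \<Lambda> X d x z T \<and>
        S \<inter> T = {x} \<longrightarrow> is_segment \<Lambda> X d (S \<union> T))"


section \<open>Affine actions\<close>

definition affine_action ::
    "('g, 'm) monoid_scheme \<Rightarrow> ('l, 'k) ogroup_scheme \<Rightarrow> 'x set \<Rightarrow> ('x \<Rightarrow> 'x \<Rightarrow> 'l) \<Rightarrow>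
     ('g \<Rightarrow> 'l \<Rightarrow> 'l) \<Rightarrow> ('g \<Rightarrow> 'x \<Rightarrow> 'x) \<Rightarrow> bool" where
  "affine_action G \<Lambda> X d \<alpha> \<phi> \<longleftrightarrow>
     \<alpha> \<in> hom G (Aut_plus \<Lambda>) \<and> group_action G X \<phi> \<and>
     (\<forall>g\<in>carrier G. \<forall>x\<in>X. \<forall>y\<in>X. d (\<phi> g x) (\<phi> g y) = \<alpha> g (d x y))"

definition linear_affine_action ::
    "('g, 'm) monoid_scheme \<Rightarrow> ('l, 'k) ogroup_scheme \<Rightarrow>
     ('g \<Rightarrow> 'l \<Rightarrow> 'l) \<Rightarrow> ('g \<Rightarrow> 'l \<Rightarrow> 'l) \<Rightarrow> bool" where
  "linear_affine_action G \<Lambda> \<alpha> \<phi> \<longleftrightarrow>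
     affine_action G \<Lambda> (carrier \<Lambda>) (ogroup_dist \<Lambda>) \<alpha> \<phi> \<and>
     (\<forall>g\<in>carrier G. \<forall>x\<in>carrier \<Lambda>. \<forall>y\<in>carrier \<Lambda>. x \<preceq>\<^bsub>\<Lambda>\<^esub> y \<longrightarrow> \<phi> g x \<preceq>\<^bsub>\<Lambda>\<^esub> \<phi> g y)"

definition linear_hyperbolic ::
    "('l, 'k) ogroup_scheme \<Rightarrow> ('g \<Rightarrow> 'l \<Rightarrow> 'l) \<Rightarrow> 'g \<Rightarrow> bool" where
  "linear_hyperbolic \<Lambda> \<phi> g \<longleftrightarrow> (\<forall>x\<in>carrier \<Lambda>. \<phi> g x \<noteq> x)"

definition linear_rigid ::
    "('g, 'm) monoid_scheme \<Rightarrow> ('l, 'k) ogroup_scheme \<Rightarrow> ('g \<Rightarrow> 'l \<Rightarrow> 'l) \<Rightarrow> 'g \<Rightarrow> bool" where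
  "linear_rigid G \<Lambda> \<phi> g \<longleftrightarrow>
     (\<forall>a\<in>carrier \<Lambda>. \<forall>b\<in>carrier \<Lambda>.
        \<not> \<phi> g ` ogroup_interval \<Lambda> a b \<subset> ogroup_interval \<Lambda> a b \<and>
        \<not> \<phi> (inv\<^bsub>G\<^esub> g) ` ogroup_interval \<Lambda> a b \<subset> ogroup_interval \<Lambda> a b)"

definition linear_essentially_free ::
    "('g, 'm) monoid_scheme \<Rightarrow> ('l, 'k) ogroup_scheme \<Rightarrow> ('g \<Rightarrow> 'l \<Rightarrow> 'l) \<Rightarrow> bool" where
  "linear_essentially_free G \<Lambda> \<phi> \<longleftrightarrow>
     (\<forall>g\<in>carrier G. g \<noteq> \<one>\<^bsub>G\<^esub> \<longrightarrow> linear_hyperbolic \<Lambda> \<phi> g \<and> linear_rigid G \<Lambda> \<phi> g)"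

text \<open>On a general tree an element is hyperbolic if it neither fixes a point nor interchanges
  two points (an inversion).\<close>

definition tree_hyperbolic :: "'x set \<Rightarrow> ('g \<Rightarrow> 'x \<Rightarrow> 'x) \<Rightarrow> 'g \<Rightarrow> bool" where
  "tree_hyperbolic X \<phi> g \<longleftrightarrow> (\<forall>x\<in>X. \<phi> g x \<noteq> x \<and> \<phi> g (\<phi> g x) \<noteq> x)"

definition tree_rigid ::
    "('g, 'm) monoid_scheme \<Rightarrow> ('l, 'k) ogroup_scheme \<Rightarrow> 'x set \<Rightarrow> ('x \<Rightarrow> 'x \<Rightarrow> 'l) \<Rightarrow>
     ('g \<Rightarrow> 'x \<Rightarrow> 'x) \<Rightarrow> 'g \<Rightarrow> bool" where
  "tree_rigid G \<Lambda> X d \<phi> g \<longleftrightarrow>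
     (\<forall>S. is_segment \<Lambda> X d S \<longrightarrow> \<not> \<phi> g ` S \<subset> S \<and> \<not> \<phi> (inv\<^bsub>G\<^esub> g) ` S \<subset> S)"

text \<open>On a general tree, hyperbolicity and rigidity alone are too weak a requirement, as they may
  be lost when the tree is completed: multiplication by 2 on the open half-line of positive reals
  is hyperbolic and rigid, but extends to a map with a fixed point on the whole line.
  Essential freeness therefore also bounds the distortion \<open>\<bar>\<alpha>\<^sub>g \<lambda> - \<lambda>\<bar>\<close> of all
  lengths \<open>\<lambda>\<close> by the displacement of every point. On \<open>\<Lambda>\<close> itself the bound follows from
  hyperbolicity and rigidity (lemma \<open>tree_essentially_free_linear_iff\<close> below).
  For isometric actions the notion reduces to freeness without inversions.\<close>

definition tree_essentially_free ::
    "('g, 'm) monoid_scheme \<Rightarrow> ('l, 'k) ogroup_scheme \<Rightarrow> 'x set \<Rightarrow> ('x \<Rightarrow> 'x \<Rightarrow> 'l) \<Rightarrow>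
     ('g \<Rightarrow> 'l \<Rightarrow> 'l) \<Rightarrow> ('g \<Rightarrow> 'x \<Rightarrow> 'x) \<Rightarrow> bool" where
  "tree_essentially_free G \<Lambda> X d \<alpha> \<phi> \<longleftrightarrow>
     (\<forall>g\<in>carrier G. g \<noteq> \<one>\<^bsub>G\<^esub> \<longrightarrow>
        tree_hyperbolic X \<phi> g \<and> tree_rigid G \<Lambda> X d \<phi> g \<and>
        (\<forall>x\<in>X. \<forall>\<mu>\<in>carrier \<Lambda>. ogroup_dist \<Lambda> (\<alpha> g \<mu>) \<mu> \<prec>\<^bsub>\<Lambda>\<^esub> d x (\<phi> g x)))"


context ordered_abelian_group
begin

lemma le_refl: "x \<in> carrier \<Lambda> \<Longrightarrow> x \<preceq> x"
  using le_total by blast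

lemma cancel_inv [simp]:
  assumes "x \<in> carrier \<Lambda>" "z \<in> carrier \<Lambda>"
  shows "z \<otimes> (inv z \<otimes> x) = x" "z \<otimes> (x \<otimes> inv z) = x" "inv z \<otimes> (z \<otimes> x) = x" "inv z \<otimes> (x \<otimes> z) = x"
  using assms by (simp_all add: m_comm[of x] flip: m_assoc)

lemma le_diff_iff:
  assumes [simp]: "x \<in> carrier \<Lambda>" "y \<in> carrier \<Lambda>"
  shows "\<one> \<preceq> y \<otimes> inv x \<longleftrightarrow> x \<preceq> y"
proof
  assume "\<one> \<preceq> y \<otimes> inv x"
  then have "x \<otimes> \<one> \<preceq> x \<otimes> (y \<otimes> inv x)" by (intro translation_invariant) auto
  then show "x \<preceq> y" by simp
next
  assume "x \<preceq> y"
  then have "inv x \<otimes> x \<preceq> inv x \<otimes> y" by (intro translation_invariant) auto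
  then show "\<one> \<preceq> y \<otimes> inv x" by (simp add: m_comm)
qed

lemma dist_eq:
  assumes [simp]: "x \<in> carrier \<Lambda>" "y \<in> carrier \<Lambda>" and "x \<preceq> y"
  shows "ogroup_dist \<Lambda> y x = y \<otimes> inv x" "ogroup_dist \<Lambda> x y = y \<otimes> inv x"
proof -
  show "ogroup_dist \<Lambda> y x = y \<otimes> inv x"
    using assms by (simp add: ogroup_dist_def ogroup_abs_def le_diff_iff)
  have *: "inv (x \<otimes> inv y) = y \<otimes> inv x"
    by (simp add: inv_mult_group)
  show "ogroup_dist \<Lambda> x y = y \<otimes> inv x"
  proof (cases "y \<preceq> x")
    case True
    then have "x = y" using assms le_antisym by blast
    then show ?thesis by (simp add: ogroup_dist_def ogroup_abs_def le_refl)
  next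
    case False
    then show ?thesis using * by (simp add: ogroup_dist_def ogroup_abs_def le_diff_iff)
  qed
qed

lemma dist_sym:
  assumes "x \<in> carrier \<Lambda>" "y \<in> carrier \<Lambda>"
  shows "ogroup_dist \<Lambda> x y = ogroup_dist \<Lambda> y x"
  using le_total[OF assms] dist_eq[OF assms] dist_eq[OF assms(2,1)] by auto

lemma dist_closed [simp]:
  "x \<in> carrier \<Lambda> \<Longrightarrow> y \<in> carrier \<Lambda> \<Longrightarrow> ogroup_dist \<Lambda> x y \<in> carrier \<Lambda>"
  by (simp add: ogroup_dist_def ogroup_abs_def)

lemma diff_mono_iff:
  assumes [simp]: "x \<in> carrier \<Lambda>" "y \<in> carrier \<Lambda>" "z \<in> carrier \<Lambda>"
  shows "x \<otimes> inv z \<preceq> y \<otimes> inv z \<longleftrightarrow> x \<preceq> y"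
proof -
  have "(y \<otimes> inv z) \<otimes> inv (x \<otimes> inv z) = y \<otimes> inv x"
    by (simp add: inv_mult_group m_assoc)
  then show ?thesis
    using le_diff_iff[of "x \<otimes> inv z" "y \<otimes> inv z"] le_diff_iff[of x y] by simp
qed

lemma diff_antimono_iff:
  assumes [simp]: "x \<in> carrier \<Lambda>" "y \<in> carrier \<Lambda>" "z \<in> carrier \<Lambda>"
  shows "z \<otimes> inv x \<preceq> z \<otimes> inv y \<longleftrightarrow> y \<preceq> x"
proof -
  have "(z \<otimes> inv y) \<otimes> inv (z \<otimes> inv x) = x \<otimes> inv y"
    by (simp add: inv_mult_group m_assoc m_lcomm[of "inv y"] m_comm)
  then show ?thesis
    using le_diff_iff[of "z \<otimes> inv x" "z \<otimes> inv y"] le_diff_iff[of y x] by simp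
qed

lemma segment_extremes:
  assumes "is_segment \<Lambda> (carrier \<Lambda>) (ogroup_dist \<Lambda>) S"
  obtains l u where "l \<in> S" "u \<in> S" "S \<subseteq> ogroup_interval \<Lambda> l u"
proof -
  obtain a b f where ab: "a \<in> carrier \<Lambda>" "b \<in> carrier \<Lambda>" "a \<preceq> b"
    and f: "f \<in> ogroup_interval \<Lambda> a b \<rightarrow> carrier \<Lambda>"
    and iso: "\<And>\<mu> \<nu>. \<mu> \<in> ogroup_interval \<Lambda> a b \<Longrightarrow> \<nu> \<in> ogroup_interval \<Lambda> a b \<Longrightarrow>
                ogroup_dist \<Lambda> (f \<mu>) (f \<nu>) = ogroup_dist \<Lambda> \<mu> \<nu>"
    and S: "S = f ` ogroup_interval \<Lambda> a b"
    using assms unfolding is_segment_def segment_between_def by blast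
  have I: "a \<in> ogroup_interval \<Lambda> a b" "b \<in> ogroup_interval \<Lambda> a b"
    using ab le_refl by (auto simp: ogroup_interval_def)
  then have fab: "f a \<in> carrier \<Lambda>" "f b \<in> carrier \<Lambda>" "f a \<in> S" "f b \<in> S"
    using f S by auto
  have near: "ogroup_dist \<Lambda> p (f a) \<preceq> ogroup_dist \<Lambda> (f a) (f b)"
             "ogroup_dist \<Lambda> p (f b) \<preceq> ogroup_dist \<Lambda> (f a) (f b)" "p \<in> carrier \<Lambda>"
    if "p \<in> S" for p
  proof -
    obtain \<mu> where \<mu>: "\<mu> \<in> ogroup_interval \<Lambda> a b" "p = f \<mu>" using \<open>p \<in> S\<close> S by blast
    then have m: "\<mu> \<in> carrier \<Lambda>" "a \<preceq> \<mu>" "\<mu> \<preceq> b" by (auto simp: ogroup_interval_def)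
    show "p \<in> carrier \<Lambda>" using \<mu> f by auto
    show "ogroup_dist \<Lambda> p (f a) \<preceq> ogroup_dist \<Lambda> (f a) (f b)"
      using \<mu> I m ab by (simp add: iso dist_eq diff_mono_iff)
    show "ogroup_dist \<Lambda> p (f b) \<preceq> ogroup_dist \<Lambda> (f a) (f b)"
      using \<mu> I m ab by (simp add: iso dist_eq diff_antimono_iff)
  qed
  have sub: "S \<subseteq> ogroup_interval \<Lambda> l u"
    if lu: "l \<in> carrier \<Lambda>" "u \<in> carrier \<Lambda>" "l \<preceq> u"
      and n: "\<And>p. p \<in> S \<Longrightarrow> p \<in> carrier \<Lambda> \<and> ogroup_dist \<Lambda> p l \<preceq> ogroup_dist \<Lambda> l u \<and>
                ogroup_dist \<Lambda> p u \<preceq> ogroup_dist \<Lambda> l u" for l u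
  proof
    fix p assume "p \<in> S"
    note p = n[OF this]
    have "p \<preceq> u"
    proof (rule ccontr)
      assume "\<not> p \<preceq> u"
      then have "u \<preceq> p" using le_total lu p by blast
      then have "l \<preceq> p" using lu p le_trans by blast
      then have "p \<otimes> inv l \<preceq> u \<otimes> inv l" using p lu dist_eq[of l p] dist_eq[of l u] by simp
      then show False using \<open>\<not> p \<preceq> u\<close> p lu by (simp add: diff_mono_iff)
    qed
    moreover have "l \<preceq> p"
    proof (rule ccontr)
      assume "\<not> l \<preceq> p"
      then have "u \<otimes> inv p \<preceq> u \<otimes> inv l" using p lu \<open>p \<preceq> u\<close> dist_eq[of p u] dist_eq[of l u] by simp
      then show False using \<open>\<not> l \<preceq> p\<close> p lu by (simp add: diff_antimono_iff)
    qed
    ultimately show "p \<in> ogroup_interval \<Lambda> l u" using p by (simp add: ogroup_interval_def)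
  qed
  show thesis
  proof (cases "f a \<preceq> f b")
    case True
    then show thesis using that[of "f a" "f b"] sub[of "f a" "f b"] near fab by blast
  next
    case False
    then have "f b \<preceq> f a" using le_total fab by blast
    then show thesis
      using that[of "f b" "f a"] sub[of "f b" "f a"] near fab dist_sym[of "f a" "f b"] by metis
  qed
qed

lemma interval_is_segment:
  assumes "a \<in> carrier \<Lambda>" "b \<in> carrier \<Lambda>" "a \<preceq> b"
  shows "is_segment \<Lambda> (carrier \<Lambda>) (ogroup_dist \<Lambda>) (ogroup_interval \<Lambda> a b)"
  unfolding is_segment_def segment_between_def
  using assms
  by (intro exI[of _ a] exI[of _ b] bexI[of _ a] bexI[of _ b] exI[of _ "\<lambda>x. x"])
     (auto simp: ogroup_interval_def)

lemma displacement_bound: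
  assumes a: "a \<in> hom \<Lambda> \<Lambda>" and f: "f \<in> carrier \<Lambda> \<rightarrow> carrier \<Lambda>"
    and mono: "\<And>x y. x \<in> carrier \<Lambda> \<Longrightarrow> y \<in> carrier \<Lambda> \<Longrightarrow> x \<preceq> y \<Longrightarrow> f x \<preceq> f y"
    and aff: "\<And>x y. x \<in> carrier \<Lambda> \<Longrightarrow> y \<in> carrier \<Lambda> \<Longrightarrow>
                ogroup_dist \<Lambda> (f x) (f y) = a (ogroup_dist \<Lambda> x y)"
    and dir: "(\<forall>x\<in>carrier \<Lambda>. x \<prec> f x) \<or> (\<forall>x\<in>carrier \<Lambda>. f x \<prec> x)"
    and x: "x \<in> carrier \<Lambda>" and \<mu>: "\<mu> \<in> carrier \<Lambda>"
  shows "ogroup_dist \<Lambda> (a \<mu>) \<mu> \<prec> ogroup_dist \<Lambda> x (f x)"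
proof -
  have ac [simp]: "a y \<in> carrier \<Lambda>" if "y \<in> carrier \<Lambda>" for y using a that by (auto simp: hom_def)
  have fc [simp]: "f y \<in> carrier \<Lambda>" if "y \<in> carrier \<Lambda>" for y using f that by auto
  have am: "a (y \<otimes> z) = a y \<otimes> a z" if "y \<in> carrier \<Lambda>" "z \<in> carrier \<Lambda>" for y z
    using a that by (auto simp: hom_def)
  interpret ah: group_hom \<Lambda> \<Lambda> a by unfold_locales (rule a)
  note [simp] = x \<mu>
  have f_pos: "f (y \<otimes> \<nu>) = f y \<otimes> a \<nu>" if "y \<in> carrier \<Lambda>" "\<nu> \<in> carrier \<Lambda>" "\<one> \<preceq> \<nu>" for y \<nu>
  proof -
    have le: "y \<preceq> y \<otimes> \<nu>" using translation_invariant[of \<one> \<nu> y] that by simp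
    have "f (y \<otimes> \<nu>) \<otimes> inv (f y) = a (y \<otimes> \<nu> \<otimes> inv y)"
      using aff[of "y \<otimes> \<nu>" y] dist_eq(1)[of y "y \<otimes> \<nu>"] dist_eq(1)[of "f y" "f (y \<otimes> \<nu>)"]
        mono[OF _ _ le] le that by simp
    also have "y \<otimes> \<nu> \<otimes> inv y = \<nu>" using that by (simp add: m_ac m_lcomm[of y \<nu>])
    finally show ?thesis using that by (metis ac fc inv_solve_right m_closed m_comm)
  qed
  have f_add: "f (y \<otimes> \<nu>) = f y \<otimes> a \<nu>" if "y \<in> carrier \<Lambda>" "\<nu> \<in> carrier \<Lambda>" for y \<nu>
  proof (cases "\<one> \<preceq> \<nu>")
    case True then show ?thesis using f_pos that by blast
  next
    case False
    then have "\<nu> \<preceq> \<one>" using le_total that by blast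
    then have "\<one> \<preceq> inv \<nu>" using le_diff_iff[of \<nu> \<one>] that by simp
    then have "f (y \<otimes> \<nu> \<otimes> inv \<nu>) = f (y \<otimes> \<nu>) \<otimes> a (inv \<nu>)" using that by (intro f_pos) auto
    then have "f y = f (y \<otimes> \<nu>) \<otimes> inv (a \<nu>)" using that by (simp add: m_assoc)
    then show ?thesis using that by (simp add: m_assoc)
  qed
  define e where "e = f x \<otimes> inv x"
  define t where "t = a \<mu> \<otimes> inv \<mu>"
  have [simp]: "e \<in> carrier \<Lambda>" "t \<in> carrier \<Lambda>" by (auto simp: e_def t_def)
  have e1: "f (x \<otimes> \<mu>) \<otimes> inv (x \<otimes> \<mu>) = e \<otimes> t"
    unfolding f_add[OF x \<mu>] by (simp add: e_def t_def inv_mult_group m_ac)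
  have e2: "f (x \<otimes> inv \<mu>) \<otimes> inv (x \<otimes> inv \<mu>) = e \<otimes> inv t"
    unfolding f_add[OF x inv_closed[OF \<mu>]] by (simp add: e_def t_def inv_mult_group m_ac)
  have dt: "ogroup_dist \<Lambda> (a \<mu>) \<mu> = t \<or> ogroup_dist \<Lambda> (a \<mu>) \<mu> = inv t"
    by (simp add: ogroup_dist_def ogroup_abs_def t_def)
  have eq1: "\<one> = z \<otimes> inv y \<longleftrightarrow> y = z" if "y \<in> carrier \<Lambda>" "z \<in> carrier \<Lambda>" for y z
    using that by (metis inv_solve_right l_one one_closed r_inv)
  have pos_lt: "y \<prec> z" if "\<one> \<prec> z \<otimes> inv y" "y \<in> carrier \<Lambda>" "z \<in> carrier \<Lambda>" for y z
    using that le_diff_iff[of y z] eq1[of y z] unfolding lt_def by blast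
  show ?thesis
    using dir
  proof
    assume up: "\<forall>x\<in>carrier \<Lambda>. x \<prec> f x"
    have pos: "\<one> \<prec> f y \<otimes> inv y" if "y \<in> carrier \<Lambda>" for y
      using bspec[OF up that] le_diff_iff[OF that fc[OF that]] eq1[OF that fc[OF that]]
      unfolding lt_def by blast
    have "\<one> \<prec> e \<otimes> t" "\<one> \<prec> e \<otimes> inv t"
      using pos[of "x \<otimes> \<mu>"] pos[of "x \<otimes> inv \<mu>"] unfolding e1 e2 by simp_all
    then have "inv t \<prec> e" "t \<prec> e"
      using pos_lt[where y = "inv t" and z = e] pos_lt[where y = t and z = e] by simp_all
    moreover have "ogroup_dist \<Lambda> x (f x) = e"
      using up dist_eq(2)[of x "f x"] by (simp add: lt_def e_def)
    ultimately show ?thesis using dt by auto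
  next
    assume down: "\<forall>x\<in>carrier \<Lambda>. f x \<prec> x"
    have neg: "\<one> \<prec> inv (f y \<otimes> inv y)" if "y \<in> carrier \<Lambda>" for y
    proof -
      have "inv (f y \<otimes> inv y) = y \<otimes> inv (f y)" using that by (simp add: inv_mult_group)
      then show ?thesis
        using bspec[OF down that] le_diff_iff[OF fc[OF that] that] eq1[OF fc[OF that] that]
        unfolding lt_def by simp
    qed
    have "\<one> \<prec> inv (e \<otimes> t)" "\<one> \<prec> inv (e \<otimes> inv t)"
      using neg[of "x \<otimes> \<mu>"] neg[of "x \<otimes> inv \<mu>"] unfolding e1 e2 by simp_all
    moreover have "inv (e \<otimes> t) = inv e \<otimes> inv t" "inv (e \<otimes> inv t) = inv e \<otimes> t"
      by (simp_all add: inv_mult_group m_comm)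
    ultimately have "\<one> \<prec> inv e \<otimes> inv t" "\<one> \<prec> inv e \<otimes> t" by simp_all
    then have "inv t \<prec> inv e" "t \<prec> inv e"
      using pos_lt[where y = "inv t" and z = "inv e"] pos_lt[where y = t and z = "inv e"] by simp_all
    moreover have "ogroup_dist \<Lambda> x (f x) = inv e"
      using down dist_eq(1)[of "f x" x] by (simp add: lt_def e_def inv_mult_group)
    ultimately show ?thesis using dt by auto
  qed
qed

lemma rigid_direction:
  assumes f: "f \<in> carrier \<Lambda> \<rightarrow> carrier \<Lambda>" and h: "h \<in> carrier \<Lambda> \<rightarrow> carrier \<Lambda>"
    and hf: "\<And>x. x \<in> carrier \<Lambda> \<Longrightarrow> h (f x) = x"
    and fh: "\<And>x. x \<in> carrier \<Lambda> \<Longrightarrow> f (h x) = x"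
    and mono_f: "\<And>x y. x \<in> carrier \<Lambda> \<Longrightarrow> y \<in> carrier \<Lambda> \<Longrightarrow> x \<preceq> y \<Longrightarrow> f x \<preceq> f y"
    and mono_h: "\<And>x y. x \<in> carrier \<Lambda> \<Longrightarrow> y \<in> carrier \<Lambda> \<Longrightarrow> x \<preceq> y \<Longrightarrow> h x \<preceq> h y"
    and nofix: "\<And>x. x \<in> carrier \<Lambda> \<Longrightarrow> f x \<noteq> x"
    and rf: "\<And>a b. a \<in> carrier \<Lambda> \<Longrightarrow> b \<in> carrier \<Lambda> \<Longrightarrow>
               \<not> f ` ogroup_interval \<Lambda> a b \<subset> ogroup_interval \<Lambda> a b"
    and rh: "\<And>a b. a \<in> carrier \<Lambda> \<Longrightarrow> b \<in> carrier \<Lambda> \<Longrightarrow>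
               \<not> h ` ogroup_interval \<Lambda> a b \<subset> ogroup_interval \<Lambda> a b"
  shows "(\<forall>x\<in>carrier \<Lambda>. x \<prec> f x) \<or> (\<forall>x\<in>carrier \<Lambda>. f x \<prec> x)"
proof (rule ccontr)
  assume "\<not> ?thesis"
  then obtain x y where xy: "x \<in> carrier \<Lambda>" "y \<in> carrier \<Lambda>" "\<not> x \<prec> f x" "\<not> f y \<prec> y" by blast
  have fc: "f x \<in> carrier \<Lambda>" "f y \<in> carrier \<Lambda>" using f xy by auto
  have dn: "f x \<preceq> x" and up: "y \<preceq> f y"
    using xy nofix[of x] nofix[of y] le_total fc unfolding lt_def by metis+
  have shrink: "k ` ogroup_interval \<Lambda> a b \<subset> ogroup_interval \<Lambda> a b"
    if k: "k \<in> carrier \<Lambda> \<rightarrow> carrier \<Lambda>"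
      and mono: "\<And>x y. x \<in> carrier \<Lambda> \<Longrightarrow> y \<in> carrier \<Lambda> \<Longrightarrow> x \<preceq> y \<Longrightarrow> k x \<preceq> k y"
      and ab: "a \<in> carrier \<Lambda>" "b \<in> carrier \<Lambda>" "a \<preceq> b" "a \<preceq> k a" "k b \<preceq> b" "k a \<noteq> a" for k a b
  proof -
    have "k ` ogroup_interval \<Lambda> a b \<subseteq> ogroup_interval \<Lambda> (k a) (k b)"
      using mono ab k by (auto simp: ogroup_interval_def)
    moreover have "ogroup_interval \<Lambda> (k a) (k b) \<subseteq> ogroup_interval \<Lambda> a b"
      using ab k le_trans unfolding ogroup_interval_def by blast
    moreover have "a \<in> ogroup_interval \<Lambda> a b" using ab le_refl by (simp add: ogroup_interval_def)
    moreover have "a \<notin> ogroup_interval \<Lambda> (k a) (k b)"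
      using ab k le_antisym by (auto simp: ogroup_interval_def)
    ultimately show ?thesis by blast
  qed
  show False
  proof (cases "y \<preceq> x")
    case True
    then show False 
      using shrink[OF f mono_f xy(2,1) True up dn nofix[OF xy(2)]] rf[OF xy(2,1)] by simp
  next
    case False
    then have le: "x \<preceq> y" using le_total xy by blast
    have "x \<preceq> h x" using mono_h[of "f x" x] fc dn xy hf by simp
    moreover have "h y \<preceq> y" using mono_h[of y "f y"] fc up xy hf by simp
    moreover have "h x \<noteq> x"
      using fh[of x] nofix[of x] xy by auto
    ultimately show False
      using shrink[OF h mono_h xy(1,2) le] rh[OF xy(1,2)] by simp
  qed
qed

end

lemma tree_essentially_free_linear_iff:
  assumes L: "ordered_abelian_group \<Lambda>" and act: "linear_affine_action G \<Lambda> \<alpha> \<phi>"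
  shows "tree_essentially_free G \<Lambda> (carrier \<Lambda>) (ogroup_dist \<Lambda>) \<alpha> \<phi> \<longleftrightarrow>
           linear_essentially_free G \<Lambda> \<phi>"
proof
  interpret ordered_abelian_group \<Lambda> by (rule L)
  assume T: "tree_essentially_free G \<Lambda> (carrier \<Lambda>) (ogroup_dist \<Lambda>) \<alpha> \<phi>"
  show "linear_essentially_free G \<Lambda> \<phi>"
    unfolding linear_essentially_free_def
  proof (intro ballI impI conjI)
    fix g assume g: "g \<in> carrier G" "g \<noteq> \<one>\<^bsub>G\<^esub>"
    show "linear_hyperbolic \<Lambda> \<phi> g"
      using T g by (auto simp: tree_essentially_free_def tree_hyperbolic_def linear_hyperbolic_def)
    have r: "tree_rigid G \<Lambda> (carrier \<Lambda>) (ogroup_dist \<Lambda>) \<phi> g"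
      using T g by (auto simp: tree_essentially_free_def)
    show "linear_rigid G \<Lambda> \<phi> g"
      unfolding linear_rigid_def
    proof (intro ballI)
      fix a b assume ab: "a \<in> carrier \<Lambda>" "b \<in> carrier \<Lambda>"
      show "\<not> \<phi> g ` ogroup_interval \<Lambda> a b \<subset> ogroup_interval \<Lambda> a b \<and>
            \<not> \<phi> (inv\<^bsub>G\<^esub> g) ` ogroup_interval \<Lambda> a b \<subset> ogroup_interval \<Lambda> a b"
      proof (cases "a \<preceq>\<^bsub>\<Lambda>\<^esub> b")
        case True
        then show ?thesis using r interval_is_segment ab unfolding tree_rigid_def by blast
      next
        case False
        then have "ogroup_interval \<Lambda> a b = {}"
          using ab le_trans unfolding ogroup_interval_def by blast
        then show ?thesis by simp
      qed
    qed
  qed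
next
  interpret ordered_abelian_group \<Lambda> by (rule L)
  assume E: "linear_essentially_free G \<Lambda> \<phi>"
  from act have ga: "group_action G (carrier \<Lambda>) \<phi>" and ah: "\<alpha> \<in> hom G (Aut_plus \<Lambda>)"
    and aff: "\<And>g x y. g \<in> carrier G \<Longrightarrow> x \<in> carrier \<Lambda> \<Longrightarrow> y \<in> carrier \<Lambda> \<Longrightarrow>
                ogroup_dist \<Lambda> (\<phi> g x) (\<phi> g y) = \<alpha> g (ogroup_dist \<Lambda> x y)"
    and mono: "\<And>g x y. g \<in> carrier G \<Longrightarrow> x \<in> carrier \<Lambda> \<Longrightarrow> y \<in> carrier \<Lambda> \<Longrightarrow>
                x \<preceq>\<^bsub>\<Lambda>\<^esub> y \<Longrightarrow> \<phi> g x \<preceq>\<^bsub>\<Lambda>\<^esub> \<phi> g y"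
    by (auto simp: linear_affine_action_def affine_action_def)
  interpret A: group_action G "carrier \<Lambda>" \<phi> by (rule ga)
  interpret G: group G using A.group_hom by (rule group_hom.axioms(1))
  show "tree_essentially_free G \<Lambda> (carrier \<Lambda>) (ogroup_dist \<Lambda>) \<alpha> \<phi>"
    unfolding tree_essentially_free_def
  proof (intro ballI impI)
    fix g assume g: "g \<in> carrier G" "g \<noteq> \<one>\<^bsub>G\<^esub>"
    have hyp: "\<And>x. x \<in> carrier \<Lambda> \<Longrightarrow> \<phi> g x \<noteq> x"
      using E g by (auto simp: linear_essentially_free_def linear_hyperbolic_def)
    have rig: "\<And>a b. a \<in> carrier \<Lambda> \<Longrightarrow> b \<in> carrier \<Lambda> \<Longrightarrow>
                 \<not> \<phi> g ` ogroup_interval \<Lambda> a b \<subset> ogroup_interval \<Lambda> a b"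
              "\<And>a b. a \<in> carrier \<Lambda> \<Longrightarrow> b \<in> carrier \<Lambda> \<Longrightarrow>
                 \<not> \<phi> (inv\<^bsub>G\<^esub> g) ` ogroup_interval \<Lambda> a b \<subset> ogroup_interval \<Lambda> a b"
      using E g by (auto simp: linear_essentially_free_def linear_rigid_def)
    have ig: "inv\<^bsub>G\<^esub> g \<in> carrier G" using g by simp
    have clos: "\<phi> k x \<in> carrier \<Lambda>" if "k \<in> carrier G" "x \<in> carrier \<Lambda>" for k x
      using A.element_image that by blast
    have inv1: "\<phi> (inv\<^bsub>G\<^esub> g) (\<phi> g x) = x" and inv2: "\<phi> g (\<phi> (inv\<^bsub>G\<^esub> g) x) = x"
      if "x \<in> carrier \<Lambda>" for x
      using that g ig A.orbit_sym_aux[of g x "\<phi> g x"]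
        A.orbit_sym_aux[of "inv\<^bsub>G\<^esub> g" x "\<phi> (inv\<^bsub>G\<^esub> g) x"] by simp_all
    have dir: "(\<forall>x\<in>carrier \<Lambda>. x \<prec>\<^bsub>\<Lambda>\<^esub> \<phi> g x) \<or> (\<forall>x\<in>carrier \<Lambda>. \<phi> g x \<prec>\<^bsub>\<Lambda>\<^esub> x)"
      by (rule rigid_direction[where h = "\<phi> (inv\<^bsub>G\<^esub> g)"])
         (use clos g ig inv1 inv2 mono hyp rig in auto)
    have dir': "(\<forall>x\<in>carrier \<Lambda>. x \<prec>\<^bsub>\<Lambda>\<^esub> \<phi> (inv\<^bsub>G\<^esub> g) x) \<or>
                (\<forall>x\<in>carrier \<Lambda>. \<phi> (inv\<^bsub>G\<^esub> g) x \<prec>\<^bsub>\<Lambda>\<^esub> x)"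
      using dir clos[OF ig] inv2 by metis
    have no_shrink: "\<not> k ` S \<subset> S"
      if S: "is_segment \<Lambda> (carrier \<Lambda>) (ogroup_dist \<Lambda>) S"
        and k: "(\<forall>x\<in>carrier \<Lambda>. x \<prec>\<^bsub>\<Lambda>\<^esub> k x) \<or> (\<forall>x\<in>carrier \<Lambda>. k x \<prec>\<^bsub>\<Lambda>\<^esub> x)" for k S
    proof
      assume sub: "k ` S \<subset> S"
      obtain l u where lu: "l \<in> S" "u \<in> S" "S \<subseteq> ogroup_interval \<Lambda> l u"
        using segment_extremes[OF S] .
      have "k u \<in> S" "k l \<in> S" using sub lu by auto
      then have "u \<in> carrier \<Lambda>" "l \<in> carrier \<Lambda>" "k u \<in> carrier \<Lambda>" "k l \<in> carrier \<Lambda>"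
        "k u \<preceq>\<^bsub>\<Lambda>\<^esub> u" "l \<preceq>\<^bsub>\<Lambda>\<^esub> k l"
        using lu by (auto simp: ogroup_interval_def)
      then show False using k le_antisym unfolding lt_def by metis
    qed
    have "\<phi> g (\<phi> g x) \<noteq> x" if x: "x \<in> carrier \<Lambda>" for x
    proof
      assume eq: "\<phi> g (\<phi> g x) = x"
      show False
        using dir clos[OF g(1) x] x eq le_antisym[of x "\<phi> g x"] unfolding lt_def by metis
    qed
    then have "tree_hyperbolic (carrier \<Lambda>) \<phi> g"
      using hyp by (simp add: tree_hyperbolic_def)
    moreover have "tree_rigid G \<Lambda> (carrier \<Lambda>) (ogroup_dist \<Lambda>) \<phi> g"
      using no_shrink dir dir' unfolding tree_rigid_def by blast
    moreover have "\<alpha> g \<in> hom \<Lambda> \<Lambda>"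
      using ah g by (auto simp: hom_def[of G] Aut_plus_def auto_def)
    then have "\<forall>x\<in>carrier \<Lambda>. \<forall>\<mu>\<in>carrier \<Lambda>.
        ogroup_dist \<Lambda> (\<alpha> g \<mu>) \<mu> \<prec>\<^bsub>\<Lambda>\<^esub> ogroup_dist \<Lambda> x (\<phi> g x)"
      using displacement_bound[of "\<alpha> g" "\<phi> g"] mono[OF g(1)] aff[OF g(1)] clos[OF g(1)] dir
      by (metis Pi_I)
    ultimately show "tree_hyperbolic (carrier \<Lambda>) \<phi> g \<and>
        tree_rigid G \<Lambda> (carrier \<Lambda>) (ogroup_dist \<Lambda>) \<phi> g \<and>
        (\<forall>x\<in>carrier \<Lambda>. \<forall>\<mu>\<in>carrier \<Lambda>.
           ogroup_dist \<Lambda> (\<alpha> g \<mu>) \<mu> \<prec>\<^bsub>\<Lambda>\<^esub> ogroup_dist \<Lambda> x (\<phi> g x))"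
      by blast
  qed
qed

text \<open>HOL cannot quantify over types inside a formula, so \<open>\<Lambda>\<close> and \<open>X\<close> have their elements in a
  fixed type built from that of the group. This loses no generality: all conditions on
  \<open>(\<Lambda>, X)\<close> are first-order (a symbol for each group element), so by the downward
  Loewenheim-Skolem theorem any example can be cut down to one of cardinality at most that of
  \<open>nat \<times> 'a\<close>, which embeds into \<open>'a universe\<close>.\<close>

type_synonym 'a universe = "('a \<Rightarrow> int) set"

definition ATFe :: "('a, 'm) monoid_scheme \<Rightarrow> bool" where
  "ATFe G \<longleftrightarrow>
     (\<exists>(\<Lambda> :: 'a universe ogroup) (X :: 'a universe set) d \<alpha> \<phi>.
        ordered_abelian_group \<Lambda> \<and> Lambda_tree \<Lambda> X d \<and>
        affine_action G \<Lambda> X d \<alpha> \<phi> \<and> tree_essentially_free G \<Lambda> X d \<alpha> \<phi>)"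

end

theory Submission
  imports Defs "HOL-Computational_Algebra.Formal_Power_Series" "HOL-Algebra.Elementary_Groups"
    "HOL-Library.Function_Algebras"
begin

text \<open>
A function \<open>f\<close> on a group is polynomial if iterated left differences \<open>x \<mapsto> f (y x) - f x\<close>
eventually vanish. Everything rests on one property of a group \<open>G\<close>: the polynomial functions
\<open>G \<rightarrow> \<rat>\<close> separate every non-trivial element from the identity (\<open>poly_separated\<close>).

This property yields the action. Let \<open>\<Delta>\<close> be the augmentation ideal of the integral group ring. The
group acts on \<open>1 + \<Delta>\<close> by left multiplication, hence affinely on \<open>\<Delta>\<close>, by
\<open>y \<mapsto> g y + (g - 1)\<close>. Polynomial functions are functionals on \<open>\<Delta>\<close>; line them up by degree (and by
an arbitrary well-order within a degree), and let the sign of an element of \<open>\<Delta>\<close> be the sign of the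
first functional that does not vanish on it. On \<open>g y - y\<close> a functional \<open>f\<close> takes the value on \<open>y\<close> of
a left difference of \<open>f\<close>, which comes earlier in the line; so left multiplication preserves signs.
The displacement of \<open>y\<close> is \<open>(g - 1) + (g - 1) y\<close>, and on \<open>(g - 1) y\<close> the functional \<open>f\<close> takes values
which right differences of \<open>f\<close> take on \<open>g - 1\<close>. Hence the first functional that does not vanish on
\<open>g - 1\<close> decides the sign of all displacements: \<open>g\<close> moves all points in the same direction, which is
rigidity and hyperbolicity in one (\<open>cone_of_poly_separated\<close>). Dividing by the elements on which all
polynomial functions vanish gives \<open>\<Lambda>\<close> (locale \<open>cone_action\<close>). All conditions on the set of
non-negative elements are finitary, so such sets for the finitely generated subgroups of \<open>G\<close> have a
limit along an ultrafilter (\<open>cone_of_local_cones\<close>); this is how a local hypothesis suffices.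

It remains to find polynomial functions. In a finitely generated torsion-free nilpotent group, an
element \<open>g \<noteq> 1\<close> has infinite order, the exponent is a polynomial function on the cyclic group of \<open>g\<close>,
and polynomial functions extend step by step along a chain of subgroups, each generated by the
previous one and an element that normalises it (\<open>poly_fun_extend_cyclic\<close>). For right-angled Artin
groups and free products, Magnus expansions do it: in a product \<open>s\<^sub>1 \<cdots> s\<^sub>k\<close> of syllables,
substitute \<open>s = 1 + (s - 1)\<close> and expand. The coefficients are polynomial functions of the product, and
for a reduced word the coefficient of \<open>(s\<^sub>1 - 1) \<cdots> (s\<^sub>k - 1)\<close> can be made non-zero
(\<open>integer_syllable_poly_separated\<close>, \<open>free_syllable_poly_separated\<close>). Free groups are right-angled
Artin groups without commuting generators, and polynomial functions pull back along quotient maps,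
which settles residually free groups. Finally, an ordered abelian group is a tree over itself, and on
it the two notions of essential freeness agree.
\<close>

section \<open>Polynomial functions on groups\<close>

text \<open>The degree of \<open>f\<close> is less than the \<open>nat\<close> argument, and \<open>\<Gamma>\<close> is a filtration by weight: elements
of \<open>\<Gamma> n\<close> have weight \<open>n + 1\<close>, and differences along them lower the degree by \<open>n + 1\<close>. Truncation of
\<open>d - n\<close> at \<open>0\<close> expresses that differences along elements whose weight exceeds the degree vanish.\<close>

fun filtered_poly ::
    "('a, 'm) monoid_scheme \<Rightarrow> (nat \<Rightarrow> 'a set) \<Rightarrow> nat \<Rightarrow> ('a \<Rightarrow> rat) \<Rightarrow> bool" where
  "filtered_poly G \<Gamma> 0 f \<longleftrightarrow> (\<forall>x\<in>carrier G. f x = 0)"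
| "filtered_poly G \<Gamma> (Suc d) f \<longleftrightarrow>
     (\<forall>n. \<forall>y\<in>\<Gamma> n. filtered_poly G \<Gamma> (d - n) (\<lambda>x. f (y \<otimes>\<^bsub>G\<^esub> x) - f x))"

locale filtered_group = group +
  fixes \<Gamma> :: "nat \<Rightarrow> 'a set"
  assumes filter_0: "\<Gamma> 0 = carrier G"
    and filter_subset: "\<Gamma> n \<subseteq> carrier G"
begin

abbreviation poly_below :: "nat \<Rightarrow> ('a \<Rightarrow> rat) \<Rightarrow> bool" where
  "poly_below \<equiv> filtered_poly G \<Gamma>"

lemma filter_closed: "y \<in> \<Gamma> n \<Longrightarrow> y \<in> carrier G"
  using filter_subset by blast

lemma poly_below_cong:
  "(\<And>x. x \<in> carrier G \<Longrightarrow> f x = g x) \<Longrightarrow> poly_below d f = poly_below d g"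
proof (induction d arbitrary: f g rule: less_induct)
  case (less d)
  show ?case
  proof (cases d)
    case 0
    then show ?thesis using less.prems by simp
  next
    case (Suc e)
    have "poly_below (e - n) (\<lambda>x. f (y \<otimes> x) - f x) = poly_below (e - n) (\<lambda>x. g (y \<otimes> x) - g x)"
      if "y \<in> \<Gamma> n" for n y
      by (rule less.IH) (use Suc that less.prems filter_closed in auto)
    then show ?thesis unfolding Suc by simp
  qed
qed

lemma poly_below_zero: "(\<And>x. x \<in> carrier G \<Longrightarrow> f x = 0) \<Longrightarrow> poly_below d f"
proof (induction d arbitrary: f rule: less_induct)
  case (less d)
  then show ?case by (cases d) (auto simp: filter_closed)
qed

lemma poly_below_add:
  "poly_below d f \<Longrightarrow> poly_below d g \<Longrightarrow> poly_below d (\<lambda>x. f x + g x)"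
proof (induction d arbitrary: f g rule: less_induct)
  case (less d)
  show ?case
  proof (cases d)
    case 0
    then show ?thesis using less.prems by simp
  next
    case (Suc e)
    have "poly_below (e - n) (\<lambda>x. f (y \<otimes> x) + g (y \<otimes> x) - (f x + g x))" if "y \<in> \<Gamma> n" for n y
    proof -
      have "poly_below (e - n) (\<lambda>x. (f (y \<otimes> x) - f x) + (g (y \<otimes> x) - g x))"
        by (rule less.IH) (use Suc less.prems that in auto)
      then show ?thesis by (simp add: algebra_simps)
    qed
    then show ?thesis unfolding Suc by simp
  qed
qed

lemma poly_below_scale: "poly_below d f \<Longrightarrow> poly_below d (\<lambda>x. c * f x)"
proof (induction d arbitrary: f rule: less_induct)
  case (less d)
  show ?case
  proof (cases d)
    case 0
    then show ?thesis using less.prems by simp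
  next
    case (Suc e)
    have "poly_below (e - n) (\<lambda>x. c * f (y \<otimes> x) - c * f x)" if "y \<in> \<Gamma> n" for n y
    proof -
      have "poly_below (e - n) (\<lambda>x. c * (f (y \<otimes> x) - f x))"
        by (rule less.IH) (use Suc less.prems that in auto)
      then show ?thesis by (simp add: algebra_simps)
    qed
    then show ?thesis unfolding Suc by simp
  qed
qed

lemma poly_below_sum:
  assumes "\<And>i. i \<in> I \<Longrightarrow> poly_below d (f i)"
  shows "poly_below d (\<lambda>x. \<Sum>i\<in>I. f i x)"
  using assms
  by (induction I rule: infinite_finite_induct) (auto intro: poly_below_add poly_below_zero)

lemma poly_below_Suc: "poly_below d f \<Longrightarrow> poly_below (Suc d) f"
proof (induction d arbitrary: f rule: less_induct)
  case (less d)
  show ?case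
  proof (cases d)
    case 0
    then show ?thesis using less.prems by (auto simp: filter_closed)
  next
    case (Suc e)
    have "poly_below (Suc e - n) (\<lambda>x. f (y \<otimes> x) - f x)" if y: "y \<in> \<Gamma> n" for n y
    proof -
      have *: "poly_below (e - n) (\<lambda>x. f (y \<otimes> x) - f x)" using less.prems y Suc by simp
      show ?thesis
      proof (cases "n \<le> e")
        case True
        then show ?thesis using less.IH[OF _ *] Suc by (simp add: Suc_diff_le)
      next
        case False
        then show ?thesis using * by simp
      qed
    qed
    then show ?thesis unfolding Suc by simp
  qed
qed

lemma poly_below_mono: "poly_below d f \<Longrightarrow> d \<le> e \<Longrightarrow> poly_below e f"
  by (induction e) (auto simp: le_Suc_eq intro: poly_below_Suc simp del: filtered_poly.simps(2))

lemma poly_below_ldiff: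
  assumes "poly_below (Suc d) f" "y \<in> carrier G"
  shows "poly_below d (\<lambda>x. f (y \<otimes> x) - f x)"
  using assms filter_0 by (auto dest!: spec[of _ 0])

lemma poly_below_const:
  assumes f: "poly_below (Suc 0) f" and x: "x \<in> carrier G"
  shows "f x = f \<one>"
proof -
  have "\<forall>z\<in>carrier G. f (x \<otimes> z) - f z = 0"
    using poly_below_ldiff[OF f x] by simp
  from bspec[OF this one_closed] show ?thesis using x by simp
qed

lemma poly_below_ltrans:
  assumes "poly_below d f" "y \<in> carrier G"
  shows "poly_below d (\<lambda>x. f (y \<otimes> x))"
proof (cases d)
  case 0
  then show ?thesis using assms by simp
next
  case (Suc e)
  have "poly_below d (\<lambda>x. f (y \<otimes> x) - f x)"
    using poly_below_ldiff[of e f y] assms Suc poly_below_Suc by blast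
  from poly_below_add[OF this assms(1)] show ?thesis by simp
qed

text \<open>Left and right differences commute with each other, so right differences lower the degree as
well.\<close>

lemma poly_below_rdiff:
  "poly_below (Suc d) f \<Longrightarrow> h \<in> carrier G \<Longrightarrow> poly_below d (\<lambda>x. f (x \<otimes> h) - f x)"
proof (induction d arbitrary: f rule: less_induct)
  case (less d)
  show ?case
  proof (cases d)
    case 0
    have "f (x \<otimes> h) - f x = 0" if "x \<in> carrier G" for x
      using poly_below_const[OF less.prems(1)[unfolded 0]] that less.prems(2) m_closed
      by (metis diff_self)
    then show ?thesis using 0 by simp
  next
    case (Suc e)
    have "poly_below (e - n) (\<lambda>x. (f (y \<otimes> x \<otimes> h) - f (y \<otimes> x)) - (f (x \<otimes> h) - f x))"
      if y: "y \<in> \<Gamma> n" for n y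
    proof -
      have *: "poly_below (Suc e - n) (\<lambda>x. f (y \<otimes> x) - f x)"
        using less.prems(1) y unfolding Suc by simp
      have "poly_below (e - n) (\<lambda>x. (f (y \<otimes> (x \<otimes> h)) - f (x \<otimes> h)) - (f (y \<otimes> x) - f x))"
      proof (cases "n \<le> e")
        case True
        then show ?thesis
          using less.IH[of "e - n" "\<lambda>x. f (y \<otimes> x) - f x"] * Suc less.prems(2)
          by (simp add: Suc_diff_le del: filtered_poly.simps(2))
      next
        case False
        then have "\<And>x. x \<in> carrier G \<Longrightarrow> f (y \<otimes> x) - f x = 0" using * by simp
        then show ?thesis using less.prems(2) by (intro poly_below_zero) simp
      qed
      then show ?thesis
        by (rule poly_below_cong[THEN iffD1, rotated])
           (use filter_closed[OF y] less.prems(2) in \<open>simp add: m_assoc algebra_simps\<close>)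
    qed
    then show ?thesis unfolding Suc by simp
  qed
qed

end

text \<open>The ordinary degree is the weighted one when no element has weight above one.\<close>

definition trivial_filtration :: "('a, 'm) monoid_scheme \<Rightarrow> nat \<Rightarrow> 'a set" where
  "trivial_filtration G n = (if n = 0 then carrier G else {})"

abbreviation poly_fun :: "('a, 'm) monoid_scheme \<Rightarrow> nat \<Rightarrow> ('a \<Rightarrow> rat) \<Rightarrow> bool" where
  "poly_fun G \<equiv> filtered_poly G (trivial_filtration G)"

lemma filtered_group_trivial: "group G \<Longrightarrow> filtered_group G (trivial_filtration G)"
  by (intro filtered_group.intro filtered_group_axioms.intro) (auto simp: trivial_filtration_def)

lemma poly_fun_Suc:
  "poly_fun G (Suc d) f \<longleftrightarrow>
     (\<forall>y\<in>carrier G. poly_fun G d (\<lambda>x. f (y \<otimes>\<^bsub>G\<^esub> x) - f x))"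
  unfolding filtered_poly.simps trivial_filtration_def by auto

text \<open>Polynomial functions arise as matrix coefficients of unipotent actions: \<open>c\<close> ranges over a
filtered space, \<open>F c\<close> is the coefficient of \<open>c\<close>, and translation by \<open>y\<close> changes \<open>c\<close> only by something
one level down.\<close>

lemma poly_fun_of_levels:
  assumes zero: "\<And>c x. A 0 c \<Longrightarrow> x \<in> carrier G \<Longrightarrow> F c x = 0"
    and step: "\<And>n c y. A (Suc n) c \<Longrightarrow> y \<in> carrier G \<Longrightarrow>
      \<exists>c'. A n c' \<and> (\<forall>x\<in>carrier G. F c (y \<otimes>\<^bsub>G\<^esub> x) - F c x = F c' x)"
    and G: "group G" and c: "A n c"
  shows "poly_fun G n (F c)"
  using c
proof (induction n arbitrary: c)
  case 0
  then show ?case using zero by simp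
next
  case (Suc n)
  interpret filtered_group G "trivial_filtration G" by (rule filtered_group_trivial[OF G])
  show ?case unfolding poly_fun_Suc
  proof
    fix y assume "y \<in> carrier G"
    from step[OF Suc.prems this] obtain c' where
      c': "A n c'" "\<And>x. x \<in> carrier G \<Longrightarrow> F c (y \<otimes>\<^bsub>G\<^esub> x) - F c x = F c' x" by blast
    from Suc.IH[OF c'(1)] show "poly_fun G n (\<lambda>x. F c (y \<otimes>\<^bsub>G\<^esub> x) - F c x)"
      by (rule poly_below_cong[THEN iffD1, rotated]) (use c' in simp)
  qed
qed

lemma poly_fun_hom:
  assumes h: "h \<in> hom G H" and G: "group G" and H: "group H" and f: "poly_fun H n f"
  shows "poly_fun G n (f \<circ> h)"
proof (rule poly_fun_of_levels[where A = "poly_fun H" and F = "\<lambda>f. f \<circ> h"])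
  fix n f y
  assume f: "poly_fun H (Suc n) f" and y: "y \<in> carrier G"
  then have "poly_fun H n (\<lambda>x. f (h y \<otimes>\<^bsub>H\<^esub> x) - f x)"
    using h unfolding poly_fun_Suc by (auto simp: hom_def)
  then show "\<exists>f'. poly_fun H n f' \<and>
      (\<forall>x\<in>carrier G. (f \<circ> h) (y \<otimes>\<^bsub>G\<^esub> x) - (f \<circ> h) x = (f' \<circ> h) x)"
    by (intro exI[of _ "\<lambda>x. f (h y \<otimes>\<^bsub>H\<^esub> x) - f x"] conjI) (use h y in \<open>auto simp: hom_def\<close>)
qed (use assms in \<open>auto simp: hom_def\<close>)

text \<open>Dually, the rational dimension subgroups of \<open>G\<close> have trivial intersection.\<close>

definition poly_separated :: "('a, 'm) monoid_scheme \<Rightarrow> bool" where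
  "poly_separated G \<longleftrightarrow> group G \<and>
     (\<forall>g\<in>carrier G. g \<noteq> \<one>\<^bsub>G\<^esub> \<longrightarrow> (\<exists>n f. poly_fun G n f \<and> f g \<noteq> f \<one>\<^bsub>G\<^esub>))"

text \<open>Polynomial functions on a quotient pull back to the group.\<close>

lemma poly_separated_residually:
  assumes "residually P G" and P: "\<And>N. N \<lhd> G \<Longrightarrow> P (G Mod N) \<Longrightarrow> poly_separated (G Mod N)"
  shows "poly_separated G"
  unfolding poly_separated_def
proof (intro conjI ballI impI)
  show G: "group G" using assms by (simp add: residually_def)
  fix g assume g: "g \<in> carrier G" "g \<noteq> \<one>\<^bsub>G\<^esub>"
  then obtain N where N: "N \<lhd> G" "P (G Mod N)" "N #>\<^bsub>G\<^esub> g \<noteq> \<one>\<^bsub>G Mod N\<^esub>"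
    using assms(1) unfolding residually_def by blast
  interpret N: normal N G by (rule N(1))
  have h: "(\<lambda>x. N #>\<^bsub>G\<^esub> x) \<in> hom G (G Mod N)" by (rule N.r_coset_hom_Mod)
  have q: "group (G Mod N)" by (rule N.factorgroup_is_group)
  have hg: "N #>\<^bsub>G\<^esub> g \<in> carrier (G Mod N)" using h g unfolding hom_def by blast
  obtain n f where f: "poly_fun (G Mod N) n f" "f (N #>\<^bsub>G\<^esub> g) \<noteq> f \<one>\<^bsub>G Mod N\<^esub>"
    using P[OF N(1,2)] N(3) hg unfolding poly_separated_def by blast
  have "N #>\<^bsub>G\<^esub> \<one>\<^bsub>G\<^esub> = \<one>\<^bsub>G Mod N\<^esub>" using h G q by (metis hom_one)
  then show "\<exists>n f. poly_fun G n f \<and> f g \<noteq> f \<one>\<^bsub>G\<^esub>"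
    using poly_fun_hom[OF h G q f(1)] f(2) by (intro exI[of _ n]) (auto simp: comp_def)
qed

section \<open>The lower central series\<close>

declare lower_central.simps(2) [simp del]

context group
begin

lemma lower_central_normal: "lower_central G n \<lhd> G"
proof (induction n)
  case 0
  then show ?case using normal_self by simp
next
  case (Suc n)
  interpret N: normal "lower_central G n" G by (rule Suc)
  show ?case unfolding lower_central.simps
  proof (rule normal_generateI)
    fix h g assume "h \<in> {x \<otimes> y \<otimes> inv x \<otimes> inv y | x y. x \<in> lower_central G n \<and> y \<in> carrier G}"
      and g: "g \<in> carrier G"
    then obtain x y where h: "h = x \<otimes> y \<otimes> inv x \<otimes> inv y" and
      x: "x \<in> lower_central G n" and y: "y \<in> carrier G" by blast
    have xc: "x \<in> carrier G" using x N.subset by blast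
    define x' y' where "x' = g \<otimes> x \<otimes> inv g" and "y' = g \<otimes> y \<otimes> inv g"
    have cancel: "inv g \<otimes> (g \<otimes> a) = a" if "a \<in> carrier G" for a
      using that g by (simp flip: m_assoc)
    have "g \<otimes> h \<otimes> inv g = x' \<otimes> y' \<otimes> inv x' \<otimes> inv y'"
      unfolding h x'_def y'_def using g xc y by (simp add: m_assoc inv_mult_group cancel)
    moreover have "x' \<in> lower_central G n" unfolding x'_def using N.inv_op_closed2[OF g x] .
    moreover have "y' \<in> carrier G" unfolding y'_def using g y by simp
    ultimately show "g \<otimes> h \<otimes> inv g \<in>
        {x \<otimes> y \<otimes> inv x \<otimes> inv y | x y. x \<in> lower_central G n \<and> y \<in> carrier G}" by blast
  qed (use N.subset in auto)
qed

lemma lower_central_subgroup: "subgroup (lower_central G n) G"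
  using lower_central_normal normal_def by blast

lemma lower_central_closed [simp]: "x \<in> lower_central G n \<Longrightarrow> x \<in> carrier G"
  using lower_central_subgroup subgroup.subset by blast

lemma commutator_in_lower_central:
  "x \<in> lower_central G n \<Longrightarrow> y \<in> carrier G \<Longrightarrow>
     x \<otimes> y \<otimes> inv x \<otimes> inv y \<in> lower_central G (Suc n)"
  unfolding lower_central.simps by (rule generate.incl) blast

lemma lower_central_antimono: "lower_central G (Suc n) \<subseteq> lower_central G n"
proof -
  interpret N: normal "lower_central G n" G by (rule lower_central_normal)
  have "x \<otimes> y \<otimes> inv x \<otimes> inv y \<in> lower_central G n"
    if "x \<in> lower_central G n" "y \<in> carrier G" for x y
  proof -
    have "x \<otimes> (y \<otimes> inv x \<otimes> inv y) \<in> lower_central G n"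
      using that(1) N.inv_op_closed2[OF that(2) N.m_inv_closed[OF that(1)]] by (rule N.m_closed)
    then show ?thesis using that by (simp add: m_assoc)
  qed
  then show ?thesis
    unfolding lower_central.simps using lower_central_subgroup
    by (intro generate_subgroup_incl) auto
qed

lemma lower_central_trivial:
  assumes "lower_central G n = {\<one>}" "n \<le> m"
  shows "lower_central G m = {\<one>}"
  using assms(2)
proof (induction m rule: dec_induct)
  case base
  then show ?case using assms by simp
next
  case (step m)
  then show ?case
    using lower_central_antimono[of m] subgroup.one_closed[OF lower_central_subgroup, of "Suc m"]
    by auto
qed

lemma filtered_group_lower_central:
  assumes "subgroup K G"
  shows "filtered_group (G\<lparr>carrier := K\<rparr>) (\<lambda>n. K \<inter> lower_central G n)"
  using subgroup.subgroup_is_group[OF assms is_group] subgroup.subset[OF assms]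
  by (intro filtered_group.intro filtered_group_axioms.intro) auto

text \<open>Weights are taken from the lower central series because conjugation by an element of \<open>G\<close> changes
an element of one term by a factor in the next. This makes conjugation unipotent on functions of
bounded weighted degree, with a drop of one; for the ordinary degree it already fails for
homomorphisms from a non-central abelian subgroup.\<close>

abbreviation weighted_poly :: "'a set \<Rightarrow> nat \<Rightarrow> ('a \<Rightarrow> rat) \<Rightarrow> bool" where
  "weighted_poly K \<equiv> filtered_poly (G\<lparr>carrier := K\<rparr>) (\<lambda>n. K \<inter> lower_central G n)"

text \<open>Write \<open>t y t\<inverse> = z = y k\<close>, where \<open>k\<close> lies one term deeper than \<open>y\<close>. The difference along \<open>y\<close> of
\<open>f (t x t\<inverse>) - f x\<close> is the same expression for the left difference of \<open>f\<close> along \<open>z\<close>, plus a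
difference along \<open>k\<close> of a left translate of \<open>f\<close>. The first has lower degree by induction, the second
because of the weight of \<open>k\<close>.\<close>

lemma weighted_poly_conj_diff:
  assumes K: "subgroup K G" and t: "t \<in> carrier G"
    and norm: "\<And>x. x \<in> K \<Longrightarrow> t \<otimes> x \<otimes> inv t \<in> K"
  shows "weighted_poly K (Suc d) f \<Longrightarrow> weighted_poly K d (\<lambda>x. f (t \<otimes> x \<otimes> inv t) - f x)"
proof (induction d arbitrary: f rule: less_induct)
  case (less d)
  interpret K: subgroup K G by (rule K)
  interpret F: filtered_group "G\<lparr>carrier := K\<rparr>" "\<lambda>n. K \<inter> lower_central G n"
    by (rule filtered_group_lower_central[OF K])
  show ?case
  proof (cases d)
    case 0
    have "f x = f \<one>\<^bsub>G\<lparr>carrier := K\<rparr>\<^esub>" if "x \<in> K" for x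
      by (rule F.poly_below_const[OF less.prems[unfolded 0]]) (simp add: that)
    then have "f (t \<otimes> x \<otimes> inv t) - f x = 0" if "x \<in> K" for x
      using norm that by (metis diff_self)
    then show ?thesis using 0 by simp
  next
    case (Suc e)
    have "weighted_poly K (e - n)
        (\<lambda>x. f (t \<otimes> (y \<otimes> x) \<otimes> inv t) - f (y \<otimes> x) - (f (t \<otimes> x \<otimes> inv t) - f x))"
      if y: "y \<in> K" "y \<in> lower_central G n" for n y
    proof -
      have yc: "y \<in> carrier G" using y by simp
      define z where "z = t \<otimes> y \<otimes> inv t"
      define k where "k = inv y \<otimes> t \<otimes> inv (inv y) \<otimes> inv t"
      have kc: "k \<in> carrier G" using t yc by (simp add: k_def)
      have z: "z = y \<otimes> k" using t yc by (simp add: z_def k_def flip: m_assoc)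
      have zK: "z \<in> K" using norm y by (simp add: z_def)
      have k: "k \<in> lower_central G (Suc n)" unfolding k_def
        using commutator_in_lower_central[of "inv y" n t] t y
          subgroup.m_inv_closed[OF lower_central_subgroup] by simp
      have kK: "k \<in> K"
      proof -
        have "k = inv y \<otimes> z" using z yc kc by (simp flip: m_assoc)
        then show ?thesis using zK y by simp
      qed
      have zn: "z \<in> lower_central G n"
        using z y k lower_central_antimono subgroup.m_closed[OF lower_central_subgroup] by blast
      define u where "u = (\<lambda>x. f (z \<otimes> x) - f x)"
      have u: "weighted_poly K (Suc e - n) u"
        using less.prems zK zn unfolding Suc u_def by simp
      have 1: "weighted_poly K (e - n) (\<lambda>x. u (t \<otimes> x \<otimes> inv t) - u x)"
      proof (cases "n \<le> e")
        case True
        then show ?thesis using less.IH[of "e - n" u] u Suc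
          by (simp add: Suc_diff_le del: filtered_poly.simps(2))
      next
        case False
        then show ?thesis using u norm by (intro F.poly_below_zero) auto
      qed
      have lt: "weighted_poly K (Suc (Suc e)) (\<lambda>x. f (y \<otimes> x))"
        using F.poly_below_ltrans[OF less.prems] y Suc by simp
      have "weighted_poly K (Suc e - Suc n) (\<lambda>x. f (y \<otimes> (k \<otimes> x)) - f (y \<otimes> x))"
        using spec[OF lt[unfolded filtered_poly.simps(2)[where d = "Suc e"]], of "Suc n"] k kK
        by simp
      then have 2: "weighted_poly K (e - n) (\<lambda>x. f (y \<otimes> (k \<otimes> x)) - f (y \<otimes> x))" by simp
      have conj: "t \<otimes> (y \<otimes> x) \<otimes> inv t = z \<otimes> (t \<otimes> x \<otimes> inv t)" if "x \<in> K" for x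
        using that t yc K.subset unfolding z_def by (simp add: m_assoc subsetD inv_solve_left)
      show ?thesis
        by (rule F.poly_below_cong[THEN iffD1, OF _ F.poly_below_add[OF 1 2]])
           (use conj y K.subset k in \<open>simp add: u_def z m_assoc subsetD\<close>)
    qed
    then show ?thesis unfolding Suc by simp
  qed
qed

text \<open>Only the identity has a weight above \<open>Suc c\<close>, so a difference costs at most \<open>Suc c\<close> in weighted
degree.\<close>

lemma weighted_poly_of_poly_fun:
  assumes K: "subgroup K G" and triv: "lower_central G (Suc c) = {\<one>}"
  shows "poly_fun (G\<lparr>carrier := K\<rparr>) d f \<Longrightarrow> weighted_poly K (Suc c * d) f"
proof (induction d arbitrary: f)
  case 0
  then show ?case by simp
next
  case (Suc d)
  interpret K: subgroup K G by (rule K)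
  interpret F: filtered_group "G\<lparr>carrier := K\<rparr>" "\<lambda>n. K \<inter> lower_central G n"
    by (rule filtered_group_lower_central[OF K])
  have "weighted_poly K (c + Suc c * d - n) (\<lambda>x. f (y \<otimes> x) - f x)"
    if y: "y \<in> K" "y \<in> lower_central G n" for y n
  proof (cases "n \<le> c")
    case True
    have "weighted_poly K (Suc c * d) (\<lambda>x. f (y \<otimes> x) - f x)"
      using Suc y unfolding poly_fun_Suc by simp
    then show ?thesis by (rule F.poly_below_mono) (use True in simp)
  next
    case False
    then have "y = \<one>" using lower_central_trivial[OF triv, of n] y by simp
    then show ?thesis using K.subset by (intro F.poly_below_zero) auto
  qed
  then show ?case by (simp add: add.commute)
qed

end

section \<open>Fractional right translations\<close>

definition rdiff :: "('a, 'm) monoid_scheme \<Rightarrow> 'a \<Rightarrow> ('a \<Rightarrow> rat) \<Rightarrow> 'a \<Rightarrow> rat" where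
  "rdiff G l f x = f (x \<otimes>\<^bsub>G\<^esub> l) - f x"

text \<open>Right translation by \<open>l\<close> is \<open>1 + rdiff G l\<close> with a nilpotent second summand, so it has powers with
any rational exponent \<open>s\<close>, given by the binomial series. Terms from \<open>N\<close> on vanish on functions of
degree below \<open>N\<close>.\<close>

definition frac_trans ::
    "('a, 'm) monoid_scheme \<Rightarrow> 'a \<Rightarrow> nat \<Rightarrow> rat \<Rightarrow> ('a \<Rightarrow> rat) \<Rightarrow> 'a \<Rightarrow> rat" where
  "frac_trans G l N s f x = (\<Sum>i<N. (s gchoose i) * (rdiff G l ^^ i) f x)"

lemma rdiff_pow_sum:
  "(rdiff G l ^^ i) (\<lambda>x. \<Sum>k\<in>A. c k * f k x) = (\<lambda>x. \<Sum>k\<in>A. c k * (rdiff G l ^^ i) (f k) x)"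
proof (induction i)
  case (Suc i)
  then show ?case
    by (simp add: rdiff_def fun_eq_iff sum_subtractf right_diff_distrib)
qed simp

lemma triangle_sum:
  fixes a :: "nat \<Rightarrow> rat"
  assumes "\<And>r. r \<ge> N \<Longrightarrow> a r = 0"
  shows "(\<Sum>i<N. \<Sum>k<N. g i k * a (i + k)) = (\<Sum>r<N. (\<Sum>i\<le>r. g i (r - i)) * a r)"
proof -
  have "(\<Sum>i<N. \<Sum>k<N. g i k * a (i + k)) = (\<Sum>(i,k)\<in>{..<N} \<times> {..<N}. g i k * a (i + k))"
    by (rule sum.cartesian_product)
  also have "\<dots> = (\<Sum>(i,k)\<in>{(i, k). i + k < N}. g i k * a (i + k))"
    by (rule sum.mono_neutral_right) (use assms in \<open>auto simp flip: not_le\<close>)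
  also have "\<dots> = (\<Sum>r<N. \<Sum>i\<le>r. g i (r - i) * a (i + (r - i)))"
    by (rule sum.triangle_reindex)
  also have "\<dots> = (\<Sum>r<N. (\<Sum>i\<le>r. g i (r - i)) * a r)"
    by (simp add: sum_distrib_right)
  finally show ?thesis .
qed

context filtered_group
begin

context
  fixes l and N :: nat
  assumes l: "l \<in> carrier G"
begin

abbreviation "shift s \<equiv> frac_trans G l N s"

lemma poly_below_rdiff_pow:
  "poly_below d f \<Longrightarrow> poly_below (d - i) ((rdiff G l ^^ i) f)"
proof (induction i)
  case (Suc i)
  show ?case
  proof (cases "d - i")
    case 0
    then have "\<And>x. x \<in> carrier G \<Longrightarrow> (rdiff G l ^^ i) f x = 0" using Suc by simp
    then show ?thesis using l by (intro poly_below_zero) (simp add: rdiff_def[of G l "(rdiff G l ^^ i) f"])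
  next
    case (Suc e)
    then have "poly_below (Suc e) ((rdiff G l ^^ i) f)" using Suc.IH Suc.prems by simp
    moreover have "d - Suc i = e" using Suc by simp
    moreover have "(rdiff G l ^^ Suc i) f = (\<lambda>x. (rdiff G l ^^ i) f (x \<otimes> l) - (rdiff G l ^^ i) f x)"
      by (simp add: rdiff_def[of G l "(rdiff G l ^^ i) f"] fun_eq_iff)
    ultimately show ?thesis using poly_below_rdiff l by metis
  qed
qed simp

lemma rdiff_pow_zero:
  assumes "poly_below N f" "N \<le> i" "x \<in> carrier G"
  shows "(rdiff G l ^^ i) f x = 0"
  using poly_below_rdiff_pow[OF assms(1), of i] assms(2,3) by simp

lemma rdiff_pow_cong:
  assumes "\<And>x. x \<in> carrier G \<Longrightarrow> f x = g x"
  shows "x \<in> carrier G \<Longrightarrow> (rdiff G l ^^ i) f x = (rdiff G l ^^ i) g x"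
proof (induction i arbitrary: x)
  case (Suc i)
  then show ?case using l by (simp add: rdiff_def)
qed (use assms in simp)

lemma shift_cong:
  assumes "\<And>x. x \<in> carrier G \<Longrightarrow> f x = g x" "x \<in> carrier G"
  shows "shift s f x = shift s g x"
  unfolding frac_trans_def using rdiff_pow_cong[of f g] assms by simp

lemma shift_diff: "shift s (\<lambda>x. f x - g x) x = shift s f x - shift s g x"
proof -
  have "(rdiff G l ^^ i) (\<lambda>x. f x - g x) = (\<lambda>x. (rdiff G l ^^ i) f x - (rdiff G l ^^ i) g x)" for i
    by (induction i) (simp_all add: rdiff_def fun_eq_iff)
  then show ?thesis by (simp add: frac_trans_def sum_subtractf right_diff_distrib)
qed

text \<open>The exponent law is Vandermonde's identity.\<close>

lemma shift_add:
  assumes f: "poly_below N f" and x: "x \<in> carrier G"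
  shows "shift s (shift u f) x = shift (s + u) f x"
proof -
  have "(rdiff G l ^^ i) (shift u f) = (\<lambda>x. \<Sum>k<N. (u gchoose k) * (rdiff G l ^^ (i + k)) f x)" for i
    unfolding frac_trans_def[abs_def] rdiff_pow_sum funpow_add by simp
  then have "shift s (shift u f) x =
      (\<Sum>i<N. \<Sum>k<N. ((s gchoose i) * (u gchoose k)) * (rdiff G l ^^ (i + k)) f x)"
    unfolding frac_trans_def[of _ _ _ s "shift u f"] by (simp add: sum_distrib_left mult.assoc)
  also have "\<dots> = (\<Sum>r<N. (\<Sum>i\<le>r. (s gchoose i) * (u gchoose (r - i))) * (rdiff G l ^^ r) f x)"
    by (rule triangle_sum) (use rdiff_pow_zero[OF f _ x] in blast)
  also have "\<dots> = shift (s + u) f x"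
    unfolding frac_trans_def atMost_atLeast0 gbinomial_Vandermonde ..
  finally show ?thesis .
qed

lemma shift_0:
  assumes "poly_below N f" "x \<in> carrier G"
  shows "shift 0 f x = f x"
proof (cases N)
  case 0
  then show ?thesis using assms by (simp add: frac_trans_def)
next
  case (Suc n)
  have "shift 0 f x = (0 gchoose 0) * (rdiff G l ^^ 0) f x +
      (\<Sum>i<n. (0 gchoose Suc i) * (rdiff G l ^^ Suc i) f x)"
    unfolding frac_trans_def Suc by (rule sum.lessThan_Suc_shift)
  then show ?thesis by simp
qed

lemma shift_1:
  assumes f: "poly_below N f" and x: "x \<in> carrier G"
  shows "shift 1 f x = f (x \<otimes> l)"
proof -
  have "shift 1 f x = (\<Sum>i<N. of_nat (1 choose i) * (rdiff G l ^^ i) f x)"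
    unfolding frac_trans_def by (simp add: binomial_gbinomial)
  also have "\<dots> = (\<Sum>i\<in>{..<2}. of_nat (1 choose i) * (rdiff G l ^^ i) f x)"
    using rdiff_pow_zero[OF f _ x]
    by (intro sum.mono_neutral_cong) (auto simp: not_less binomial_eq_0)
  also have "\<dots> = f (x \<otimes> l)" by (simp add: numeral_2_eq_2 rdiff_def)
  finally show ?thesis .
qed

lemma poly_below_shift:
  assumes "poly_below d f"
  shows "poly_below d (shift s f)"
  unfolding frac_trans_def[abs_def]
  by (intro poly_below_sum poly_below_scale poly_below_mono[OF poly_below_rdiff_pow[OF assms]]) simp

lemma poly_below_shift_diff:
  assumes f: "poly_below (Suc d) f" and d: "Suc d \<le> N"
  shows "poly_below d (\<lambda>x. shift s f x - f x)"
proof -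
  obtain n where N: "N = Suc n" using d by (cases N) auto
  have "shift s f x - f x = (\<Sum>i<n. (s gchoose Suc i) * (rdiff G l ^^ Suc i) f x)" for x
    unfolding frac_trans_def N by (subst sum.lessThan_Suc_shift) simp
  moreover have "poly_below d (\<lambda>x. \<Sum>i<n. (s gchoose Suc i) * (rdiff G l ^^ Suc i) f x)"
    by (intro poly_below_sum poly_below_scale poly_below_mono[OF poly_below_rdiff_pow[OF f]]) simp
  ultimately show ?thesis by simp
qed

lemma shift_nat:
  assumes f: "poly_below N f"
  shows "x \<in> carrier G \<Longrightarrow> shift (of_nat n) f x = f (x \<otimes> l [^] n)"
proof (induction n arbitrary: x)
  case 0
  then show ?case using shift_0[OF f] by simp
next
  case (Suc n)
  have "shift (of_nat (Suc n)) f x = shift 1 (shift (of_nat n) f) x"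
    using shift_add[OF f Suc.prems, of 1 "of_nat n"] by simp
  also have "\<dots> = shift (of_nat n) f (x \<otimes> l)"
    by (rule shift_1[OF poly_below_shift[OF f] Suc.prems])
  also have "\<dots> = f (x \<otimes> l \<otimes> l [^] n)" using Suc l by simp
  also have "x \<otimes> l \<otimes> l [^] n = x \<otimes> l [^] Suc n"
    using Suc.prems l nat_pow_Suc2[OF l, of n] by (metis m_assoc nat_pow_closed)
  finally show ?case .
qed

lemma shift_int:
  assumes f: "poly_below N f" and x: "x \<in> carrier G"
  shows "shift (of_int m) f x = f (x \<otimes> l [^] m)"
proof (cases "m \<ge> 0")
  case True
  then obtain n where "m = int n" using nonneg_int_cases by blast
  then show ?thesis using shift_nat[where n = n, OF f x] by (simp add: int_pow_int)
next
  case False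
  then obtain n where m: "m = - int n" by (metis nle_le nonneg_int_cases neg_0_le_iff_le minus_minus)
  define y where "y = x \<otimes> l [^] m"
  have y: "y \<in> carrier G" "y \<otimes> l [^] n = x"
    using x l by (simp_all add: y_def m int_pow_neg int_pow_int m_assoc)
  have "f y = shift (of_nat n + of_int m) f y" using shift_0[OF f y(1)] by (simp add: m)
  also have "\<dots> = shift (of_nat n) (shift (of_int m) f) y" by (simp add: shift_add[OF f y(1)])
  also have "\<dots> = shift (of_int m) f x"
    using shift_nat[where n = n, OF poly_below_shift[where s = "of_int m", OF f] y(1)] y(2) by simp
  finally show ?thesis by (simp add: y_def)
qed

end
end

section \<open>Extending polynomial functions along cyclic extensions\<close>

lemma int_subgroup_cyclic:
  fixes S :: "int set"
  assumes "0 \<in> S" and diff: "\<And>i j. i \<in> S \<Longrightarrow> j \<in> S \<Longrightarrow> i - j \<in> S"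
  obtains q where "\<And>j. j \<in> S \<longleftrightarrow> q dvd j"
proof (cases "\<exists>n::nat. n > 0 \<and> int n \<in> S")
  case False
  have "j = 0" if "j \<in> S" for j
  proof (rule ccontr)
    assume "j \<noteq> 0"
    moreover have "- j \<in> S" using diff[OF assms(1) that] by simp
    ultimately have "int (nat \<bar>j\<bar>) \<in> S \<and> nat \<bar>j\<bar> > 0" using that by (auto simp: abs_if)
    then show False using False by blast
  qed
  then show thesis using that[of 0] assms(1) by auto
next
  case True
  define n where "n = (LEAST n::nat. n > 0 \<and> int n \<in> S)"
  have n: "n > 0" "int n \<in> S" using LeastI_ex[OF True] by (auto simp: n_def)
  have least: "m \<ge> n" if "m > 0" "int m \<in> S" for m
    unfolding n_def by (rule Least_le) (use that in simp)
  have add: "i + j \<in> S" if "i \<in> S" "j \<in> S" for i j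
    using diff[OF that(1) diff[OF assms(1) that(2)]] by simp
  have nat_mult: "int k * int n \<in> S" for k
    by (induction k) (use assms(1) n add in \<open>auto simp: algebra_simps\<close>)
  have mult: "i * int n \<in> S" for i
  proof (cases "i \<ge> 0")
    case True
    then show ?thesis using nat_mult[of "nat i"] by simp
  next
    case False
    then show ?thesis using diff[OF assms(1) nat_mult[of "nat (- i)"]] by simp
  qed
  have "int n dvd j" if "j \<in> S" for j
  proof -
    have "j mod int n \<in> S"
      using diff[OF that mult[of "j div int n"]] by (simp add: minus_div_mult_eq_mod)
    moreover have "j mod int n < int n" "j mod int n \<ge> 0" using n by simp_all
    ultimately have "j mod int n = 0" using least[of "nat (j mod int n)"] by force
    then show ?thesis by auto
  qed
  moreover have "j \<in> S" if "int n dvd j" for j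
    using that mult by (auto simp: dvd_def mult.commute)
  ultimately show thesis using that[of "int n"] by blast
qed

context group
begin

lemma conj_nat_pow:
  assumes K: "subgroup K G" and t: "t \<in> carrier G"
    and norm: "\<And>x. x \<in> K \<Longrightarrow> t \<otimes> x \<otimes> inv t \<in> K"
  shows "x \<in> K \<Longrightarrow> t [^] (n::nat) \<otimes> x \<otimes> inv (t [^] n) \<in> K"
proof (induction n arbitrary: x)
  case 0
  then show ?case using subgroup.subset[OF K] by auto
next
  case (Suc n)
  have "t [^] Suc n \<otimes> x \<otimes> inv (t [^] Suc n) = t [^] n \<otimes> (t \<otimes> x \<otimes> inv t) \<otimes> inv (t [^] n)"
    using subgroup.mem_carrier[OF K Suc.prems] t by (simp add: m_assoc inv_mult_group)
  then show ?case using Suc.IH[OF norm[OF Suc.prems]] by simp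
qed

lemma conj_int_pow:
  assumes K: "subgroup K G" and t: "t \<in> carrier G"
    and norm: "\<And>x. x \<in> K \<Longrightarrow> t \<otimes> x \<otimes> inv t \<in> K" "\<And>x. x \<in> K \<Longrightarrow> inv t \<otimes> x \<otimes> t \<in> K"
    and x: "x \<in> K"
  shows "t [^] (i::int) \<otimes> x \<otimes> inv (t [^] i) \<in> K"
proof (cases "i \<ge> 0")
  case True
  then obtain n where "i = int n" using nonneg_int_cases by blast
  then show ?thesis using conj_nat_pow[OF K t norm(1) x, of n] by (simp add: int_pow_int)
next
  case False
  then obtain n where i: "i = - int n" by (metis nle_le nonneg_int_cases neg_0_le_iff_le minus_minus)
  show ?thesis
    using conj_nat_pow[OF K inv_closed[OF t] _ x, of n] norm(2) t
    by (simp add: i int_pow_neg int_pow_int nat_pow_inv)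
qed

lemma cyclic_extension_elements:
  assumes K: "subgroup K G" and t: "t \<in> carrier G"
    and norm: "\<And>x. x \<in> K \<Longrightarrow> t \<otimes> x \<otimes> inv t \<in> K" "\<And>x. x \<in> K \<Longrightarrow> inv t \<otimes> x \<otimes> t \<in> K"
    and g: "g \<in> generate G (insert t K)"
  shows "\<exists>x\<in>K. \<exists>j::int. g = x \<otimes> t [^] j"
  using g
proof (induction rule: generate.induct)
  case one
  then show ?case using subgroup.one_closed[OF K] by (intro bexI[of _ \<one>] exI[of _ 0]) auto
next
  case (incl h)
  then consider "h = t" | "h \<in> K" by blast
  then show ?case
  proof cases
    case 1
    then show ?thesis
      using subgroup.one_closed[OF K] t by (intro bexI[of _ \<one>] exI[of _ 1]) auto
  next
    case 2
    then show ?thesis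
      using subgroup.mem_carrier[OF K] by (intro bexI[of _ h] exI[of _ 0]) auto
  qed
next
  case (inv h)
  then consider "h = t" | "h \<in> K" by blast
  then show ?case
  proof cases
    case 1
    then show ?thesis
      using subgroup.one_closed[OF K] t
      by (intro bexI[of _ \<one>] exI[of _ "-1"]) (auto simp: int_pow_neg)
  next
    case 2
    then show ?thesis
      using subgroup.mem_carrier[OF K] subgroup.m_inv_closed[OF K]
      by (intro bexI[of _ "inv h"] exI[of _ 0]) auto
  qed
next
  case (eng g h)
  then obtain x y i j where xy: "x \<in> K" "y \<in> K" "g = x \<otimes> t [^] (i::int)" "h = y \<otimes> t [^] (j::int)"
    by blast
  have c: "x \<in> carrier G" "y \<in> carrier G" using xy subgroup.mem_carrier[OF K] by auto
  have "g \<otimes> h = (x \<otimes> (t [^] i \<otimes> y \<otimes> inv (t [^] i))) \<otimes> t [^] (i + j)"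
    using c t by (simp add: xy m_assoc int_pow_mult inv_solve_left)
  then show ?case
    using subgroup.m_closed[OF K xy(1) conj_int_pow[OF K t norm xy(2)]] by blast
qed

text \<open>Let \<open>l = t\<^sup>q\<close> generate the intersection of \<open>K\<close> with the cyclic group of \<open>t\<close>, and let \<open>R\<close> be right
translation by \<open>l\<close>. An extension is forced to be \<open>F (x t\<^sup>j) = (R\<^bsup>j/q\<^esup> f) x\<close> if \<open>q > 0\<close>, since
\<open>t\<close> then acts like a \<open>q\<close>-th root of \<open>l\<close>. If the intersection is trivial, then \<open>q = 0\<close>, and the
convention \<open>j / 0 = 0\<close> turns the same formula into \<open>F (x t\<^sup>j) = f x\<close>. Left translation by
\<open>y t\<^sup>i\<close> amounts to replacing \<open>f\<close> by \<open>R\<^bsup>i/q\<^esup>\<close> of \<open>x \<mapsto> f (y t\<^sup>i x t\<^sup>-\<^sup>i)\<close>. It is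
composed of a left translation, a conjugation and a fractional right translation, each of which
changes \<open>f\<close> only by something of lower weighted degree.\<close>

theorem poly_fun_extend_cyclic:
  assumes K: "subgroup K G" and t: "t \<in> carrier G"
    and norm: "\<And>x. x \<in> K \<Longrightarrow> t \<otimes> x \<otimes> inv t \<in> K" "\<And>x. x \<in> K \<Longrightarrow> inv t \<otimes> x \<otimes> t \<in> K"
    and triv: "lower_central G (Suc c) = {\<one>}"
    and f: "poly_fun (G\<lparr>carrier := K\<rparr>) d f"
  shows "\<exists>m F. poly_fun (G\<lparr>carrier := generate G (insert t K)\<rparr>) m F \<and> (\<forall>x\<in>K. F x = f x)"
proof -
  interpret K: subgroup K G by (rule K)
  interpret F: filtered_group "G\<lparr>carrier := K\<rparr>" "\<lambda>n. K \<inter> lower_central G n"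
    by (rule filtered_group_lower_central[OF K])
  define N where "N = Suc c * d"
  have fN: "weighted_poly K N f" unfolding N_def by (rule weighted_poly_of_poly_fun[OF K triv f])
  have L: "subgroup (generate G (insert t K)) G" (is "subgroup ?L G")
    using t K.subset by (intro generate_is_subgroup) auto
  have Kc [simp]: "x \<in> carrier G" if "x \<in> K" for x using that K.subset by blast
  note [simp] = t
  have "\<exists>q. \<forall>j::int. t [^] j \<in> K \<longleftrightarrow> q dvd j"
  proof (rule int_subgroup_cyclic[of "{j::int. t [^] j \<in> K}"])
    show "i - j \<in> {j. t [^] j \<in> K}" if "i \<in> {j. t [^] j \<in> K}" "j \<in> {j. t [^] j \<in> K}" for i j :: int
      using that by (simp add: int_pow_diff[OF t])
  qed auto
  then obtain q where q: "\<And>j::int. t [^] j \<in> K \<longleftrightarrow> q dvd j" by blast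
  define l where "l = t [^] q"
  have l: "l \<in> K" using q by (simp add: l_def)
  have lpow: "l [^]\<^bsub>G\<lparr>carrier := K\<rparr>\<^esub> m = t [^] (q * m)" for m :: int
    using int_pow_consistent[OF K l, of m] by (simp add: l_def int_pow_pow)
  define E where "E s h x = frac_trans (G\<lparr>carrier := K\<rparr>) l N s h x" for s h x
  have E_add: "E s (E u h) x = E (s + u) h x" if "weighted_poly K N h" "x \<in> K" for s u h x
    using F.shift_add[where N = N and l = l and s = s and u = u and f = h and x = x] l that
    unfolding E_def[abs_def] by simp
  have E_int: "E (of_int m) h x = h (x \<otimes> t [^] (q * m))" if "weighted_poly K N h" "x \<in> K" for m h x
    using F.shift_int[where N = N and l = l and f = h and x = x and m = m] l that
    unfolding E_def[abs_def] lpow by simp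
  have E_poly: "weighted_poly K N (E s h)" if "weighted_poly K N h" for s h
    using F.poly_below_shift[where N = N and l = l and f = h and s = s and d = N] l that
    unfolding E_def[abs_def] by simp

  \<comment> \<open>Two representations \<open>x t\<^sup>i = y t\<^sup>j\<close> of an element differ by a power of \<open>l\<close>.\<close>
  have wd: "E (of_int i / of_int q) h x = E (of_int j / of_int q) h y"
    if h: "weighted_poly K N h" and xy: "x \<in> K" "y \<in> K" "x \<otimes> t [^] i = y \<otimes> t [^] j"
    for h x y and i j :: int
  proof -
    have "inv y \<otimes> x \<otimes> t [^] i = inv y \<otimes> (y \<otimes> t [^] j)" using xy by (simp add: m_assoc)
    also have "\<dots> = t [^] j" using xy(2) by (simp flip: m_assoc)
    finally have "t [^] j = inv y \<otimes> x \<otimes> t [^] i" ..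
    then have "inv y \<otimes> x = t [^] (j - i)"
      unfolding int_pow_diff[OF t] using xy(1,2) by (simp add: inv_solve_right)
    moreover have "inv y \<otimes> x \<in> K" using xy by simp
    ultimately obtain m where m: "j - i = q * m" using q by (metis dvdE)
    have x: "x = y \<otimes> t [^] (q * m)"
    proof -
      have "x = y \<otimes> (inv y \<otimes> x)" using xy(1,2) by (simp flip: m_assoc)
      then show ?thesis using \<open>inv y \<otimes> x = _\<close> unfolding m by simp
    qed
    show ?thesis
    proof (cases "q = 0")
      case True
      then show ?thesis using x m xy by simp
    next
      case False
      then have "of_int j / of_int q = (of_int m + of_int i / of_int q :: rat)"
        using m by (simp add: field_simps flip: of_int_mult of_int_add)
      then have "E (of_int j / of_int q) h y = E (of_int m) (E (of_int i / of_int q) h) y"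
        using E_add[OF h xy(2)] by simp
      also have "\<dots> = E (of_int i / of_int q) h x"
        unfolding x by (rule E_int[OF E_poly[OF h] xy(2)])
      finally show ?thesis by simp
    qed
  qed
  define rep where "rep g = (SOME p. fst p \<in> K \<and> g = fst p \<otimes> t [^] (snd p :: int))" for g
  define \<F> where "\<F> h g = E (of_int (snd (rep g)) / of_int q) h (fst (rep g))" for h g
  have \<F>: "\<F> h (x \<otimes> t [^] j) = E (of_int j / of_int q) h x"
    if h: "weighted_poly K N h" and x: "x \<in> K" for h x and j :: int
  proof -
    have "\<exists>p. fst p \<in> K \<and> x \<otimes> t [^] j = fst p \<otimes> t [^] (snd p :: int)"
      by (rule exI[of _ "(x, j)"]) (use x in simp)
    note p = someI_ex[OF this, folded rep_def]
    show ?thesis unfolding \<F>_def by (rule wd[OF h x conjunct1[OF p] conjunct2[OF p], symmetric])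
  qed
  \<comment> \<open>The bound \<open>n \<le> N\<close> keeps the truncated binomial series exact on all functions that occur.\<close>
  have "\<exists>h'. (n \<le> N \<and> weighted_poly K n h') \<and> (\<forall>x\<in>?L. \<F> h (g \<otimes> x) - \<F> h x = \<F> h' x)"
    if h: "Suc n \<le> N" "weighted_poly K (Suc n) h" and g: "g \<in> ?L" for n h g
  proof -
    obtain y i where y: "y \<in> K" and gy: "g = y \<otimes> t [^] (i::int)"
      using cyclic_extension_elements[OF K t norm g] by blast
    define cj where "cj x = t [^] i \<otimes> x \<otimes> inv (t [^] i)" for x
    have cjK: "cj x \<in> K" if "x \<in> K" for x
      using conj_int_pow[OF K t norm that] by (simp add: cj_def)
    define k where "k = (\<lambda>x. h (y \<otimes> cj x))"
    define h' where "h' = (\<lambda>x. E (of_int i / of_int q) k x - h x)"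
    have 1: "weighted_poly K n (\<lambda>x. h (y \<otimes> x) - h x)"
      using F.poly_below_ldiff[OF h(2)] y by simp
    have 2: "weighted_poly K (Suc n) (\<lambda>x. h (y \<otimes> x))"
      using F.poly_below_ltrans[OF h(2)] y by (simp del: filtered_poly.simps)
    have 3: "weighted_poly K n (\<lambda>x. k x - h (y \<otimes> x))"
      unfolding k_def cj_def
      by (rule weighted_poly_conj_diff[OF K _ _ 2]) (use cjK in \<open>simp_all add: cj_def\<close>)
    have k: "weighted_poly K (Suc n) k"
      using F.poly_below_add[OF F.poly_below_Suc[OF 3] 2] by (simp del: filtered_poly.simps)
    have 4: "weighted_poly K n (\<lambda>x. E (of_int i / of_int q) k x - k x)"
      using F.poly_below_shift_diff[OF _ k h(1), of l] l unfolding E_def by simp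
    have h': "weighted_poly K n h'"
      using F.poly_below_add[OF 4 F.poly_below_add[OF 3 1]] by (simp add: h'_def)
    note mono = F.poly_below_mono[OF _ h(1)] F.poly_below_mono[OF _ Suc_leD[OF h(1)]]
    have "\<F> h (g \<otimes> u) - \<F> h u = \<F> h' u" if u: "u \<in> ?L" for u
    proof -
      obtain x j where x: "x \<in> K" and ux: "u = x \<otimes> t [^] (j::int)"
        using cyclic_extension_elements[OF K t norm u] by blast
      have "g \<otimes> u = (y \<otimes> cj x) \<otimes> t [^] (i + j)"
        using x y by (simp add: gy ux cj_def m_assoc int_pow_mult inv_solve_left)
      then have "\<F> h (g \<otimes> u) = E (of_int (i + j) / of_int q) h (y \<otimes> cj x)"
        using \<F>[OF mono(1)[OF h(2)] K.m_closed[OF y cjK[OF x]]] by simp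
      also have "\<dots> = E (of_int (i + j) / of_int q) k x"
      proof -
        have "(rdiff (G\<lparr>carrier := K\<rparr>) l ^^ r) h (y \<otimes> cj z) = (rdiff (G\<lparr>carrier := K\<rparr>) l ^^ r) k z"
          if "z \<in> K" for r z
          using that
        proof (induction r arbitrary: z)
          case 0
          then show ?case by (simp add: k_def)
        next
          case (Suc r)
          have comm: "t [^] i \<otimes> l = l \<otimes> t [^] i"
            unfolding l_def by (simp add: add.commute flip: int_pow_mult)
          have "cj (z \<otimes> l) = cj z \<otimes> l"
          proof -
            have "cj (z \<otimes> l) = t [^] i \<otimes> z \<otimes> (l \<otimes> inv (t [^] i))"
              using Suc.prems l by (simp add: cj_def m_assoc)
            also have "l \<otimes> inv (t [^] i) = inv (t [^] i) \<otimes> l"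
              using comm l by (metis Kc inv_closed int_pow_closed inv_solve_left inv_solve_right m_assoc m_closed t)
            finally show ?thesis using Suc.prems l by (simp add: cj_def m_assoc)
          qed
          then have "y \<otimes> cj z \<otimes> l = y \<otimes> cj (z \<otimes> l)"
            using Suc.prems y l cjK by (simp add: m_assoc)
          then show ?case using Suc l by (simp add: rdiff_def)
        qed
        then show ?thesis unfolding E_def frac_trans_def using x by simp
      qed
      also have "\<dots> = E (of_int j / of_int q) (E (of_int i / of_int q) k) x"
        using E_add[OF mono(1)[OF k] x] by (simp add: add_divide_distrib add.commute)
      finally have "\<F> h (g \<otimes> u) - \<F> h u =
          E (of_int j / of_int q) (E (of_int i / of_int q) k) x - E (of_int j / of_int q) h x"
        using \<F>[OF mono(1)[OF h(2)] x] ux by simp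
      also have "\<dots> = E (of_int j / of_int q) h' x"
        using F.shift_diff[where l = l and N = N] l unfolding h'_def E_def[abs_def] by simp
      also have "\<dots> = \<F> h' u" using \<F>[OF mono(2)[OF h'] x] ux by simp
      finally show ?thesis .
    qed
    then show ?thesis using h' h(1) by (intro exI[of _ h']) auto
  qed
  moreover have "\<F> h x = 0" if h: "weighted_poly K 0 h" and x: "x \<in> ?L" for h x
  proof -
    obtain y i where y: "y \<in> K" and xy: "x = y \<otimes> t [^] (i::int)"
      using cyclic_extension_elements[OF K t norm x] by blast
    have "\<F> h x = E (of_int i / of_int q) h y"
      unfolding xy by (rule \<F>[OF F.poly_below_mono[OF h] y]) simp
    also have "\<dots> = E (of_int i / of_int q) (\<lambda>_. 0) y"
      using F.shift_cong[where l = l and N = N and x = y and g = "\<lambda>_. 0" and f = h] l y h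
      unfolding E_def by simp
    also have "\<dots> = 0" using F.shift_diff[where l = l and N = N and f = h and g = h and x = y] l
      unfolding E_def by simp
    finally show ?thesis .
  qed
  ultimately have "poly_fun (G\<lparr>carrier := ?L\<rparr>) N (\<F> f)"
    using fN subgroup.subgroup_is_group[OF L is_group]
    by (intro poly_fun_of_levels[where A = "\<lambda>n h. n \<le> N \<and> weighted_poly K n h" and F = \<F>]) auto
  moreover have "\<F> f x = f x" if x: "x \<in> K" for x
    using \<F>[OF fN x, of 0] E_int[OF fN x, of 0] x by simp
  ultimately show ?thesis by blast
qed

end

section \<open>Finitely generated torsion-free nilpotent groups\<close>

context group
begin

abbreviation commutator :: "'a \<Rightarrow> 'a \<Rightarrow> 'a" where
  "commutator x y \<equiv> x \<otimes> y \<otimes> inv x \<otimes> inv y"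

lemma inv_cancel_left [simp]:
  "x \<in> carrier G \<Longrightarrow> y \<in> carrier G \<Longrightarrow> inv x \<otimes> (x \<otimes> y) = y"
  "x \<in> carrier G \<Longrightarrow> y \<in> carrier G \<Longrightarrow> x \<otimes> (inv x \<otimes> y) = y"
  by (simp_all flip: m_assoc)

text \<open>Modulo a normal subgroup that contains the term after the next one, commutators of elements of
one term with elements of \<open>G\<close> are multiplicative in both arguments. So the commutators of generators
generate the next term, up to the one that follows it.\<close>

lemma lower_central_finitely_generated:
  assumes S: "finite S" "S \<subseteq> carrier G" "generate G S = carrier G"
  shows "\<exists>X. finite X \<and> X \<subseteq> lower_central G n \<and>
           lower_central G n = generate G (lower_central G (Suc n) \<union> X)"
proof (induction n)
  case 0
  have "carrier G \<subseteq> generate G (lower_central G (Suc 0) \<union> S)"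
    using mono_generate[of S "lower_central G (Suc 0) \<union> S"] S(3) by auto
  moreover have "generate G (lower_central G (Suc 0) \<union> S) \<subseteq> carrier G"
    using S(2) by (intro generate_incl) auto
  ultimately show ?case using S by (intro exI[of _ S]) auto
next
  case (Suc n)
  let ?\<gamma> = "lower_central G"
  from Suc obtain X where X: "finite X" "X \<subseteq> ?\<gamma> n"
    "?\<gamma> n = generate G (?\<gamma> (Suc n) \<union> X)" by blast
  define X' where "X' = (\<lambda>(x, s). commutator x s) ` (X \<times> S)"
  define M where "M = generate G (?\<gamma> (Suc (Suc n)) \<union> X')"
  have X': "finite X'" "X' \<subseteq> ?\<gamma> (Suc n)"
    using X S by (auto simp: X'_def intro!: commutator_in_lower_central)
  have M: "subgroup M G" unfolding M_def
    using X' lower_central_closed by (intro generate_is_subgroup) blast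
  interpret M: subgroup M G by (rule M)
  have \<gamma>M: "?\<gamma> (Suc (Suc n)) \<subseteq> M" and XM: "X' \<subseteq> M" unfolding M_def by (auto intro: generate.incl)
  have M\<gamma>: "M \<subseteq> ?\<gamma> (Suc n)" unfolding M_def
    using X' lower_central_antimono by (intro generate_subgroup_incl lower_central_subgroup) blast
  have conj: "g \<otimes> m \<otimes> inv g \<in> M" if m: "m \<in> M" and g: "g \<in> carrier G" for m g
  proof -
    have "commutator (inv m) g \<in> M"
      using commutator_in_lower_central[of "inv m" "Suc n" g] m g M\<gamma> \<gamma>M by blast
    then have "m \<otimes> commutator (inv m) g \<in> M" using m by simp
    then show ?thesis using m g by (simp add: m_assoc)
  qed
  have conj': "inv g \<otimes> m \<otimes> g \<in> M" if "m \<in> M" "g \<in> carrier G" for m g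
    using conj[of m "inv g"] that by simp
  have XS: "commutator x s \<in> M" if "x \<in> ?\<gamma> n" and s: "s \<in> S" for x s
  proof -
    have sc [simp]: "s \<in> carrier G" using s S by blast
    have "subgroup {x \<in> ?\<gamma> n. commutator x s \<in> M} G"
    proof (rule subgroupI)
      show "{x \<in> ?\<gamma> n. commutator x s \<in> M} \<noteq> {}"
        using subgroup.one_closed[OF lower_central_subgroup, of n] by (auto intro!: exI[of _ \<one>])
    next
      fix a assume a: "a \<in> {x \<in> ?\<gamma> n. commutator x s \<in> M}"
      then have ac: "a \<in> carrier G" by auto
      have "inv a \<otimes> inv (commutator a s) \<otimes> a \<in> M" using a by (intro conj') auto
      also have "inv a \<otimes> inv (commutator a s) \<otimes> a = commutator (inv a) s"
        using ac by (simp add: m_assoc inv_mult_group)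
      finally show "inv a \<in> {x \<in> ?\<gamma> n. commutator x s \<in> M}"
        using a subgroup.m_inv_closed[OF lower_central_subgroup] by simp
    next
      fix a b assume a: "a \<in> {x \<in> ?\<gamma> n. commutator x s \<in> M}"
        and b: "b \<in> {x \<in> ?\<gamma> n. commutator x s \<in> M}"
      then have abc: "a \<in> carrier G" "b \<in> carrier G" by auto
      have "(a \<otimes> commutator b s \<otimes> inv a) \<otimes> commutator a s \<in> M"
        by (rule M.m_closed[OF conj]) (use a b in auto)
      also have "(a \<otimes> commutator b s \<otimes> inv a) \<otimes> commutator a s = commutator (a \<otimes> b) s"
        using abc by (simp add: m_assoc inv_mult_group)
      finally show "a \<otimes> b \<in> {x \<in> ?\<gamma> n. commutator x s \<in> M}"
        using a b subgroup.m_closed[OF lower_central_subgroup] by simp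
    qed auto
    moreover have "?\<gamma> (Suc n) \<union> X \<subseteq> {x \<in> ?\<gamma> n. commutator x s \<in> M}"
      using commutator_in_lower_central[of _ "Suc n" s] \<gamma>M XM X(2) s
        lower_central_antimono[of n, THEN subsetD]
      by (auto simp: X'_def)
    ultimately have "generate G (?\<gamma> (Suc n) \<union> X) \<subseteq> {x \<in> ?\<gamma> n. commutator x s \<in> M}"
      by (intro generate_subgroup_incl)
    then show ?thesis using that X(3) by blast
  qed
  have "commutator x g \<in> M" if x: "x \<in> ?\<gamma> n" and "g \<in> carrier G" for x g
  proof -
    have xc [simp]: "x \<in> carrier G" using x by simp
    have "subgroup {g \<in> carrier G. commutator x g \<in> M} G"
    proof (rule subgroupI)
      show "{g \<in> carrier G. commutator x g \<in> M} \<noteq> {}" by (auto intro!: exI[of _ \<one>])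
    next
      fix a assume a: "a \<in> {g \<in> carrier G. commutator x g \<in> M}"
      have "inv a \<otimes> inv (commutator x a) \<otimes> a \<in> M" using a by (intro conj') auto
      also have "inv a \<otimes> inv (commutator x a) \<otimes> a = commutator x (inv a)"
        using a by (simp add: m_assoc inv_mult_group)
      finally show "inv a \<in> {g \<in> carrier G. commutator x g \<in> M}" using a by simp
    next
      fix a b assume a: "a \<in> {g \<in> carrier G. commutator x g \<in> M}"
        and b: "b \<in> {g \<in> carrier G. commutator x g \<in> M}"
      have "commutator x a \<otimes> (a \<otimes> commutator x b \<otimes> inv a) \<in> M"
        by (rule M.m_closed[OF _ conj]) (use a b in auto)
      also have "commutator x a \<otimes> (a \<otimes> commutator x b \<otimes> inv a) = commutator x (a \<otimes> b)"
        using a b by (simp add: m_assoc inv_mult_group)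
      finally show "a \<otimes> b \<in> {g \<in> carrier G. commutator x g \<in> M}" using a b by simp
    qed auto
    moreover have "S \<subseteq> {g \<in> carrier G. commutator x g \<in> M}" using XS[OF x] S by auto
    ultimately have "generate G S \<subseteq> {g \<in> carrier G. commutator x g \<in> M}"
      by (intro generate_subgroup_incl)
    then show ?thesis using that S(3) by blast
  qed
  then have "?\<gamma> (Suc n) \<subseteq> M"
    unfolding lower_central.simps(2)[of G n] by (intro generate_subgroup_incl M) auto
  then show ?case using M\<gamma> X' unfolding M_def by blast
qed

text \<open>Every subgroup that contains a term of the lower central series is normalised by the elements of
the preceding term. Therefore one can climb from \<open>L\<close> to \<open>G\<close> through the subgroups generated by \<open>L\<close> and
a term of the series, from the last term to the first, adding the finitely many generators of a term
one at a time.\<close>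

lemma nilpotent_cyclic_chain_induct:
  assumes S: "finite S" "S \<subseteq> carrier G" "generate G S = carrier G"
    and nil: "lower_central G c = {\<one>}"
    and L: "subgroup L G" and base: "Q L"
    and step: "\<And>K t. subgroup K G \<Longrightarrow> t \<in> carrier G \<Longrightarrow>
      (\<And>x. x \<in> K \<Longrightarrow> t \<otimes> x \<otimes> inv t \<in> K) \<Longrightarrow> (\<And>x. x \<in> K \<Longrightarrow> inv t \<otimes> x \<otimes> t \<in> K) \<Longrightarrow>
      Q K \<Longrightarrow> Q (generate G (insert t K))"
  shows "Q (carrier G)"
proof -
  have Lc: "L \<subseteq> carrier G" by (rule subgroup.subset[OF L])
  have gen_id: "generate G K = K" if "subgroup K G" for K
    using generate_subgroup_incl[OF _ that, of K] by (auto intro: generate.incl)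
  have gen_insert: "generate G (insert t (generate G A)) = generate G (insert t A)"
    if "insert t A \<subseteq> carrier G" for t A
  proof
    have "insert t (generate G A) \<subseteq> generate G (insert t A)"
      using mono_generate[of A "insert t A"] by (auto intro: generate.incl)
    then show "generate G (insert t (generate G A)) \<subseteq> generate G (insert t A)"
      using that by (intro generate_subgroup_incl generate_is_subgroup)
    show "generate G (insert t A) \<subseteq> generate G (insert t (generate G A))"
      by (intro mono_generate) (auto intro: generate.incl)
  qed
  have "Q (generate G (L \<union> lower_central G n))" if "n \<le> c" for n
    using that
  proof (induction n rule: inc_induct)
    case base
    have "generate G (L \<union> lower_central G c) = L"
      unfolding nil using gen_id[OF L] subgroup.one_closed[OF L] by (simp add: insert_absorb)
    then show ?case using \<open>Q L\<close> by simp
  next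
    case (step n)
    let ?\<gamma> = "lower_central G"
    obtain X where X: "finite X" "X \<subseteq> ?\<gamma> n" "?\<gamma> n = generate G (?\<gamma> (Suc n) \<union> X)"
      using lower_central_finitely_generated[OF S] by blast
    have "Q (generate G (L \<union> ?\<gamma> (Suc n) \<union> X))"
      using X(1,2)
    proof (induction X rule: finite_induct)
      case empty
      then show ?case using step.IH by simp
    next
      case (insert t X)
      let ?A = "L \<union> ?\<gamma> (Suc n) \<union> X"
      have A: "insert t ?A \<subseteq> carrier G" using insert.prems Lc lower_central_closed by blast
      have K: "subgroup (generate G ?A) G" using A by (intro generate_is_subgroup) auto
      interpret K: subgroup "generate G ?A" G by (rule K)
      have t: "t \<in> ?\<gamma> n" using insert.prems by blast
      have norm: "u \<otimes> x \<otimes> inv u \<in> generate G ?A"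
        if u: "u \<in> ?\<gamma> n" and x: "x \<in> generate G ?A" for u x
      proof -
        have "commutator u x \<in> ?\<gamma> (Suc n)"
          using u x K.subset by (intro commutator_in_lower_central) auto
        then have "commutator u x \<in> generate G ?A" by (auto intro: generate.incl)
        then have "commutator u x \<otimes> x \<in> generate G ?A" using x by simp
        then show ?thesis using u x K.subset by (simp add: m_assoc subsetD)
      qed
      have "inv t \<in> ?\<gamma> n" by (rule subgroup.m_inv_closed[OF lower_central_subgroup t])
      then have "Q (generate G (insert t (generate G ?A)))"
        using insert.prems insert.IH t norm[of "inv t"] norm[OF t] by (intro assms(7) K) auto
      then show ?case unfolding gen_insert[OF A] by simp
    qed
    moreover have "generate G (L \<union> ?\<gamma> (Suc n) \<union> X) = generate G (L \<union> ?\<gamma> n)"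
    proof
      show "generate G (L \<union> ?\<gamma> (Suc n) \<union> X) \<subseteq> generate G (L \<union> ?\<gamma> n)"
        using X(2) lower_central_antimono by (intro mono_generate) blast
      have "?\<gamma> n \<subseteq> generate G (L \<union> ?\<gamma> (Suc n) \<union> X)"
        unfolding X(3) by (intro mono_generate) blast
      then show "generate G (L \<union> ?\<gamma> n) \<subseteq> generate G (L \<union> ?\<gamma> (Suc n) \<union> X)"
        using Lc X(2) lower_central_closed
        by (intro generate_subgroup_incl generate_is_subgroup) (auto intro: generate.incl)
    qed
    ultimately show ?case by simp
  qed
  from this[of 0] show ?thesis using Lc gen_id[OF subgroup_self] by (simp add: Un_absorb1)
qed

lemma poly_fun_exponent:
  assumes g: "g \<in> carrier G" and inf: "\<And>n::nat. g [^] n = \<one> \<Longrightarrow> n = 0"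
  shows "\<exists>f. poly_fun (G\<lparr>carrier := generate G {g}\<rparr>) 2 f \<and> f g \<noteq> f \<one>"
proof -
  have inf_int: "k = 0" if "g [^] (k::int) = \<one>" for k
  proof (cases "k \<ge> 0")
    case True
    then show ?thesis using that inf[of "nat k"] by (metis int_pow_int int_nat_eq of_nat_0)
  next
    case False
    then have "g [^] (int (nat (- k))) = \<one>" using that g by (simp add: int_pow_neg)
    then show ?thesis using inf[of "nat (- k)"] False by (simp add: int_pow_int)
  qed
  define e where "e x = (SOME k::int. x = g [^] k)" for x
  have e: "e (g [^] k) = k" for k :: int
  proof -
    have "g [^] k = g [^] e (g [^] k)" unfolding e_def by (rule someI[where x = k and P = "\<lambda>j. g [^] k = g [^] j"]) simp
    then have "g [^] (k - e (g [^] k)) = \<one>" using g by (simp add: int_pow_diff)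
    then show ?thesis using inf_int by fastforce
  qed
  have gen: "generate G {g} = {g [^] (k::int) | k. True}" using generate_pow[OF g] by auto
  have "poly_fun (G\<lparr>carrier := generate G {g}\<rparr>) 2 (\<lambda>x. of_int (e x))"
    unfolding numeral_2_eq_2 poly_fun_Suc
    by (auto simp: gen e simp flip: int_pow_mult[OF g])
  moreover have "e g \<noteq> e \<one>" using e[of 1] e[of 0] g by simp
  ultimately show ?thesis by (intro exI[of _ "\<lambda>x. of_int (e x)"]) auto
qed

text \<open>The exponent, which distinguishes \<open>g\<close> from \<open>1\<close> on the infinite cyclic group of \<open>g\<close>, extends along
a chain of subgroups up to \<open>G\<close>.\<close>

theorem torsion_free_nilpotent_poly_separated:
  assumes S: "finite S" "S \<subseteq> carrier G" "generate G S = carrier G"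
    and nil: "nilpotent_group G" and tf: "torsion_free G"
  shows "poly_separated G"
  unfolding poly_separated_def
proof (intro conjI ballI impI)
  show "group G" by (rule is_group)
  fix g assume g: "g \<in> carrier G" "g \<noteq> \<one>"
  obtain c where c: "lower_central G c = {\<one>}" using nil by (auto simp: nilpotent_group_def)
  note c' = lower_central_trivial[OF c, of "Suc c"]
  define Q where "Q K \<longleftrightarrow> g \<in> K \<and> \<one> \<in> K \<and>
    (\<exists>n f. poly_fun (G\<lparr>carrier := K\<rparr>) n f \<and> f g \<noteq> f \<one>)" for K
  have "Q (carrier G)"
  proof (rule nilpotent_cyclic_chain_induct[OF S c])
    show "subgroup (generate G {g}) G" using g by (intro generate_is_subgroup) auto
    show "Q (generate G {g})"
    proof -
      have "n = 0" if "g [^] n = \<one>" for n :: nat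
        using tf g that unfolding torsion_free_def by blast
      then show ?thesis
        unfolding Q_def using poly_fun_exponent[OF g(1)] by (auto intro: generate.intros)
    qed
  next
    fix K t assume *: "subgroup K G" "t \<in> carrier G" "Q K"
      "\<And>x. x \<in> K \<Longrightarrow> t \<otimes> x \<otimes> inv t \<in> K" "\<And>x. x \<in> K \<Longrightarrow> inv t \<otimes> x \<otimes> t \<in> K"
    then obtain n f where f: "poly_fun (G\<lparr>carrier := K\<rparr>) n f" "f g \<noteq> f \<one>" "g \<in> K" "\<one> \<in> K"
      by (auto simp: Q_def)
    obtain m F where "poly_fun (G\<lparr>carrier := generate G (insert t K)\<rparr>) m F" "\<forall>x\<in>K. F x = f x"
      using poly_fun_extend_cyclic[OF *(1,2,4,5) c' f(1)] by auto
    then show "Q (generate G (insert t K))"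
      using f unfolding Q_def by (auto intro!: generate.incl exI[of _ m] exI[of _ F])
  qed
  then show "\<exists>n f. poly_fun G n f \<and> f g \<noteq> f \<one>" by (simp add: Q_def)
qed

end

theorem finitely_generated_subgroup_poly_separated:
  assumes G: "locally_residually_torsion_free_nilpotent G" and S: "finite S" "S \<subseteq> carrier G"
  shows "poly_separated (G\<lparr>carrier := generate G S\<rparr>)"
proof -
  let ?K = "G\<lparr>carrier := generate G S\<rparr>"
  interpret G: group G using G by (simp add: locally_residually_torsion_free_nilpotent_def)
  have K: "subgroup (generate G S) G" using S by (intro G.generate_is_subgroup)
  interpret K: group ?K by (rule subgroup.subgroup_is_group[OF K G.is_group])
  have SK: "S \<subseteq> generate G S" by (auto intro: generate.incl)
  have gen: "generate ?K S = carrier ?K" using G.generate_consistent[OF SK K] by simp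
  show ?thesis
  proof (rule poly_separated_residually)
    show "residually (\<lambda>Q. torsion_free Q \<and> nilpotent_group Q) ?K"
      using G S unfolding locally_residually_torsion_free_nilpotent_def
        residually_torsion_free_nilpotent_def by blast
    fix N assume N: "N \<lhd> ?K" and P: "torsion_free (?K Mod N) \<and> nilpotent_group (?K Mod N)"
    interpret N: normal N ?K by (rule N)
    interpret Q: group "?K Mod N" by (rule N.factorgroup_is_group)
    interpret h: group_hom ?K "?K Mod N" "\<lambda>x. N #>\<^bsub>?K\<^esub> x"
      by unfold_locales (rule N.r_coset_hom_Mod)
    have "generate (?K Mod N) ((\<lambda>x. N #>\<^bsub>?K\<^esub> x) ` S) = (\<lambda>x. N #>\<^bsub>?K\<^esub> x) ` carrier ?K"
      using h.generate_img[of S] SK gen by simp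
    also have "\<dots> = carrier (?K Mod N)" by (auto simp: FactGroup_def RCOSETS_def)
    finally show "poly_separated (?K Mod N)"
      using P S SK h.hom_closed
      by (intro Q.torsion_free_nilpotent_poly_separated[where S = "(\<lambda>x. N #>\<^bsub>?K\<^esub> x) ` S"]) auto
  qed
qed

section \<open>Coefficient functions on syllable words\<close>

definition syllables :: "'i set \<Rightarrow> ('i \<Rightarrow> ('h, 'k) monoid_scheme) \<Rightarrow> ('i \<times> 'h) set" where
  "syllables I H = (SIGMA i:I. carrier (H i))"

text \<open>Let the groups \<open>H i\<close> generate a group, with \<open>H i\<close> and \<open>H j\<close> commuting for \<open>(i, j) \<in> E\<close>. A
functional on the group ring is determined by its values \<open>c [s\<^sub>1, \<dots>, s\<^sub>k]\<close> on the products
\<open>(s\<^sub>1 - 1) \<cdots> (s\<^sub>k - 1)\<close> of syllables. The three conditions on \<open>c\<close> express the relations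
\<open>1 - 1 = 0\<close>, \<open>(a - 1) (b - 1) = (a b - 1) - (a - 1) - (b - 1)\<close> and the commutation of \<open>H i\<close> with
\<open>H j\<close>.\<close>

definition magnus_fun ::
    "'i set \<Rightarrow> ('i \<Rightarrow> ('h, 'k) monoid_scheme) \<Rightarrow> ('i \<times> 'i) set \<Rightarrow> (('i \<times> 'h) list \<Rightarrow> rat) \<Rightarrow> bool" where
  "magnus_fun I H E c \<longleftrightarrow>
     (\<forall>u\<in>lists (syllables I H). \<forall>v\<in>lists (syllables I H). \<forall>i\<in>I.
        c (u @ (i, \<one>\<^bsub>H i\<^esub>) # v) = 0 \<and>
        (\<forall>a\<in>carrier (H i). \<forall>b\<in>carrier (H i).
           c (u @ (i, a) # (i, b) # v) =
             c (u @ (i, a \<otimes>\<^bsub>H i\<^esub> b) # v) - c (u @ (i, a) # v) - c (u @ (i, b) # v)) \<and>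
        (\<forall>j\<in>I. (i, j) \<in> E \<longrightarrow> (\<forall>a\<in>carrier (H i). \<forall>b\<in>carrier (H j).
           c (u @ (i, a) # (j, b) # v) = c (u @ (j, b) # (i, a) # v))))"

lemma magnus_funI:
  assumes "\<And>u v i. u \<in> lists (syllables I H) \<Longrightarrow> v \<in> lists (syllables I H) \<Longrightarrow> i \<in> I \<Longrightarrow>
      c (u @ (i, \<one>\<^bsub>H i\<^esub>) # v) = 0"
    and "\<And>u v i a b. u \<in> lists (syllables I H) \<Longrightarrow> v \<in> lists (syllables I H) \<Longrightarrow> i \<in> I \<Longrightarrow>
      a \<in> carrier (H i) \<Longrightarrow> b \<in> carrier (H i) \<Longrightarrow> c (u @ (i, a) # (i, b) # v) =
        c (u @ (i, a \<otimes>\<^bsub>H i\<^esub> b) # v) - c (u @ (i, a) # v) - c (u @ (i, b) # v)"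
    and "\<And>u v i j a b. u \<in> lists (syllables I H) \<Longrightarrow> v \<in> lists (syllables I H) \<Longrightarrow> i \<in> I \<Longrightarrow>
      j \<in> I \<Longrightarrow> (i, j) \<in> E \<Longrightarrow> a \<in> carrier (H i) \<Longrightarrow> b \<in> carrier (H j) \<Longrightarrow>
      c (u @ (i, a) # (j, b) # v) = c (u @ (j, b) # (i, a) # v)"
  shows "magnus_fun I H E c"
  using assms unfolding magnus_fun_def by blast

lemma magnus_funD:
  assumes "magnus_fun I H E c" "u \<in> lists (syllables I H)" "v \<in> lists (syllables I H)" "i \<in> I"
  shows "c (u @ (i, \<one>\<^bsub>H i\<^esub>) # v) = 0"
    and "a \<in> carrier (H i) \<Longrightarrow> b \<in> carrier (H i) \<Longrightarrow> c (u @ (i, a) # (i, b) # v) =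
      c (u @ (i, a \<otimes>\<^bsub>H i\<^esub> b) # v) - c (u @ (i, a) # v) - c (u @ (i, b) # v)"
    and "j \<in> I \<Longrightarrow> (i, j) \<in> E \<Longrightarrow> a \<in> carrier (H i) \<Longrightarrow> b \<in> carrier (H j) \<Longrightarrow>
      c (u @ (i, a) # (j, b) # v) = c (u @ (j, b) # (i, a) # v)"
  using assms unfolding magnus_fun_def by blast+

text \<open>The transpose of left multiplication by \<open>y = 1 + (y - 1)\<close>.\<close>

definition push :: "'s \<Rightarrow> ('s list \<Rightarrow> rat) \<Rightarrow> 's list \<Rightarrow> rat" where
  "push y c w = c w + c (y # w)"

text \<open>The value of the functional \<open>c\<close> on the product of the syllables of \<open>w\<close>: expanding
\<open>\<Prod>(1 + (s - 1))\<close> shows that it is the sum of \<open>c\<close> over all subwords of \<open>w\<close>.\<close>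

definition subword_sum :: "('s list \<Rightarrow> rat) \<Rightarrow> 's list \<Rightarrow> rat" where
  "subword_sum c w = fold push w c []"

lemma subword_sum_append: "subword_sum c (u @ w) = subword_sum (fold push u c) w"
  by (simp add: subword_sum_def)

lemma fold_push_diff:
  "fold push u (\<lambda>w. c w - d w) = (\<lambda>w. fold push u c w - fold push u d w)"
proof (induction u arbitrary: c d)
  case (Cons y u)
  have "push y (\<lambda>w. c w - d w) = (\<lambda>w. push y c w - push y d w)"
    by (simp add: push_def fun_eq_iff)
  then show ?case using Cons by simp
qed simp

lemma fold_push_cong:
  assumes "\<And>w. w \<in> lists Y \<Longrightarrow> c w = d w" "u \<in> lists Y" "w \<in> lists Y"
  shows "fold push u c w = fold push u d w"
  using assms(2,1)
proof (induction u arbitrary: c d)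
  case (Cons y u)
  have "push y c w = push y d w" if "w \<in> lists Y" for w
    using Cons.prems that Cons.hyps by (simp add: push_def)
  then have "fold push u (push y c) w = fold push u (push y d) w" by (rule Cons.IH)
  then show ?case by simp
qed (use assms(3) in simp)

lemma subword_sum_cong:
  assumes "\<And>w. w \<in> lists Y \<Longrightarrow> c w = d w" "u \<in> lists Y"
  shows "subword_sum c u = subword_sum d u"
  unfolding subword_sum_def by (rule fold_push_cong[where Y = Y]) (use assms in auto)

text \<open>If \<open>c\<close> vanishes on all shorter words, then only \<open>w\<close> itself contributes among its subwords.\<close>

lemma subword_sum_longest:
  assumes "w \<in> lists Y" "\<And>v. v \<in> lists Y \<Longrightarrow> length v < length w \<Longrightarrow> c v = 0"
  shows "subword_sum c w = c w"
  using assms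
proof (induction w arbitrary: c)
  case (Cons y w)
  have "subword_sum c (y # w) = subword_sum (push y c) w" by (simp add: subword_sum_def)
  also have "\<dots> = push y c w"
    using Cons.prems Cons.hyps by (intro Cons.IH) (simp_all add: push_def)
  also have "\<dots> = c (y # w)" using Cons.prems Cons.hyps by (simp add: push_def)
  finally show ?case .
qed (simp add: subword_sum_def)

text \<open>The functional \<open>c\<close> vanishes on the \<open>n\<close>-th power of the augmentation ideal.\<close>

definition vanishes_from :: "'s set \<Rightarrow> nat \<Rightarrow> ('s list \<Rightarrow> rat) \<Rightarrow> bool" where
  "vanishes_from Y n c \<longleftrightarrow> (\<forall>w\<in>lists Y. n \<le> length w \<longrightarrow> c w = 0)"

lemma vanishes_from_push:
  assumes "vanishes_from Y (Suc n) c" "y \<in> Y"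
  shows "vanishes_from Y (Suc n) (push y c)" "vanishes_from Y n (\<lambda>w. push y c w - c w)"
  using assms by (auto simp: vanishes_from_def push_def)

lemma vanishes_from_fold_push:
  assumes "u \<in> lists Y" "vanishes_from Y (Suc n) c"
  shows "vanishes_from Y n (\<lambda>w. fold push u c w - c w)"
  using assms
proof (induction u arbitrary: c)
  case (Cons y u)
  have "vanishes_from Y n (\<lambda>w. fold push u (push y c) w - push y c w)"
    by (intro Cons.IH vanishes_from_push Cons.prems Cons.hyps)
  moreover have "vanishes_from Y n (\<lambda>w. push y c w - c w)"
    by (intro vanishes_from_push Cons.prems Cons.hyps)
  ultimately show ?case by (auto simp: vanishes_from_def)
qed (simp add: vanishes_from_def)

context
  fixes I :: "'i set" and H :: "'i \<Rightarrow> ('h, 'k) monoid_scheme" and E :: "('i \<times> 'i) set"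
begin

lemma magnus_fun_push:
  assumes c: "magnus_fun I H E c" and y: "y \<in> syllables I H"
  shows "magnus_fun I H E (push y c)"
proof (rule magnus_funI)
  fix u v i assume uv: "u \<in> lists (syllables I H)" "v \<in> lists (syllables I H)" "i \<in> I"
  have yu: "y # u \<in> lists (syllables I H)" using uv y by simp
  note A = magnus_funD[OF c uv] and B = magnus_funD[OF c yu uv(2,3)]
  show "push y c (u @ (i, \<one>\<^bsub>H i\<^esub>) # v) = 0" using A(1) B(1) by (simp add: push_def)
  fix a b assume a: "a \<in> carrier (H i)"
  show "push y c (u @ (i, a) # (i, b) # v) =
      push y c (u @ (i, a \<otimes>\<^bsub>H i\<^esub> b) # v) - push y c (u @ (i, a) # v) - push y c (u @ (i, b) # v)"
    if "b \<in> carrier (H i)"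
    using A(2)[OF a that] B(2)[OF a that] by (simp add: push_def)
  show "push y c (u @ (i, a) # (j, b) # v) = push y c (u @ (j, b) # (i, a) # v)"
    if "j \<in> I" "(i, j) \<in> E" "b \<in> carrier (H j)" for j
    using A(3)[OF that(1,2) a that(3)] B(3)[OF that(1,2) a that(3)] by (simp add: push_def)
qed

lemma magnus_fun_fold_push:
  "u \<in> lists (syllables I H) \<Longrightarrow> magnus_fun I H E c \<Longrightarrow> magnus_fun I H E (fold push u c)"
  by (induction u arbitrary: c) (auto intro: magnus_fun_push)

lemma magnus_fun_diff:
  assumes c: "magnus_fun I H E c" and d: "magnus_fun I H E d"
  shows "magnus_fun I H E (\<lambda>w. c w - d w)"
proof (rule magnus_funI)
  fix u v i assume uv: "u \<in> lists (syllables I H)" "v \<in> lists (syllables I H)" "i \<in> I"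
  note A = magnus_funD[OF c uv] and B = magnus_funD[OF d uv]
  show "c (u @ (i, \<one>\<^bsub>H i\<^esub>) # v) - d (u @ (i, \<one>\<^bsub>H i\<^esub>) # v) = 0" using A(1) B(1) by simp
  fix a b assume a: "a \<in> carrier (H i)"
  show "c (u @ (i, a) # (i, b) # v) - d (u @ (i, a) # (i, b) # v) =
      c (u @ (i, a \<otimes>\<^bsub>H i\<^esub> b) # v) - d (u @ (i, a \<otimes>\<^bsub>H i\<^esub> b) # v) -
      (c (u @ (i, a) # v) - d (u @ (i, a) # v)) - (c (u @ (i, b) # v) - d (u @ (i, b) # v))"
    if "b \<in> carrier (H i)"
    using A(2)[OF a that] B(2)[OF a that] by simp
  show "c (u @ (i, a) # (j, b) # v) - d (u @ (i, a) # (j, b) # v) =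
      c (u @ (j, b) # (i, a) # v) - d (u @ (j, b) # (i, a) # v)"
    if "j \<in> I" "(i, j) \<in> E" "b \<in> carrier (H j)" for j
    using A(3)[OF that(1,2) a that(3)] B(3)[OF that(1,2) a that(3)] by simp
qed

lemma push_mult:
  assumes "magnus_fun I H E c" "i \<in> I" "a \<in> carrier (H i)" "b \<in> carrier (H i)" "w \<in> lists (syllables I H)"
  shows "push (i, b) (push (i, a) c) w = push (i, a \<otimes>\<^bsub>H i\<^esub> b) c w"
  using magnus_funD(2)[OF assms(1) lists.Nil assms(5,2,3,4)] by (simp add: push_def)

lemma push_one:
  assumes "magnus_fun I H E c" "i \<in> I" "w \<in> lists (syllables I H)"
  shows "push (i, \<one>\<^bsub>H i\<^esub>) c w = c w"
  using magnus_funD(1)[OF assms(1) lists.Nil assms(3,2)] by (simp add: push_def)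

lemma push_swap:
  assumes "magnus_fun I H E c" "i \<in> I" "j \<in> I" "(i, j) \<in> E" "a \<in> carrier (H i)" "b \<in> carrier (H j)"
    "w \<in> lists (syllables I H)"
  shows "push (j, b) (push (i, a) c) w = push (i, a) (push (j, b) c) w"
  using magnus_funD(3)[OF assms(1) lists.Nil assms(7,2,3,4,5,6)] by (simp add: push_def)

text \<open>Here \<open>syl\<close> translates the letters of a presentation into syllables. It suffices that the
operators \<open>push\<close> of the syllables satisfy the defining relations of the presentation.\<close>

lemma subword_sum_word_eq:
  assumes syl: "\<And>b x. x \<in> X \<Longrightarrow> syl (b, x) \<in> syllables I H"
    and cancel: "\<And>b x c w. x \<in> X \<Longrightarrow> magnus_fun I H E c \<Longrightarrow> w \<in> lists (syllables I H) \<Longrightarrow>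
      push (syl (\<not> b, x)) (push (syl (b, x)) c) w = c w"
    and rel: "\<And>r s c w. (r, s) \<in> R \<Longrightarrow> r \<in> words_on X \<Longrightarrow> s \<in> words_on X \<Longrightarrow> magnus_fun I H E c \<Longrightarrow>
      w \<in> lists (syllables I H) \<Longrightarrow> fold push (map syl r) c w = fold push (map syl s) c w"
    and eq: "word_eq X R u v" and c: "magnus_fun I H E c"
  shows "subword_sum c (map syl u) = subword_sum c (map syl v)"
proof -
  have words: "map syl w \<in> lists (syllables I H)" if "w \<in> words_on X" for w
    using that syl unfolding words_on_def by (induction w) auto
  show ?thesis using eq
  proof induction
    case (cancel x u v b)
    let ?d = "fold push (map syl u) c"
    have "magnus_fun I H E ?d" by (rule magnus_fun_fold_push[OF words[OF cancel(2)] c])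
    then have "subword_sum (push (syl (\<not> b, x)) (push (syl (b, x)) ?d)) (map syl v) =
        subword_sum ?d (map syl v)"
      using assms(2) cancel(1) words[OF cancel(3)] by (intro subword_sum_cong[where Y = "syllables I H"]) auto
    then show ?case by (simp add: subword_sum_append) (simp add: subword_sum_def)
  next
    case (relation r s u v)
    let ?d = "fold push (map syl u) c"
    have "magnus_fun I H E ?d" by (rule magnus_fun_fold_push[OF words[OF relation(4)] c])
    then have "subword_sum (fold push (map syl r) ?d) (map syl v) =
        subword_sum (fold push (map syl s) ?d) (map syl v)"
      using rel relation(1-3) words[OF relation(5)] by (intro subword_sum_cong[where Y = "syllables I H"]) auto
    then show ?case by (simp add: subword_sum_append)
  qed auto
qed

end

section \<open>Groups generated by syllables\<close>

text \<open>The last assumption makes every \<open>c\<close> a functional on the group ring of \<open>G\<close>. It takes the place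
of the universal property of \<open>G\<close> as the quotient of the free product of the \<open>H i\<close> by the commutation
relations in \<open>E\<close>.\<close>

locale syllable_group = group G for G :: "('a, 'm) monoid_scheme" (structure) +
  fixes I :: "'i set" and H :: "'i \<Rightarrow> ('h, 'k) monoid_scheme" and E :: "('i \<times> 'i) set"
    and p :: "'i \<Rightarrow> 'h \<Rightarrow> 'a"
  assumes H_group: "i \<in> I \<Longrightarrow> group (H i)"
    and p_hom: "i \<in> I \<Longrightarrow> p i \<in> hom (H i) G"
    and p_comm: "i \<in> I \<Longrightarrow> j \<in> I \<Longrightarrow> (i, j) \<in> E \<Longrightarrow> a \<in> carrier (H i) \<Longrightarrow> b \<in> carrier (H j) \<Longrightarrow>
      p i a \<otimes> p j b = p j b \<otimes> p i a"
    and spans: "g \<in> carrier G \<Longrightarrow>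
      \<exists>w\<in>lists (syllables I H). foldr (\<lambda>(i, a) g. p i a \<otimes> g) w \<one> = g"
    and subword_sum_invariant: "magnus_fun I H E c \<Longrightarrow> u \<in> lists (syllables I H) \<Longrightarrow>
      v \<in> lists (syllables I H) \<Longrightarrow>
      foldr (\<lambda>(i, a) g. p i a \<otimes> g) u \<one> = foldr (\<lambda>(i, a) g. p i a \<otimes> g) v \<one> \<Longrightarrow>
      subword_sum c u = subword_sum c v"
begin

abbreviation S :: "('i \<times> 'h) set" where "S \<equiv> syllables I H"

definition value_of :: "('i \<times> 'h) list \<Rightarrow> 'a" where
  "value_of w = foldr (\<lambda>(i, a) g. p i a \<otimes> g) w \<one>"

lemma p_closed: "i \<in> I \<Longrightarrow> a \<in> carrier (H i) \<Longrightarrow> p i a \<in> carrier G"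
  using p_hom by (auto simp: hom_def)

lemma p_mult: "i \<in> I \<Longrightarrow> a \<in> carrier (H i) \<Longrightarrow> b \<in> carrier (H i) \<Longrightarrow>
    p i (a \<otimes>\<^bsub>H i\<^esub> b) = p i a \<otimes> p i b"
  using p_hom by (auto simp: hom_def)

lemma p_one: "i \<in> I \<Longrightarrow> p i \<one>\<^bsub>H i\<^esub> = \<one>"
  using hom_one[OF p_hom H_group is_group] .

lemma value_of_closed: "w \<in> lists S \<Longrightarrow> value_of w \<in> carrier G"
  by (induction w) (auto simp: value_of_def syllables_def p_closed)

lemma value_of_append:
  "u \<in> lists S \<Longrightarrow> v \<in> lists S \<Longrightarrow> value_of (u @ v) = value_of u \<otimes> value_of v"
proof (induction u)
  case (Cons y u)
  then show ?case
    using value_of_closed by (cases y) (simp add: value_of_def syllables_def p_closed m_assoc)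
qed (simp add: value_of_closed, simp add: value_of_def)

lemma value_of_Cons: "value_of ((i, a) # w) = p i a \<otimes> value_of w"
  by (simp add: value_of_def)

lemma value_of_replace:
  assumes "u \<in> lists S" "v \<in> lists S" "r \<in> lists S" "s \<in> lists S" "value_of r = value_of s"
  shows "value_of (u @ r @ v) = value_of (u @ s @ v)"
  using assms by (simp add: value_of_append)

definition reduced :: "('i \<times> 'h) list \<Rightarrow> bool" where
  "reduced w \<longleftrightarrow> w \<in> lists S \<and>
     (\<forall>v\<in>lists S. value_of v = value_of w \<longrightarrow> length w \<le> length v)"

lemma reduced_exists:
  assumes "g \<in> carrier G"
  shows "\<exists>w. reduced w \<and> value_of w = g"
proof -
  have "\<exists>w. w \<in> lists S \<and> value_of w = g" using spans[OF assms] by (auto simp: value_of_def)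
  from ex_has_least_nat[of "\<lambda>w. w \<in> lists S \<and> value_of w = g" _ length] this show ?thesis
    unfolding reduced_def by metis
qed

lemma reduced_no_unit:
  assumes "reduced (u @ (i, a) # v)"
  shows "a \<noteq> \<one>\<^bsub>H i\<^esub>"
proof
  assume a: "a = \<one>\<^bsub>H i\<^esub>"
  have w: "u \<in> lists S" "v \<in> lists S" "i \<in> I"
    using assms by (auto simp: reduced_def syllables_def)
  interpret Hi: group "H i" by (rule H_group[OF w(3)])
  have "(i, \<one>\<^bsub>H i\<^esub>) # v \<in> lists S" using w by (simp add: syllables_def)
  then have "value_of (u @ v) = value_of (u @ (i, a) # v)"
    using value_of_closed w by (simp add: value_of_append value_of_Cons a p_one)
  then show False using assms w unfolding reduced_def by (auto dest!: bspec[of _ _ "u @ v"])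
qed

lemma reduced_no_merge:
  assumes "reduced (u @ (i, a) # (i, b) # v)"
  shows False
proof -
  have w: "u \<in> lists S" "v \<in> lists S" "i \<in> I" "a \<in> carrier (H i)" "b \<in> carrier (H i)"
    using assms by (auto simp: reduced_def syllables_def)
  interpret Hi: group "H i" by (rule H_group[OF w(3)])
  have m: "(i, a \<otimes>\<^bsub>H i\<^esub> b) \<in> S" using w by (simp add: syllables_def)
  have "value_of (u @ [(i, a \<otimes>\<^bsub>H i\<^esub> b)] @ v) = value_of (u @ [(i, a), (i, b)] @ v)"
    by (rule value_of_replace)
       (use w m in \<open>auto simp: value_of_Cons p_mult p_closed syllables_def value_of_def\<close>)
  then show False
    using assms w m unfolding reduced_def
    by (auto dest!: bspec[of _ _ "u @ [(i, a \<otimes>\<^bsub>H i\<^esub> b)] @ v"])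
qed

text \<open>Left translation of the function \<open>F c\<close> by the value of \<open>u\<close> gives \<open>F (fold push u c)\<close>, and
\<open>fold push u c - c\<close> vanishes on words one syllable shorter than \<open>c\<close> does.\<close>

lemma poly_fun_of_magnus_fun:
  assumes c: "magnus_fun I H E c" "vanishes_from S n c"
  shows "\<exists>f. poly_fun G n f \<and> (\<forall>w\<in>lists S. f (value_of w) = subword_sum c w)"
proof -
  define word where "word g = (SOME w. w \<in> lists S \<and> value_of w = g)" for g
  have word: "word g \<in> lists S" "value_of (word g) = g" if "g \<in> carrier G" for g
  proof -
    have "\<exists>w. w \<in> lists S \<and> value_of w = g" using spans[OF that] by (auto simp: value_of_def)
    from someI_ex[OF this] show "word g \<in> lists S" "value_of (word g) = g"
      unfolding word_def by auto
  qed
  define F where "F c g = subword_sum c (word g)" for c g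
  have F: "F c (value_of w) = subword_sum c w" if "magnus_fun I H E c" "w \<in> lists S" for c w
    unfolding F_def
    using subword_sum_invariant[OF that(1) word(1)[OF value_of_closed[OF that(2)]] that(2)]
      word(2)[OF value_of_closed[OF that(2)]]
    unfolding value_of_def[symmetric] by simp
  have "poly_fun G n (F c)"
  proof (rule poly_fun_of_levels[where A = "\<lambda>n c. magnus_fun I H E c \<and> vanishes_from S n c"])
    fix c x assume "magnus_fun I H E c \<and> vanishes_from S 0 c" "x \<in> carrier G"
    then show "F c x = 0"
      using subword_sum_cong[where Y = S and c = c and d = "\<lambda>_. 0" and u = "word x"]
        subword_sum_longest[where Y = S and c = "\<lambda>_. 0" and w = "word x"] word
      by (simp add: F_def vanishes_from_def)
  next
    fix n c y assume A: "magnus_fun I H E c \<and> vanishes_from S (Suc n) c" and y: "y \<in> carrier G"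
    define u where "u = word y"
    have u: "u \<in> lists S" "value_of u = y" using word[OF y] by (auto simp: u_def)
    define c' where "c' = (\<lambda>w. fold push u c w - c w)"
    have c': "magnus_fun I H E c'" "vanishes_from S n c'"
      unfolding c'_def using A u magnus_fun_diff[OF magnus_fun_fold_push] vanishes_from_fold_push
      by blast+
    have "F c (y \<otimes> x) - F c x = F c' x" if x: "x \<in> carrier G" for x
    proof -
      define w where "w = word x"
      have w: "w \<in> lists S" "value_of w = x" using word[OF x] by (auto simp: w_def)
      have "F c (y \<otimes> x) = subword_sum (fold push u c) w"
        using F[of c "u @ w"] A u w by (simp add: value_of_append subword_sum_append)
      moreover have "F c x = subword_sum c w" using F[of c w] A w by simp
      moreover have "F c' x = subword_sum c' w" using F[of c' w] c' w by simp
      moreover have "subword_sum c' w = subword_sum (fold push u c) w - subword_sum c w"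
        by (simp add: c'_def subword_sum_def fold_push_diff)
      ultimately show ?thesis by simp
    qed
    then show "\<exists>c'. (magnus_fun I H E c' \<and> vanishes_from S n c') \<and>
        (\<forall>x\<in>carrier G. F c (y \<otimes> x) - F c x = F c' x)" using c' by blast
  qed (use c is_group in auto)
  then show ?thesis using F[OF c(1)] by blast
qed

lemma magnus_fun_separates:
  assumes c: "magnus_fun I H E c" "vanishes_from S n c"
    and w: "w \<in> lists S" "c w \<noteq> 0" "w \<noteq> []"
    and short: "\<And>v. v \<in> lists S \<Longrightarrow> length v < length w \<Longrightarrow> c v = 0"
  shows "\<exists>n f. poly_fun G n f \<and> f (value_of w) \<noteq> f \<one>"
proof -
  obtain f where f: "poly_fun G n f" "\<And>w. w \<in> lists S \<Longrightarrow> f (value_of w) = subword_sum c w"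
    using poly_fun_of_magnus_fun[OF c] by blast
  have "f (value_of w) = c w" using f(2)[OF w(1)] subword_sum_longest[OF w(1) short] by simp
  moreover have "f \<one> = 0"
    using f(2)[of "[]"] short[of "[]"] w by (simp add: value_of_def subword_sum_def)
  ultimately show ?thesis using f(1) w(2) by metis
qed

end

section \<open>Partially commutative products of infinite cyclic groups\<close>

text \<open>Equality in the partially commutative monoid. Swaps are applied to the left-hand word only, so
that the target word stays fixed in inductions.\<close>

inductive trace_eq :: "('v \<times> 'v) set \<Rightarrow> 'v list \<Rightarrow> 'v list \<Rightarrow> bool" for E where
  refl: "trace_eq E l l"
| swap: "trace_eq E (u @ [x, y] @ v) l \<Longrightarrow> (x, y) \<in> E \<or> (y, x) \<in> E \<Longrightarrow>
    trace_eq E (u @ [y, x] @ v) l"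

lemma trace_eq_length: "trace_eq E l l' \<Longrightarrow> length l = length l'"
  by (induction rule: trace_eq.induct) auto

locale integer_syllable_group =
  syllable_group G I "\<lambda>_. integer_group" E p
  for G :: "('a, 'm) monoid_scheme" (structure) and I :: "'i set" and E p
begin

lemma trace_eq_value:
  assumes "w \<in> lists S"
  shows "trace_eq E l (map fst w) \<Longrightarrow>
    \<exists>w'\<in>lists S. map fst w' = l \<and> value_of w' = value_of w \<and> length w' = length w"
proof (induction l "map fst w" rule: trace_eq.induct)
  case refl
  then show ?case using assms by blast
next
  case (swap u x y v)
  then obtain w' where w': "w' \<in> lists S" "map fst w' = u @ [x, y] @ v" "value_of w' = value_of w"
    "length w' = length w" by blast
  then obtain w1 a b w2 where w12: "w' = w1 @ [(x, a), (y, b)] @ w2" "map fst w1 = u" "map fst w2 = v"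
    by (auto simp: map_eq_append_conv map_eq_Cons_conv)
  have xy: "x \<in> I" "y \<in> I" "w1 \<in> lists S" "w2 \<in> lists S" using w'(1) w12 by (auto simp: syllables_def)
  have "p x a \<otimes> p y b = p y b \<otimes> p x a"
    using swap(3) p_comm[of x y a b] p_comm[of y x b a] xy by auto
  then have "value_of (w1 @ [(y, b), (x, a)] @ w2) = value_of (w1 @ [(x, a), (y, b)] @ w2)"
    using xy p_closed by (intro value_of_replace) (auto simp: value_of_def syllables_def)
  then show ?case
    using w' w12 xy by (intro bexI[of _ "w1 @ [(y, b), (x, a)] @ w2"]) (auto simp: syllables_def)
qed

text \<open>For a reduced word \<open>w\<close>, with syllables \<open>(i, e)\<close> that stand for the \<open>e\<close>-th power of a generator, let \<open>c\<close>
be supported on the words whose generators form the trace of \<open>w\<close>, and there be the product of the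
exponents. Since \<open>w\<close> is reduced, no word with this trace contains a generator twice in succession:
two such syllables could be merged. So \<open>c\<close> vanishes on the left-hand side of the multiplication rule
\<open>(a - 1) (b - 1) = \<dots>\<close>, while its right-hand side vanishes because \<open>c\<close> is additive in every exponent.\<close>

theorem integer_syllable_poly_separated: "poly_separated G"
  unfolding poly_separated_def
proof (intro conjI ballI impI is_group)
  fix g assume g: "g \<in> carrier G" "g \<noteq> \<one>"
  obtain w where red: "reduced w" and wg: "value_of w = g" using reduced_exists[OF g(1)] by blast
  have w: "w \<in> lists S" using red by (simp add: reduced_def)
  define c :: "('i \<times> int) list \<Rightarrow> rat" where
    "c v = (if trace_eq E (map fst v) (map fst w) then \<Prod>y\<leftarrow>v. of_int (snd y) else 0)" for v
  have no_square: "\<not> trace_eq E (u @ [i, i] @ v) (map fst w)" for u v i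
  proof
    assume "trace_eq E (u @ [i, i] @ v) (map fst w)"
    from trace_eq_value[OF w this] obtain w' where w': "w' \<in> lists S" "map fst w' = u @ [i, i] @ v"
      "value_of w' = value_of w" "length w' = length w" by blast
    then obtain w1 a b w2 where "w' = w1 @ [(i, a), (i, b)] @ w2"
      by (auto simp: map_eq_append_conv map_eq_Cons_conv)
    moreover have "reduced w'" using red w' by (simp add: reduced_def)
    ultimately show False using reduced_no_merge[of w1 i a b w2] by simp
  qed
  have swap: "trace_eq E (u @ [i, j] @ v) l = trace_eq E (u @ [j, i] @ v) l" if "(i, j) \<in> E" for u v i j l
    using trace_eq.swap[of E u i j v l] trace_eq.swap[of E u j i v l] that by blast
  have "magnus_fun I (\<lambda>_. integer_group) E c"
  proof (rule magnus_funI)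
    fix u v :: "('i \<times> int) list" and i
    show "c (u @ (i, \<one>\<^bsub>integer_group\<^esub>) # v) = 0" by (simp add: c_def)
    fix a b :: int
    show "c (u @ (i, a) # (i, b) # v) =
        c (u @ (i, a \<otimes>\<^bsub>integer_group\<^esub> b) # v) - c (u @ (i, a) # v) - c (u @ (i, b) # v)"
      using no_square[of "map fst u" i "map fst v"] by (simp add: c_def algebra_simps)
    show "c (u @ (i, a) # (j, b) # v) = c (u @ (j, b) # (i, a) # v)" if "(i, j) \<in> E" for j
      using swap[OF that, of "map fst u" "map fst v" "map fst w"] by (simp add: c_def)
  qed
  moreover have "vanishes_from S (Suc (length w)) c"
    unfolding vanishes_from_def c_def using trace_eq_length by fastforce
  moreover have "c w \<noteq> 0"
  proof -
    have "snd y \<noteq> 0" if y: "y \<in> set w" for y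
    proof -
      obtain u v where "w = u @ y # v" using split_list[OF y] by auto
      then show ?thesis using red reduced_no_unit[of u "fst y" "snd y" v] by simp
    qed
    then have "\<forall>y\<in>set w. snd y \<noteq> 0" by blast
    then show ?thesis by (force simp: c_def trace_eq.refl prod_list_zero_iff)
  qed
  moreover have "c v = 0" if "length v < length w" for v
    using that trace_eq_length unfolding c_def by fastforce
  moreover have "w \<noteq> []" using g(2) wg by (auto simp: value_of_def)
  ultimately show "\<exists>n f. poly_fun G n f \<and> f g \<noteq> f \<one>"
    using magnus_fun_separates[of c "Suc (length w)" w] w wg by blast
qed

end

section \<open>Free products of polynomially separated groups\<close>

text \<open>The value of \<open>f\<close> on the product \<open>(y\<^sub>1 - 1) \<cdots> (y\<^sub>k - 1)\<close> in the group ring.\<close>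

fun iterated_diff :: "('h, 'k) monoid_scheme \<Rightarrow> ('h \<Rightarrow> rat) \<Rightarrow> 'h list \<Rightarrow> rat" where
  "iterated_diff G f [] = f \<one>\<^bsub>G\<^esub>"
| "iterated_diff G f (y # ys) = iterated_diff G (\<lambda>x. f (y \<otimes>\<^bsub>G\<^esub> x) - f x) ys"

context group
begin

lemma iterated_diff_cong:
  "(\<And>x. x \<in> carrier G \<Longrightarrow> f x = f' x) \<Longrightarrow> ys \<in> lists (carrier G) \<Longrightarrow>
     iterated_diff G f ys = iterated_diff G f' ys"
proof (induction ys arbitrary: f f')
  case (Cons y ys)
  show ?case unfolding iterated_diff.simps by (rule Cons.IH) (use Cons.prems in auto)
qed simp

lemma iterated_diff_diff:
  "iterated_diff G (\<lambda>x. f x - f' x) ys = iterated_diff G f ys - iterated_diff G f' ys"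
proof (induction ys arbitrary: f f')
  case (Cons y ys)
  have "iterated_diff G (\<lambda>x. (f (y \<otimes> x) - f x) - (f' (y \<otimes> x) - f' x)) ys =
      iterated_diff G (\<lambda>x. f (y \<otimes> x) - f x) ys - iterated_diff G (\<lambda>x. f' (y \<otimes> x) - f' x) ys"
    by (rule Cons.IH)
  then show ?case by (simp add: algebra_simps)
qed simp

lemma iterated_diff_zero: "ys \<in> lists (carrier G) \<Longrightarrow> (\<And>x. x \<in> carrier G \<Longrightarrow> f x = 0) \<Longrightarrow>
    iterated_diff G f ys = 0"
  using iterated_diff_cong[of f "\<lambda>x. f x - f x" ys] iterated_diff_diff[of f f ys] by simp

lemma iterated_diff_one:
  "us \<in> lists (carrier G) \<Longrightarrow> vs \<in> lists (carrier G) \<Longrightarrow> iterated_diff G f (us @ \<one> # vs) = 0"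
proof (induction us arbitrary: f)
  case Nil
  then show ?case by (simp add: iterated_diff_zero)
qed simp

lemma iterated_diff_mult:
  "us \<in> lists (carrier G) \<Longrightarrow> vs \<in> lists (carrier G) \<Longrightarrow> a \<in> carrier G \<Longrightarrow> b \<in> carrier G \<Longrightarrow>
     iterated_diff G f (us @ a # b # vs) =
       iterated_diff G f (us @ (a \<otimes> b) # vs) - iterated_diff G f (us @ a # vs) -
       iterated_diff G f (us @ b # vs)"
proof (induction us arbitrary: f)
  case Nil
  have "iterated_diff G (\<lambda>x. (f (a \<otimes> (b \<otimes> x)) - f (b \<otimes> x)) - (f (a \<otimes> x) - f x)) vs =
    iterated_diff G (\<lambda>x. ((f (a \<otimes> b \<otimes> x) - f x) - (f (a \<otimes> x) - f x)) - (f (b \<otimes> x) - f x)) vs"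
    by (rule iterated_diff_cong) (use Nil in \<open>auto simp: m_assoc\<close>)
  then show ?case by (simp add: iterated_diff_diff)
qed simp

lemma iterated_diff_vanishes:
  "poly_fun G n f \<Longrightarrow> ys \<in> lists (carrier G) \<Longrightarrow> n \<le> length ys \<Longrightarrow> iterated_diff G f ys = 0"
proof (induction ys arbitrary: n f)
  case Nil
  then show ?case by simp
next
  case (Cons y ys)
  show ?case
  proof (cases n)
    case 0
    then show ?thesis using Cons.prems by (intro iterated_diff_zero) auto
  next
    case (Suc m)
    then show ?thesis using Cons.prems Cons.IH[of m] unfolding Suc poly_fun_Suc by auto
  qed
qed

end

text \<open>The functional \<open>f\<^sub>1 \<otimes> \<cdots> \<otimes> f\<^sub>k\<close>: the word is cut into maximal blocks of syllables from the
same factor, which have to belong to the prescribed factors, and the \<open>j\<close>-th function is evaluated on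
the \<open>j\<close>-th block.\<close>

fun block_fun :: "('i \<Rightarrow> ('h, 'k) monoid_scheme) \<Rightarrow> ('i \<times> ('h \<Rightarrow> rat)) list \<Rightarrow> ('i \<times> 'h) list \<Rightarrow> rat" where
  "block_fun H [] w = of_bool (w = [])"
| "block_fun H ((i, f) # fs) w =
     (let u = takeWhile (\<lambda>y. fst y = i) w in
      if u = [] then 0
      else iterated_diff (H i) f (map snd u) * block_fun H fs (dropWhile (\<lambda>y. fst y = i) w))"

lemma block_fun_short: "length w < length fs \<Longrightarrow> block_fun H fs w = 0"
proof (induction fs arbitrary: w)
  case (Cons fi fs)
  obtain i f where fi: "fi = (i, f)" by (cases fi)
  let ?u = "takeWhile (\<lambda>y. fst y = i) w" and ?v = "dropWhile (\<lambda>y. fst y = i) w"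
  have "length ?u + length ?v = length w" by (metis length_append takeWhile_dropWhile_id)
  then have "?u \<noteq> [] \<Longrightarrow> length ?v < length fs" using Cons.prems by (cases ?u) auto
  then show ?case using Cons.IH[of ?v] by (auto simp: fi Let_def)
qed simp

lemma block_fun_long:
  assumes "\<And>i f n. (i, f, n) \<in> set ns \<Longrightarrow> group (H i) \<and> poly_fun (H i) n f"
  shows "w \<in> lists (syllables I H) \<Longrightarrow> (\<Sum>(i, f, n)\<leftarrow>ns. n) < length w \<Longrightarrow>
    block_fun H (map (\<lambda>(i, f, n). (i, f)) ns) w = 0"
  using assms
proof (induction ns arbitrary: w)
  case (Cons t ns)
  obtain i f n where t: "t = (i, f, n)" by (cases t)
  let ?u = "takeWhile (\<lambda>y. fst y = i) w" and ?v = "dropWhile (\<lambda>y. fst y = i) w"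
  have len: "length ?u + length ?v = length w" by (metis length_append takeWhile_dropWhile_id)
  interpret Hi: group "H i" using Cons.prems(3)[of i f n] t by auto
  have u: "map snd ?u \<in> lists (carrier (H i))"
    using Cons.prems(1) by (fastforce dest: set_takeWhileD simp: syllables_def)
  show ?case
  proof (cases "n \<le> length ?u")
    case True
    then show ?thesis
      using Hi.iterated_diff_vanishes[of n f "map snd ?u"] Cons.prems(3)[of i f n] u
      by (simp add: t Let_def)
  next
    case False
    have "?v \<in> lists (syllables I H)" using Cons.prems(1) by (auto dest: set_dropWhileD)
    then have "block_fun H (map (\<lambda>(i, f, n). (i, f)) ns) ?v = 0"
      using Cons.prems False len by (intro Cons.IH) (auto simp: t)
    then show ?thesis by (simp add: t Let_def)
  qed
qed auto

text \<open>The syllables on which the multiplication rule operates belong to one factor, so they lie in the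
same block. By induction, it is enough to consider the first block, and there the rule holds for
iterated differences.\<close>

lemma block_fun_magnus:
  assumes H: "\<And>i. i \<in> I \<Longrightarrow> group (H i)"
  shows "fst ` set fs \<subseteq> I \<Longrightarrow> magnus_fun I H {} (block_fun H fs)"
proof (induction fs)
  case Nil
  then show ?case by (simp add: magnus_fun_def)
next
  case (Cons fi fs)
  obtain k f where fi: "fi = (k, f)" and k: "k \<in> I" using Cons.prems by (cases fi) auto
  have IH: "magnus_fun I H {} (block_fun H fs)" using Cons by simp
  interpret Hk: group "H k" by (rule H[OF k])
  have step: "block_fun H (fi # fs) (u @ (i, \<one>\<^bsub>H i\<^esub>) # v) = 0 \<and>
      (\<forall>a\<in>carrier (H i). \<forall>b\<in>carrier (H i). block_fun H (fi # fs) (u @ (i, a) # (i, b) # v) =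
         block_fun H (fi # fs) (u @ (i, a \<otimes>\<^bsub>H i\<^esub> b) # v) - block_fun H (fi # fs) (u @ (i, a) # v)
         - block_fun H (fi # fs) (u @ (i, b) # v))"
    if uv: "u \<in> lists (syllables I H)" "v \<in> lists (syllables I H)" and i: "i \<in> I" for u v i
  proof -
    let ?P = "\<lambda>y. fst y = k"
    have sub: "dropWhile ?P u \<in> lists (syllables I H)"
      using uv by (auto dest: set_dropWhileD)
    consider (inside) "\<forall>y\<in>set u. ?P y" "i = k" | (after) "\<forall>y\<in>set u. ?P y" "i \<noteq> k"
      | (later) "\<exists>y\<in>set u. \<not> ?P y" by blast
    then show ?thesis
    proof cases
      case inside
      have tw: "takeWhile ?P (u @ r) = u @ takeWhile ?P r" "dropWhile ?P (u @ r) = dropWhile ?P r" for r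
        using inside(1) by (auto simp: takeWhile_append2 dropWhile_append2)
      have us: "map snd u \<in> lists (carrier (H k))" "map snd (takeWhile ?P v) \<in> lists (carrier (H k))"
        using uv inside(1) by (fastforce dest: set_takeWhileD simp: syllables_def)+
      show ?thesis
        using us Hk.iterated_diff_one[OF us] Hk.iterated_diff_mult[OF us]
        by (simp add: fi Let_def tw inside(2) left_diff_distrib)
    next
      case after
      have tw: "takeWhile ?P (u @ (i, x) # r) = u" "dropWhile ?P (u @ (i, x) # r) = (i, x) # r" for x r
        using after by (auto simp: takeWhile_append2 dropWhile_append2)
      show ?thesis
        using magnus_funD(1,2)[OF IH lists.Nil uv(2) i]
        by (simp add: fi Let_def tw right_diff_distrib)
    next
      case later
      then obtain y where y: "y \<in> set u" "\<not> ?P y" by blast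
      have tw: "takeWhile ?P (u @ r) = takeWhile ?P u" "dropWhile ?P (u @ r) = dropWhile ?P u @ r" for r
        using takeWhile_append1[OF y(1), of ?P] dropWhile_append1[OF y(1), of ?P] y(2) by auto
      show ?thesis
        using magnus_funD(1,2)[OF IH sub uv(2) i]
        by (simp add: fi Let_def tw right_diff_distrib)
    qed
  qed
  show ?case by (rule magnus_funI) (use step in blast)+
qed

text \<open>In a reduced word neighbouring syllables belong to different factors, so every block is a single
syllable \<open>(i, h)\<close> with \<open>h \<noteq> 1\<close>. Choosing for each a polynomial function that separates \<open>h\<close> from \<open>1\<close>
makes the product of the differences \<open>f h - f 1\<close> non-zero.\<close>

theorem (in syllable_group) free_syllable_poly_separated:
  assumes E: "E = {}" and sep: "\<And>i. i \<in> I \<Longrightarrow> poly_separated (H i)"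
  shows "poly_separated G"
  unfolding poly_separated_def
proof (intro conjI ballI impI is_group)
  fix g assume g: "g \<in> carrier G" "g \<noteq> \<one>"
  obtain w where red: "reduced w" and wg: "value_of w = g" using reduced_exists[OF g(1)] by blast
  have w: "w \<in> lists S" using red by (simp add: reduced_def)
  have "\<exists>f n. poly_fun (H (fst y)) n f \<and> f (snd y) \<noteq> f \<one>\<^bsub>H (fst y)\<^esub>" if y: "y \<in> set w" for y
  proof -
    obtain u v where "w = u @ y # v" using split_list[OF y] by auto
    then have "snd y \<noteq> \<one>\<^bsub>H (fst y)\<^esub>" using red reduced_no_unit[of u "fst y" "snd y" v] by simp
    moreover have "fst y \<in> I" "snd y \<in> carrier (H (fst y))" using w y by (auto simp: syllables_def)
    ultimately show ?thesis using sep unfolding poly_separated_def by blast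
  qed
  then obtain f n where fn: "\<And>y. y \<in> set w \<Longrightarrow>
      poly_fun (H (fst y)) (n y) (f y) \<and> f y (snd y) \<noteq> f y \<one>\<^bsub>H (fst y)\<^esub>" by metis
  define ns where "ns = map (\<lambda>y. (fst y, f y, n y)) w"
  define fs where "fs = map (\<lambda>y. (fst y, f y)) w"
  have fs: "fs = map (\<lambda>(i, f, n). (i, f)) ns" by (simp add: fs_def ns_def)
  have wI: "fst y \<in> I" "snd y \<in> carrier (H (fst y))" if "y \<in> set w" for y
    using w that by (auto simp: syllables_def)
  have 1: "magnus_fun I H E (block_fun H fs)"
    unfolding E by (rule block_fun_magnus) (use H_group wI in \<open>auto simp: fs_def\<close>)
  have 2: "vanishes_from S (Suc (\<Sum>(i, f, n)\<leftarrow>ns. n)) (block_fun H fs)"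
    unfolding vanishes_from_def fs
  proof (intro ballI impI block_fun_long[where I = I])
    show "group (H i) \<and> poly_fun (H i) m h" if "(i, h, m) \<in> set ns" for i h m
      using that fn wI H_group by (auto simp: ns_def)
  qed simp_all
  have 3: "block_fun H fs v = 0" if "length v < length w" for v
    by (rule block_fun_short) (use that in \<open>simp add: fs_def\<close>)
  have "block_fun H (map (\<lambda>y. (fst y, f y)) v) v \<noteq> 0" if "w = u @ v" for u v
    using that
  proof (induction v arbitrary: u)
    case (Cons y v)
    obtain i h where y: "y = (i, h)" by (cases y)
    have v: "takeWhile (\<lambda>y. fst y = i) v = [] \<and> dropWhile (\<lambda>y. fst y = i) v = v"
    proof (cases v)
      case (Cons z v')
      then have "fst z \<noteq> i"
        using red \<open>w = u @ y # v\<close> reduced_no_merge[of u i h "snd z" v'] y by (cases z) auto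
      then show ?thesis using Cons by simp
    qed simp
    have yw: "y \<in> set w" using Cons.prems by simp
    interpret Hi: group "H i" using H_group wI[OF yw] y by simp
    have "f y (h \<otimes>\<^bsub>H i\<^esub> \<one>\<^bsub>H i\<^esub>) - f y \<one>\<^bsub>H i\<^esub> \<noteq> 0" using fn[OF yw] wI[OF yw] y by simp
    then show ?case using Cons.IH[of "u @ [y]"] Cons.prems v by (simp add: y)
  qed simp
  from this[of "[]" w] have 4: "block_fun H fs w \<noteq> 0" by (simp add: fs_def)
  have "w \<noteq> []" using g(2) wg by (auto simp: value_of_def)
  then show "\<exists>n f. poly_fun G n f \<and> f g \<noteq> f \<one>"
    using magnus_fun_separates[OF 1 2 w 4 _ 3] wg by simp
qed

section \<open>Presentations\<close>

lemma words_on_simps [simp]: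
  "[] \<in> words_on X" "a # u \<in> words_on X \<longleftrightarrow> snd a \<in> X \<and> u \<in> words_on X"
  "u @ v \<in> words_on X \<longleftrightarrow> u \<in> words_on X \<and> v \<in> words_on X"
  by (auto simp: words_on_def mem_Times_iff)

lemma word_eq_words: "word_eq X R u v \<Longrightarrow> u \<in> words_on X \<and> v \<in> words_on X"
  by (induction rule: word_eq.induct) auto

lemma word_eq_append_right:
  "word_eq X R u v \<Longrightarrow> w \<in> words_on X \<Longrightarrow> word_eq X R (u @ w) (v @ w)"
proof (induction rule: word_eq.induct)
  case (cancel x u v b)
  then show ?case using word_eq.cancel[of x X u "v @ w" R b] by simp
next
  case (relation r s u v)
  then show ?case using word_eq.relation[of r s R X u "v @ w"] by simp
qed (auto intro: word_eq.intros(1-3))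

lemma word_eq_append_left:
  "word_eq X R u v \<Longrightarrow> w \<in> words_on X \<Longrightarrow> word_eq X R (w @ u) (w @ v)"
proof (induction rule: word_eq.induct)
  case (cancel x u v b)
  then show ?case using word_eq.cancel[of x X "w @ u" v R b] by simp
next
  case (relation r s u v)
  then show ?case using word_eq.relation[of r s R X "w @ u" v] by simp
qed (auto intro: word_eq.intros(1-3))

text \<open>The map \<open>\<pi>\<close> evaluates words in the letters of the presentation.\<close>

locale presented = group G for G :: "('a, 'm) monoid_scheme" (structure) +
  fixes X :: "'x set" and R :: "('x word \<times> 'x word) set" and \<pi> :: "'x word \<Rightarrow> 'a"
  assumes \<pi>_closed: "u \<in> words_on X \<Longrightarrow> \<pi> u \<in> carrier G"
    and \<pi>_surj: "g \<in> carrier G \<Longrightarrow> \<exists>u\<in>words_on X. \<pi> u = g"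
    and \<pi>_append: "u \<in> words_on X \<Longrightarrow> v \<in> words_on X \<Longrightarrow> \<pi> (u @ v) = \<pi> u \<otimes> \<pi> v"
    and \<pi>_eq_iff: "u \<in> words_on X \<Longrightarrow> v \<in> words_on X \<Longrightarrow> \<pi> u = \<pi> v \<longleftrightarrow> word_eq X R u v"

lemma presented_exists:
  assumes G: "group G" and iso: "presented_group X R \<cong> G"
  shows "\<exists>\<pi>. presented G X R \<pi>"
proof -
  define cl where "cl u = {w. word_eq X R u w}" for u
  obtain \<psi> where \<psi>: "\<psi> \<in> iso (presented_group X R) G" using iso by (auto simp: is_iso_def)
  have carrier: "carrier (presented_group X R) = cl ` words_on X"
    by (auto simp: presented_group_def quotient_def cl_def)
  have cl_eq: "cl u = cl v \<longleftrightarrow> word_eq X R u v" if "u \<in> words_on X" "v \<in> words_on X" for u v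
    using word_eq.refl[OF that(2)] unfolding cl_def
    by (blast intro: word_eq.trans word_eq.sym)
  have mult: "cl u \<otimes>\<^bsub>presented_group X R\<^esub> cl v = cl (u @ v)"
    if uv: "u \<in> words_on X" "v \<in> words_on X" for u v
  proof -
    have "word_eq X R (u @ v) (a @ b)" if "word_eq X R u a" "word_eq X R v b" for a b
      using word_eq_append_right[OF that(1) uv(2)] word_eq_append_left[OF that(2)]
        word_eq_words[OF that(1)] word_eq.trans by blast
    then have "{w. \<exists>a\<in>cl u. \<exists>b\<in>cl v. word_eq X R (a @ b) w} = cl (u @ v)"
      using word_eq.refl uv unfolding cl_def by (blast intro: word_eq.trans word_eq.sym)
    then show ?thesis by (simp add: presented_group_def)
  qed
  have bij: "bij_betw \<psi> (cl ` words_on X) (carrier G)" and hom: "\<psi> \<in> hom (presented_group X R) G"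
    using \<psi> by (auto simp: iso_def carrier)
  have "presented G X R (\<lambda>u. \<psi> (cl u))"
  proof (intro presented.intro G presented_axioms.intro)
    show "\<psi> (cl u) \<in> carrier G" if "u \<in> words_on X" for u
      using bij that by (auto simp: bij_betw_def)
    show "\<exists>u\<in>words_on X. \<psi> (cl u) = g" if "g \<in> carrier G" for g
    proof -
      have "g \<in> \<psi> ` cl ` words_on X" using bij that by (simp add: bij_betw_def)
      then show ?thesis by blast
    qed
    show "\<psi> (cl (u @ v)) = \<psi> (cl u) \<otimes>\<^bsub>G\<^esub> \<psi> (cl v)" if "u \<in> words_on X" "v \<in> words_on X" for u v
      using hom that by (auto simp: hom_def carrier simp flip: mult)
    show "\<psi> (cl u) = \<psi> (cl v) \<longleftrightarrow> word_eq X R u v" if "u \<in> words_on X" "v \<in> words_on X" for u v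
      using bij that cl_eq[OF that] by (auto simp: bij_betw_def inj_on_def)
  qed
  then show ?thesis by blast
qed

context presented
begin

lemma \<pi>_Nil: "\<pi> [] = \<one>"
  using \<pi>_append[of "[]" "[]"] \<pi>_closed[of "[]"] by simp

lemma \<pi>_Cons: "snd a \<in> X \<Longrightarrow> u \<in> words_on X \<Longrightarrow> \<pi> (a # u) = \<pi> [a] \<otimes> \<pi> u"
  using \<pi>_append[of "[a]" u] by simp

lemma \<pi>_inverse:
  assumes "x \<in> X"
  shows "\<pi> [(False, x)] = inv \<pi> [(True, x)]"
proof -
  have "\<pi> ([(False, x)] @ [(True, x)]) = \<pi> []"
    using assms word_eq.cancel[of x X "[]" "[]" R False] by (subst \<pi>_eq_iff) auto
  then have "\<pi> [(False, x)] \<otimes> \<pi> [(True, x)] = \<one>"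
    using assms \<pi>_append[of "[(False, x)]" "[(True, x)]"] \<pi>_Nil by simp
  then show ?thesis using assms \<pi>_closed inv_equality by simp
qed

lemma \<pi>_relation:
  assumes "(r, s) \<in> R" "r \<in> words_on X" "s \<in> words_on X"
  shows "\<pi> r = \<pi> s"
  using \<pi>_eq_iff[OF assms(2,3)] word_eq.relation[OF assms, of "[]" "[]"] by simp

end

section \<open>Right-angled Artin groups\<close>

lemma (in group) int_pow_commute:
  assumes x: "x \<in> carrier G" and y: "y \<in> carrier G" and comm: "x \<otimes> y = y \<otimes> x"
  shows "x [^] (i::int) \<otimes> y [^] (j::int) = y [^] j \<otimes> x [^] i"
proof -
  have C: "subgroup {z \<in> carrier G. z \<otimes> u = u \<otimes> z} G" if u: "u \<in> carrier G" for u
  proof (rule subgroupI)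
    show "{z \<in> carrier G. z \<otimes> u = u \<otimes> z} \<noteq> {}" using u by (auto intro!: exI[of _ \<one>])
    show "inv z \<in> {z \<in> carrier G. z \<otimes> u = u \<otimes> z}" if "z \<in> {z \<in> carrier G. z \<otimes> u = u \<otimes> z}" for z
    proof -
      have z: "z \<in> carrier G" "z \<otimes> u = u \<otimes> z" using that by auto
      have "inv z \<otimes> u = inv z \<otimes> (u \<otimes> z) \<otimes> inv z" using z(1) u by (simp add: m_assoc)
      also have "\<dots> = u \<otimes> inv z" unfolding z(2)[symmetric] using z(1) u by (simp add: m_assoc)
      finally show ?thesis using z(1) by simp
    qed
    show "a \<otimes> b \<in> {z \<in> carrier G. z \<otimes> u = u \<otimes> z}"
      if "a \<in> {z \<in> carrier G. z \<otimes> u = u \<otimes> z}" "b \<in> {z \<in> carrier G. z \<otimes> u = u \<otimes> z}" for a b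
    proof -
      have ab: "a \<in> carrier G" "b \<in> carrier G" "a \<otimes> u = u \<otimes> a" "b \<otimes> u = u \<otimes> b" using that by auto
      have "a \<otimes> b \<otimes> u = a \<otimes> (u \<otimes> b)" using ab u by (simp add: m_assoc)
      also have "\<dots> = u \<otimes> (a \<otimes> b)" using ab u by (simp flip: m_assoc)
      finally show ?thesis using ab by simp
    qed
  qed auto
  have 1: "x [^] i \<otimes> y = y \<otimes> x [^] i"
    using subgroup_int_pow_closed[OF C[OF y], of x i] x comm by simp
  have "y [^] j \<otimes> x [^] i = x [^] i \<otimes> y [^] j"
    using subgroup_int_pow_closed[OF C[of "x [^] i"], of y j] x y 1 by simp
  then show ?thesis ..
qed

lemma fold_push_replicate:
  fixes s :: int
  assumes w: "w \<in> lists (syllables I (\<lambda>_. integer_group))" and i: "i \<in> I"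
  shows "magnus_fun I (\<lambda>_. integer_group) E c \<Longrightarrow>
    fold push (replicate n (i, s)) c w = push (i, int n * s) c w"
proof (induction n arbitrary: c)
  case 0
  then show ?case using push_one[OF 0 i w] by simp
next
  case (Suc n)
  have s: "(i, s) \<in> syllables I (\<lambda>_. integer_group)" using i by (simp add: syllables_def)
  have "fold push (replicate (Suc n) (i, s)) c w = push (i, int n * s) (push (i, s) c) w"
    using Suc.IH[OF magnus_fun_push[OF Suc.prems s]] by simp
  also have "\<dots> = push (i, int (Suc n) * s) c w"
    using push_mult[OF Suc.prems i _ _ w, of s "int n * s"] by (simp add: algebra_simps)
  finally show ?case .
qed

text \<open>A syllable \<open>(v, e)\<close> is the \<open>e\<close>-th power of the generator \<open>v\<close>. Letters are the syllables with
exponent \<open>\<plusminus>1\<close> (\<open>syl\<close>), and syllables can be written out in letters (\<open>expand\<close>); invariance of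
\<open>subword_sum\<close> is inherited from the presentation, as it does not change under \<open>expand\<close>.\<close>

theorem raag_poly_separated:
  fixes G :: "('a, 'm) monoid_scheme" (structure)
  assumes raag: "right_angled_artin_group V E G"
  shows "poly_separated G"
proof -
  let ?R = "{([(True, u), (True, v)], [(True, v), (True, u)]) | u v. (u, v) \<in> E}"
  interpret group G using raag by (simp add: right_angled_artin_group_def)
  obtain \<pi> where "presented G V ?R \<pi>"
    using presented_exists[of G V ?R] raag by (auto simp: right_angled_artin_group_def)
  then interpret presented G V ?R \<pi> .
  let ?H = "\<lambda>_. integer_group"
  let ?S = "syllables V ?H"
  define gen where "gen v = \<pi> [(True, v)]" for v
  have gen: "gen v \<in> carrier G" if "v \<in> V" for v using that \<pi>_closed by (simp add: gen_def)
  define p where "p v e = gen v [^] (e::int)" for v e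
  define val where "val w = foldr (\<lambda>(v, e) g. p v e \<otimes> g) w \<one>" for w
  define syl where "syl = (\<lambda>(b, v::'b). (v, if b then 1 else - 1 :: int))"
  define expand where "expand = (\<lambda>(v::'b, e::int). replicate (nat \<bar>e\<bar>) (e > 0, v))"
  have S_iff: "y \<in> ?S \<longleftrightarrow> fst y \<in> V" for y by (cases y) (simp add: syllables_def)
  have gen_comm: "gen u \<otimes> gen v = gen v \<otimes> gen u" if "u \<in> V" "v \<in> V" "(u, v) \<in> E" for u v
  proof -
    have "\<pi> [(True, u), (True, v)] = \<pi> [(True, v), (True, u)]"
      by (rule \<pi>_relation) (use that in auto)
    then show ?thesis
      using that \<pi>_Cons[of "(True, u)" "[(True, v)]"] \<pi>_Cons[of "(True, v)" "[(True, u)]"]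
      by (simp add: gen_def)
  qed
  have letter: "\<pi> [(b, v)] = p v (if b then 1 else - 1)" if "v \<in> V" for b v
    using that gen[OF that] \<pi>_inverse[OF that]
    by (cases b) (auto simp: p_def gen_def[symmetric] int_pow_neg)
  have val_syl: "val (map syl u) = \<pi> u" if "u \<in> words_on V" for u
    using that
  proof (induction u)
    case Nil
    then show ?case by (simp add: val_def \<pi>_Nil)
  next
    case (Cons a u)
    then show ?case
      using \<pi>_Cons[of a u] letter[of "snd a" "fst a"] by (cases a) (simp add: val_def syl_def)
  qed
  have \<pi>_replicate: "replicate n (b, v) \<in> words_on V \<and>
      \<pi> (replicate n (b, v)) = p v (int n * (if b then 1 else - 1))" if v: "v \<in> V" for n b v
  proof (induction n)
    case 0
    then show ?case using gen[OF v] by (simp add: \<pi>_Nil p_def)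
  next
    case (Suc n)
    then have "\<pi> (replicate (Suc n) (b, v)) =
        p v (if b then 1 else - 1) \<otimes> p v (int n * (if b then 1 else - 1))"
      using \<pi>_Cons[of "(b, v)" "replicate n (b, v)"] letter[OF v] v by simp
    also have "\<dots> = p v (int (Suc n) * (if b then 1 else - 1))"
      using gen[OF v] by (simp add: p_def int_pow_mult[symmetric] algebra_simps)
    finally show ?case using Suc v by simp
  qed
  have sign: "int (nat \<bar>e\<bar>) * (if e > 0 then 1 else - 1) = e" for e :: int by auto
  have expand: "concat (map expand w) \<in> words_on V \<and> \<pi> (concat (map expand w)) = val w"
    if "w \<in> lists ?S" for w
    using that
  proof (induction w)
    case Nil
    then show ?case by (simp add: val_def \<pi>_Nil)
  next
    case (Cons y w)
    obtain v e where y: "y = (v, e)" by (cases y)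
    then have v: "v \<in> V" using Cons.hyps S_iff[of y] by simp
    show ?case
      using \<pi>_replicate[OF v, of "nat \<bar>e\<bar>" "e > 0"] Cons.IH
        \<pi>_append[of "expand y" "concat (map expand w)"] sign[of e]
      by (simp add: y expand_def val_def)
  qed
  have sum_expand: "subword_sum c (map syl (concat (map expand w))) = subword_sum c w"
    if "w \<in> lists ?S" "magnus_fun V ?H E c" for w c
    using that
  proof (induction w arbitrary: c)
    case Nil
    then show ?case by simp
  next
    case (Cons y w)
    obtain v e where y: "y = (v, e)" by (cases y)
    then have v: "v \<in> V" using Cons.hyps S_iff[of y] by simp
    have "map syl (expand y) = replicate (nat \<bar>e\<bar>) (v, if e > 0 then 1 else - 1)"
      by (simp add: y expand_def syl_def map_replicate)
    then have eq: "fold push (map syl (expand y)) c z = push y c z" if "z \<in> lists ?S" for z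
      using fold_push_replicate[OF that v Cons.prems] sign[of e] y by simp
    have words: "map syl (concat (map expand w)) \<in> lists ?S"
    proof -
      have "u \<in> words_on V \<Longrightarrow> map syl u \<in> lists ?S" for u
        by (induction u) (auto simp: syl_def S_iff)
      then show ?thesis using expand[OF Cons.hyps(2)] by blast
    qed
    have "subword_sum c (map syl (concat (map expand (y # w)))) =
        subword_sum (fold push (map syl (expand y)) c) (map syl (concat (map expand w)))"
      by (simp add: subword_sum_append)
    also have "\<dots> = subword_sum (push y c) (map syl (concat (map expand w)))"
      by (rule subword_sum_cong[where Y = ?S]) (use eq words in auto)
    also have "\<dots> = subword_sum (push y c) w"
      by (rule Cons.IH) (rule magnus_fun_push[OF Cons.prems Cons.hyps(1)])
    finally show ?case by (simp add: subword_sum_def)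
  qed
  interpret integer_syllable_group G V E p
  proof (intro integer_syllable_group.intro syllable_group.intro syllable_group_axioms.intro is_group)
    fix i assume i: "i \<in> V"
    show "p i \<in> hom integer_group G"
      using gen[OF i] by (auto simp: hom_def p_def int_pow_mult)
    show "p i a \<otimes> p j b = p j b \<otimes> p i a" if "j \<in> V" "(i, j) \<in> E" for j a b
      unfolding p_def using i that gen gen_comm by (intro int_pow_commute) auto
  next
    fix g assume "g \<in> carrier G"
    then obtain u where u: "u \<in> words_on V" "\<pi> u = g" using \<pi>_surj by blast
    then have "map syl u \<in> lists ?S"
      by (induction u arbitrary: g) (auto simp: syl_def S_iff)
    then show "\<exists>w\<in>lists ?S. foldr (\<lambda>(i, a). (\<otimes>) (p i a)) w \<one> = g"
      using val_syl[OF u(1)] u(2) unfolding val_def by blast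
  next
    fix c u v assume c: "magnus_fun V ?H E c" and uv: "u \<in> lists ?S" "v \<in> lists ?S"
      and "foldr (\<lambda>(i, a). (\<otimes>) (p i a)) u \<one> = foldr (\<lambda>(i, a). (\<otimes>) (p i a)) v \<one>"
    then have "val u = val v" by (simp add: val_def)
    then have eq: "word_eq V ?R (concat (map expand u)) (concat (map expand v))"
      using expand[OF uv(1)] expand[OF uv(2)]
        \<pi>_eq_iff[of "concat (map expand u)" "concat (map expand v)"] by simp
    have "subword_sum c (map syl (concat (map expand u))) =
        subword_sum c (map syl (concat (map expand v)))"
    proof (rule subword_sum_word_eq[OF _ _ _ eq c])
      show "syl (b, x) \<in> ?S" if "x \<in> V" for b x using that by (simp add: syl_def S_iff)
      show "push (syl (\<not> b, x)) (push (syl (b, x)) d) w = d w"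
        if "x \<in> V" "magnus_fun V ?H E d" "w \<in> lists ?S" for b x d w
        using push_mult[OF that(2,1) _ _ that(3)] push_one[OF that(2,1,3)]
        by (cases b) (simp_all add: syl_def)
      show "fold push (map syl r) d w = fold push (map syl s) d w"
        if "(r, s) \<in> ?R" "r \<in> words_on V" "magnus_fun V ?H E d" "w \<in> lists ?S" for r s d w
        using that push_swap[OF that(3) _ _ _ _ _ that(4)] by (auto simp: syl_def)
    qed
    then show "subword_sum c u = subword_sum c v" using sum_expand c uv by simp
  qed auto
  show ?thesis by (rule integer_syllable_poly_separated)
qed

text \<open>A free group is a right-angled Artin group in which no generators are required to commute.\<close>

lemma free_group_poly_separated:
  fixes G :: "('a, 'm) monoid_scheme"
  assumes "free_group G"
  shows "poly_separated G"
proof -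
  obtain X :: "'a set" where "group G" "presented_group X {} \<cong> G" using assms by (auto simp: free_group_def)
  then have "right_angled_artin_group X {} G" by (simp add: right_angled_artin_group_def)
  then show ?thesis by (rule raag_poly_separated)
qed

lemma residually_free_poly_separated: "residually_free G \<Longrightarrow> poly_separated G"
  unfolding residually_free_def by (erule poly_separated_residually) (rule free_group_poly_separated)

section \<open>Presentations of free products\<close>

theorem free_product_poly_separated:
  fixes G :: "('a, 'm) monoid_scheme" (structure)
  assumes fp: "free_product I H G" and sep: "\<And>i. i \<in> I \<Longrightarrow> poly_separated (H i)"
  shows "poly_separated G"
proof -
  let ?X = "SIGMA i:I. carrier (H i)"
  let ?R = "{([(True, (i, a)), (True, (i, b))], [(True, (i, a \<otimes>\<^bsub>H i\<^esub> b))]) | i a b.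
          i \<in> I \<and> a \<in> carrier (H i) \<and> b \<in> carrier (H i)}"
  let ?S = "syllables I H"
  have X: "?X = ?S" by (simp add: syllables_def)
  interpret group G using fp by (simp add: free_product_def)
  have Hg: "group (H i)" if "i \<in> I" for i using fp that by (simp add: free_product_def)
  obtain \<pi> where "presented G ?X ?R \<pi>"
    using presented_exists[of G ?X ?R] fp by (auto simp: free_product_def)
  then interpret presented G ?X ?R \<pi> .
  define p where "p i a = \<pi> [(True, (i, a))]" for i a
  define val where "val w = foldr (\<lambda>(i, a) g. p i a \<otimes> g) w \<one>" for w
  define syl where "syl = (\<lambda>(b, (i, a)). (i, if b then a else inv\<^bsub>H i\<^esub> a))"
  have p_hom: "p i \<in> hom (H i) G" if i: "i \<in> I" for i
  proof -
    have "p i (a \<otimes>\<^bsub>H i\<^esub> b) = p i a \<otimes> p i b" if ab: "a \<in> carrier (H i)" "b \<in> carrier (H i)" for a b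
    proof -
      have "a \<otimes>\<^bsub>H i\<^esub> b \<in> carrier (H i)" using Hg[OF i] ab by (simp add: group.is_monoid monoid.m_closed)
      then have "\<pi> [(True, (i, a)), (True, (i, b))] = \<pi> [(True, (i, a \<otimes>\<^bsub>H i\<^esub> b))]"
        using i ab by (intro \<pi>_relation) auto
      then show ?thesis
        using \<pi>_Cons[of "(True, (i, a))" "[(True, (i, b))]"] i ab by (simp add: p_def)
    qed
    then show ?thesis using \<pi>_closed i by (auto simp: hom_def p_def)
  qed
  have syl_S: "syl a \<in> ?S" if "snd a \<in> ?X" for a
    using that Hg by (auto simp: syl_def syllables_def split: prod.splits)
  have letter: "\<pi> [(b, (i, a))] = p i (if b then a else inv\<^bsub>H i\<^esub> a)"
    if "i \<in> I" "a \<in> carrier (H i)" for b i a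
  proof -
    interpret h: group_hom "H i" G "p i"
      by (intro group_hom.intro group_hom_axioms.intro Hg that is_group p_hom)
    show ?thesis using \<pi>_inverse[of "(i, a)"] that by (cases b) (auto simp: p_def[symmetric])
  qed
  have val_syl: "map syl u \<in> lists ?S \<and> val (map syl u) = \<pi> u" if "u \<in> words_on ?X" for u
    using that
  proof (induction u)
    case Nil
    then show ?case by (simp add: val_def \<pi>_Nil)
  next
    case (Cons y u)
    obtain b i a where y: "y = (b, (i, a))" by (cases y) auto
    then show ?case
      using Cons \<pi>_Cons[of y u] letter[of i a b] syl_S[of y] by (simp add: val_def syl_def)
  qed
  have val_\<pi>: "map (Pair True) w \<in> words_on ?X \<and> \<pi> (map (Pair True) w) = val w" if "w \<in> lists ?S" for w
    using that
  proof (induction w)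
    case Nil
    then show ?case by (simp add: val_def \<pi>_Nil)
  next
    case (Cons y w)
    then show ?case
      using \<pi>_Cons[of "(True, y)" "map (Pair True) w"] X by (cases y) (simp add: val_def p_def)
  qed
  have syl_True: "map syl (map (Pair True) w) = w" for w
    by (induction w) (auto simp: syl_def)
  interpret syllable_group G I H "{}" p
  proof (intro syllable_group.intro syllable_group_axioms.intro is_group)
    show "group (H i)" if "i \<in> I" for i by (rule Hg[OF that])
    show "p i \<in> hom (H i) G" if "i \<in> I" for i by (rule p_hom[OF that])
    show "\<exists>w\<in>lists ?S. foldr (\<lambda>(i, a). (\<otimes>) (p i a)) w \<one> = g" if "g \<in> carrier G" for g
    proof -
      obtain u where "u \<in> words_on ?X" "\<pi> u = g" using \<pi>_surj[OF \<open>g \<in> carrier G\<close>] by blast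
      then show ?thesis using val_syl[of u] unfolding val_def by blast
    qed
    fix c u v assume c: "magnus_fun I H {} c" and uv: "u \<in> lists ?S" "v \<in> lists ?S"
      and "foldr (\<lambda>(i, a). (\<otimes>) (p i a)) u \<one> = foldr (\<lambda>(i, a). (\<otimes>) (p i a)) v \<one>"
    then have "val u = val v" by (simp add: val_def)
    then have eq: "word_eq ?X ?R (map (Pair True) u) (map (Pair True) v)"
      using val_\<pi>[OF uv(1)] val_\<pi>[OF uv(2)]
        \<pi>_eq_iff[of "map (Pair True) u" "map (Pair True) v"] by simp
    have "subword_sum c (map syl (map (Pair True) u)) = subword_sum c (map syl (map (Pair True) v))"
    proof (rule subword_sum_word_eq[OF _ _ _ eq c])
      show "syl (b, x) \<in> ?S" if "x \<in> ?X" for b x using syl_S[of "(b, x)"] that by simp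
      show "push (syl (\<not> b, x)) (push (syl (b, x)) d) w = d w"
        if x: "x \<in> ?X" and d: "magnus_fun I H {} d" and w: "w \<in> lists ?S" for b x d w
      proof -
        obtain i a where ia: "x = (i, a)" "i \<in> I" "a \<in> carrier (H i)" using x by auto
        interpret Hi: group "H i" by (rule Hg[OF ia(2)])
        show ?thesis
          using push_mult[OF d ia(2) _ _ w, of a "inv\<^bsub>H i\<^esub> a"] push_mult[OF d ia(2) _ _ w, of "inv\<^bsub>H i\<^esub> a" a]
            push_one[OF d ia(2) w] ia by (cases b) (simp_all add: syl_def)
      qed
      show "fold push (map syl r) d w = fold push (map syl s) d w"
        if "(r, s) \<in> ?R" "magnus_fun I H {} d" "w \<in> lists ?S" for r s d w
        using that push_mult[OF that(2) _ _ _ that(3)] by (auto simp: syl_def)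
    qed
    then show "subword_sum c u = subword_sum c v" unfolding syl_True .
  qed auto
  show ?thesis by (rule free_syllable_poly_separated[OF _ sep]) simp
qed

section \<open>An ordered abelian group as a tree over itself\<close>

context ordered_abelian_group
begin

lemma diff_eq_iff:
  assumes "x \<in> carrier \<Lambda>" "y \<in> carrier \<Lambda>" "z \<in> carrier \<Lambda>"
  shows "x \<otimes> inv z = y \<otimes> inv z \<longleftrightarrow> x = y" "z \<otimes> inv x = z \<otimes> inv y \<longleftrightarrow> x = y"
  using assms inv_inj by (auto simp: inj_on_def)

lemma mult_inv_cancel:
  "x \<in> carrier \<Lambda> \<Longrightarrow> y \<in> carrier \<Lambda> \<Longrightarrow> x \<otimes> y \<otimes> inv x = y"
  by (simp add: m_comm[of x] m_assoc)

lemma near_imp_between: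
  assumes lu: "l \<in> carrier \<Lambda>" "u \<in> carrier \<Lambda>" "l \<preceq> u" and p: "p \<in> carrier \<Lambda>"
    and near: "ogroup_dist \<Lambda> p l \<preceq> ogroup_dist \<Lambda> l u" "ogroup_dist \<Lambda> p u \<preceq> ogroup_dist \<Lambda> l u"
  shows "l \<preceq> p \<and> p \<preceq> u"
proof -
  have pu: "p \<preceq> u"
  proof (cases "u \<preceq> p")
    case True
    then have "l \<preceq> p" using lu p le_trans by blast
    then show ?thesis using near(1) lu p by (simp add: dist_eq diff_mono_iff)
  qed (use le_total lu p in blast)
  moreover have "l \<preceq> p" using near(2) lu p pu by (simp add: dist_eq diff_antimono_iff)
  ultimately show ?thesis by blast
qed

lemma segment_between_carrier:
  assumes "segment_between \<Lambda> (carrier \<Lambda>) (ogroup_dist \<Lambda>) x y S"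
  shows "x \<in> carrier \<Lambda>" "y \<in> carrier \<Lambda>"
  using assms le_refl unfolding segment_between_def ogroup_interval_def by auto

text \<open>Every point of a segment is at distance at most \<open>ogroup_dist \<Lambda> x y\<close> from both ends and hence
between them. Conversely, a point between \<open>x\<close> and \<open>y\<close> is determined by its distance from \<open>x\<close>, and all
distances up to \<open>ogroup_dist \<Lambda> x y\<close> occur.\<close>

lemma segment_between_eq_interval:
  assumes "segment_between \<Lambda> (carrier \<Lambda>) (ogroup_dist \<Lambda>) x y S"
  shows "S = (if x \<preceq> y then ogroup_interval \<Lambda> x y else ogroup_interval \<Lambda> y x)"
proof -
  obtain a b f where ab: "a \<in> carrier \<Lambda>" "b \<in> carrier \<Lambda>" "a \<preceq> b"
    and f: "f \<in> ogroup_interval \<Lambda> a b \<rightarrow> carrier \<Lambda>"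
    and iso: "\<And>\<mu> \<nu>. \<mu> \<in> ogroup_interval \<Lambda> a b \<Longrightarrow> \<nu> \<in> ogroup_interval \<Lambda> a b \<Longrightarrow>
                ogroup_dist \<Lambda> (f \<mu>) (f \<nu>) = ogroup_dist \<Lambda> \<mu> \<nu>"
    and S: "S = f ` ogroup_interval \<Lambda> a b" and fab: "f a = x" "f b = y"
    using assms unfolding segment_between_def by blast
  note [simp] = segment_between_carrier[OF assms] ab(1,2)
  have I: "a \<in> ogroup_interval \<Lambda> a b" "b \<in> ogroup_interval \<Lambda> a b"
    using ab le_refl by (auto simp: ogroup_interval_def)
  have len: "ogroup_dist \<Lambda> x y = b \<otimes> inv a" using iso[OF I] ab by (simp add: fab dist_eq)
  have f\<mu>: "f \<mu> \<in> carrier \<Lambda>" "ogroup_dist \<Lambda> (f \<mu>) x = \<mu> \<otimes> inv a"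
    "ogroup_dist \<Lambda> (f \<mu>) y = b \<otimes> inv \<mu>" if "\<mu> \<in> ogroup_interval \<Lambda> a b" for \<mu>
    using iso[OF that I(1)] iso[OF that I(2)] f that
    by (auto simp: fab ogroup_interval_def dist_eq)
  have between: "l \<preceq> f \<mu> \<and> f \<mu> \<preceq> u"
    if "\<mu> \<in> ogroup_interval \<Lambda> a b" "l \<preceq> u" "l = x \<and> u = y \<or> l = y \<and> u = x" for l u \<mu>
    using that(3)
  proof (elim disjE conjE; intro near_imp_between; hypsubst?)
  qed (use that f\<mu>[OF that(1)] len dist_sym[of x y] in
        \<open>auto simp: ogroup_interval_def diff_mono_iff diff_antimono_iff\<close>)
  have mem: "a \<otimes> \<delta> \<in> ogroup_interval \<Lambda> a b"
    if "\<delta> \<in> carrier \<Lambda>" "\<one> \<preceq> \<delta>" "\<delta> \<preceq> b \<otimes> inv a" for \<delta>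
    using that translation_invariant[of \<one> \<delta> a] translation_invariant[of \<delta> "b \<otimes> inv a" a]
    by (auto simp: ogroup_interval_def)
  show ?thesis
  proof (cases "x \<preceq> y")
    case True
    have "S \<subseteq> ogroup_interval \<Lambda> x y"
      using between[OF _ True] f\<mu>(1) unfolding S by (auto simp: ogroup_interval_def)
    moreover have "q \<in> S" if "q \<in> ogroup_interval \<Lambda> x y" for q
    proof -
      have q: "q \<in> carrier \<Lambda>" "x \<preceq> q" "q \<preceq> y" using that by (auto simp: ogroup_interval_def)
      define \<mu> where "\<mu> = a \<otimes> (q \<otimes> inv x)"
      have \<mu>: "\<mu> \<in> ogroup_interval \<Lambda> a b"
        unfolding \<mu>_def
        using q len[symmetric] dist_eq(2)[of x y] True
        by (intro mem) (auto simp: le_diff_iff diff_mono_iff)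
      have "f \<mu> \<otimes> inv x = q \<otimes> inv x"
        using f\<mu>[OF \<mu>] between[OF \<mu> True] q
        by (simp add: dist_eq) (simp add: \<mu>_def mult_inv_cancel)
      then have "f \<mu> = q" using diff_eq_iff(1)[of "f \<mu>" q x] f\<mu>(1)[OF \<mu>] q(1) segment_between_carrier[OF assms] by blast
      then show ?thesis using \<mu> S by blast
    qed
    ultimately show ?thesis using True by auto
  next
    case False
    then have yx: "y \<preceq> x" using le_total[of x y] by simp
    have "S \<subseteq> ogroup_interval \<Lambda> y x"
      using between[OF _ yx] f\<mu>(1) unfolding S by (auto simp: ogroup_interval_def)
    moreover have "q \<in> S" if "q \<in> ogroup_interval \<Lambda> y x" for q
    proof -
      have q: "q \<in> carrier \<Lambda>" "y \<preceq> q" "q \<preceq> x" using that by (auto simp: ogroup_interval_def)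
      define \<mu> where "\<mu> = a \<otimes> (x \<otimes> inv q)"
      have \<mu>: "\<mu> \<in> ogroup_interval \<Lambda> a b"
        unfolding \<mu>_def
        using q len[symmetric] dist_eq(1)[of y x] yx
        by (intro mem) (auto simp: le_diff_iff diff_antimono_iff)
      have "x \<otimes> inv (f \<mu>) = x \<otimes> inv q"
        using f\<mu>[OF \<mu>] between[OF \<mu> yx] q
        by (simp add: dist_eq) (simp add: \<mu>_def mult_inv_cancel)
      then have "f \<mu> = q" using diff_eq_iff(2)[of "f \<mu>" q x] f\<mu>(1)[OF \<mu>] q(1) segment_between_carrier[OF assms] by blast
      then show ?thesis using \<mu> S by blast
    qed
    ultimately show ?thesis using False by auto
  qed
qed

lemma segment_between_exists:
  assumes [simp]: "x \<in> carrier \<Lambda>" "y \<in> carrier \<Lambda>"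
  shows "\<exists>S. segment_between \<Lambda> (carrier \<Lambda>) (ogroup_dist \<Lambda>) x y S"
proof (cases "x \<preceq> y")
  case True
  then show ?thesis
    unfolding segment_between_def
    by (intro exI[of _ "ogroup_interval \<Lambda> x y"] bexI[of _ x] bexI[of _ y] exI[of _ "\<lambda>\<mu>. \<mu>"])
       (auto simp: ogroup_interval_def)
next
  case False
  then have yx: "y \<preceq> x" using le_total[of x y] by simp
  let ?f = "\<lambda>\<mu>. (x \<otimes> y) \<otimes> inv \<mu>"
  have "ogroup_dist \<Lambda> (?f \<mu>) (?f \<nu>) = ogroup_dist \<Lambda> \<mu> \<nu>"
    if "\<mu> \<in> carrier \<Lambda>" "\<nu> \<in> carrier \<Lambda>" for \<mu> \<nu>
  proof -
    have "?f \<mu> \<otimes> inv (?f \<nu>) = \<nu> \<otimes> inv \<mu>"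
      using that by (simp add: inv_mult_group m_ac)
    then show ?thesis using dist_sym[OF that] by (simp add: ogroup_dist_def)
  qed
  then show ?thesis
    unfolding segment_between_def using yx
    by (intro exI[of _ "?f ` ogroup_interval \<Lambda> y x"] bexI[of _ y] bexI[of _ x] exI[of _ ?f])
       (auto simp: ogroup_interval_def m_assoc mult_inv_cancel)
qed

lemma dist_triangle:
  assumes [simp]: "x \<in> carrier \<Lambda>" "y \<in> carrier \<Lambda>" "z \<in> carrier \<Lambda>"
  shows "ogroup_dist \<Lambda> x z \<preceq> ogroup_dist \<Lambda> x y \<otimes> ogroup_dist \<Lambda> y z"
proof -
  have abs_ge: "t \<preceq> ogroup_abs \<Lambda> t" if [simp]: "t \<in> carrier \<Lambda>" for t
  proof (cases "\<one> \<preceq> t")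
    case False
    then have "t \<preceq> \<one>" using le_total[of t \<one>] by simp
    then have "\<one> \<preceq> inv t" using le_diff_iff[of t \<one>] by simp
    with \<open>t \<preceq> \<one>\<close> have "t \<preceq> inv t" using le_trans[of t \<one> "inv t"] by simp
    then show ?thesis using False by (simp add: ogroup_abs_def)
  qed (simp add: ogroup_abs_def le_refl)
  have add_mono: "s \<otimes> t \<preceq> s' \<otimes> t'"
    if [simp]: "s \<in> carrier \<Lambda>" "t \<in> carrier \<Lambda>" "s' \<in> carrier \<Lambda>" "t' \<in> carrier \<Lambda>"
      and "s \<preceq> s'" "t \<preceq> t'" for s t s' t'
    using translation_invariant[of t t' s] translation_invariant[of s s' t'] that
      le_trans[of "s \<otimes> t" "s \<otimes> t'" "s' \<otimes> t'"] by (simp add: m_comm)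
  have diff: "p \<otimes> inv q \<preceq> ogroup_dist \<Lambda> p q" if "p \<in> carrier \<Lambda>" "q \<in> carrier \<Lambda>" for p q
    using abs_ge that by (simp add: ogroup_dist_def)
  have tri: "p \<otimes> inv r \<preceq> ogroup_dist \<Lambda> p q \<otimes> ogroup_dist \<Lambda> q r"
    if [simp]: "p \<in> carrier \<Lambda>" "q \<in> carrier \<Lambda>" "r \<in> carrier \<Lambda>" for p q r
    using add_mono[OF _ _ _ _ diff[of p q] diff[of q r]] by (simp add: m_assoc)
  show ?thesis
  proof (cases "z \<preceq> x")
    case True
    then show ?thesis using tri[of x y z] by (simp add: dist_eq)
  next
    case False
    then have "x \<preceq> z" using le_total[of x z] by simp
    then show ?thesis
      using tri[of z y x] dist_sym[of x y] dist_sym[of y z] by (simp add: dist_eq m_comm)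
  qed
qed

lemma Lambda_metric_self: "Lambda_metric_space \<Lambda> (carrier \<Lambda>) (ogroup_dist \<Lambda>)"
proof -
  have pos: "\<one> \<preceq> ogroup_dist \<Lambda> x y" and zero: "ogroup_dist \<Lambda> x y = \<one> \<longleftrightarrow> x = y"
    if [simp]: "x \<in> carrier \<Lambda>" "y \<in> carrier \<Lambda>" for x y
  proof -
    have *: "\<one> \<preceq> ogroup_dist \<Lambda> x y \<and> (ogroup_dist \<Lambda> x y = \<one> \<longleftrightarrow> x = y)"
      if [simp]: "x \<in> carrier \<Lambda>" "y \<in> carrier \<Lambda>" and le: "x \<preceq> y" for x y
      using le diff_eq_iff(1)[of y x x] by (simp add: dist_eq le_diff_iff eq_commute)
    show "\<one> \<preceq> ogroup_dist \<Lambda> x y" "ogroup_dist \<Lambda> x y = \<one> \<longleftrightarrow> x = y"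
      using *[of x y] *[of y x] dist_sym[of x y] le_total[of x y] by auto
  qed
  show ?thesis
    unfolding Lambda_metric_space_def
    using pos zero dist_sym dist_triangle by simp
qed

text \<open>Two intervals with the common endpoint \<open>x\<close> are nested if they extend to the same side of \<open>x\<close>, and
meet only in \<open>x\<close> otherwise.\<close>

lemma Lambda_tree_self: "Lambda_tree \<Lambda> (carrier \<Lambda>) (ogroup_dist \<Lambda>)"
proof -
  let ?seg = "segment_between \<Lambda> (carrier \<Lambda>) (ogroup_dist \<Lambda>)"
  let ?is = "is_segment \<Lambda> (carrier \<Lambda>) (ogroup_dist \<Lambda>)"
  have two: "?is (S \<inter> T) \<and> (S \<inter> T = {x} \<longrightarrow> ?is (S \<union> T))"
    if ST: "?seg x y S" "?seg x z T" for x y z S T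
  proof -
    note [simp] = segment_between_carrier[OF ST(1)] segment_between_carrier(2)[OF ST(2)]
    note S = segment_between_eq_interval[OF ST(1)]
    note T = segment_between_eq_interval[OF ST(2)]
    note tot = le_total[of x y] le_total[of x z] le_total[of y z]
    have int: "?is A" if "A = ogroup_interval \<Lambda> l u" "l \<in> carrier \<Lambda>" "u \<in> carrier \<Lambda>" "l \<preceq> u" for A l u
      using interval_is_segment that by blast
    have sub: "ogroup_interval \<Lambda> l u \<subseteq> ogroup_interval \<Lambda> l' u'"
      if "l' \<preceq> l" "u \<preceq> u'" "l \<in> carrier \<Lambda>" "u \<in> carrier \<Lambda>" "l' \<in> carrier \<Lambda>" "u' \<in> carrier \<Lambda>" for l u l' u'
      using that le_trans unfolding ogroup_interval_def by blast
    have nested: ?thesis if "A = ogroup_interval \<Lambda> l u" "l \<in> carrier \<Lambda>" "u \<in> carrier \<Lambda>" "l \<preceq> u"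
      "B = ogroup_interval \<Lambda> l' u'" "l' \<in> carrier \<Lambda>" "u' \<in> carrier \<Lambda>" "l' \<preceq> u'" "A \<subseteq> B"
      "S = A \<and> T = B \<or> S = B \<and> T = A" for A B l u l' u'
      using that int[OF that(1-4)] int[OF that(5-8)] by (metis Int_absorb1 Int_absorb2 Un_absorb1 Un_absorb2)
    have opposite: ?thesis
      if "l \<preceq> x" "x \<preceq> u" "S = ogroup_interval \<Lambda> l x \<and> T = ogroup_interval \<Lambda> x u \<or>
        S = ogroup_interval \<Lambda> x u \<and> T = ogroup_interval \<Lambda> l x" "l \<in> carrier \<Lambda>" "u \<in> carrier \<Lambda>" for l u
    proof -
      have "ogroup_interval \<Lambda> x x \<subseteq> S \<inter> T" using that sub[of l x x x] sub[of x x x u] le_refl by auto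
      then have "S \<inter> T = ogroup_interval \<Lambda> x x" using that unfolding ogroup_interval_def by blast
      moreover have "S \<union> T = ogroup_interval \<Lambda> l u"
      proof
        show "S \<union> T \<subseteq> ogroup_interval \<Lambda> l u" using that sub[of l l x u] sub[of l x u u] le_refl by auto
        show "ogroup_interval \<Lambda> l u \<subseteq> S \<union> T" using that le_total[of _ x] unfolding ogroup_interval_def by auto
      qed
      moreover have "l \<preceq> u" using that le_trans[of l x u] by simp
      ultimately show ?thesis using int[of _ x x] int[of _ l u] that le_refl by simp
    qed
    consider "x \<preceq> y" "x \<preceq> z" | "\<not> x \<preceq> y" "\<not> x \<preceq> z" | "x \<preceq> y" "\<not> x \<preceq> z" | "\<not> x \<preceq> y" "x \<preceq> z"
      by blast
    then show ?thesis
    proof cases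
      case 1
      show ?thesis
      proof (cases "y \<preceq> z")
        case True
        show ?thesis by (rule nested[of S x y T x z]) (use 1 True S T sub le_refl in auto)
      next
        case False
        then have "z \<preceq> y" using tot by auto
        then show ?thesis by (intro nested[of T x z S x y]) (use 1 S T sub le_refl in auto)
      qed
    next
      case 2
      then have yz: "y \<preceq> x" "z \<preceq> x" using tot by auto+
      show ?thesis
      proof (cases "y \<preceq> z")
        case True
        show ?thesis by (rule nested[of T z x S y x]) (use 2 yz True S T sub le_refl in auto)
      next
        case False
        then have "z \<preceq> y" using tot by auto
        then show ?thesis by (intro nested[of S y x T z x]) (use 2 yz S T sub le_refl in auto)
      qed
    next
      case 3
      then have "z \<preceq> x" using tot by auto
      then show ?thesis by (intro opposite[of z y]) (use 3 S T in auto)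
    next
      case 4
      then have "y \<preceq> x" using tot by auto
      then show ?thesis by (intro opposite[of y z]) (use 4 S T in auto)
    qed
  qed
  show ?thesis
    unfolding Lambda_tree_def
    using Lambda_metric_self segment_between_exists two one_closed by blast
qed

end

section \<open>Affine actions from invariant cones\<close>

lemma (in group) hom_BijGroup_I:
  assumes ext: "\<And>g. g \<in> carrier G \<Longrightarrow> f g \<in> extensional E"
    and cl: "\<And>g x. g \<in> carrier G \<Longrightarrow> x \<in> E \<Longrightarrow> f g x \<in> E"
    and one: "\<And>x. x \<in> E \<Longrightarrow> f \<one> x = x"
    and mult: "\<And>g h x. g \<in> carrier G \<Longrightarrow> h \<in> carrier G \<Longrightarrow> x \<in> E \<Longrightarrow> f (g \<otimes> h) x = f g (f h x)"
  shows "f \<in> hom G (BijGroup E)"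
proof -
  have B: "f g \<in> Bij E" if g: "g \<in> carrier G" for g
  proof -
    have "bij_betw (f g) E E"
      by (rule bij_betw_byWitness[where f' = "f (inv g)"])
         (use g cl one mult[of "inv g" g] mult[of g "inv g"] in auto)
    then show ?thesis using ext g by (simp add: Bij_def)
  qed
  have "f (g \<otimes> h) = compose E (f g) (f h)" if "g \<in> carrier G" "h \<in> carrier G" for g h
    by (rule extensionalityI[of _ E]) (use that ext mult in \<open>auto simp: compose_def\<close>)
  then show ?thesis using B by (auto simp: hom_def BijGroup_def)
qed

text \<open>A map that moves all points up does not map the upper end of an interval into the interval.\<close>

lemma (in ordered_abelian_group) interval_not_shrunk:
  assumes f: "\<And>x. x \<in> carrier \<Lambda> \<Longrightarrow> f x \<in> carrier \<Lambda>"
    and dir: "(\<forall>x\<in>carrier \<Lambda>. x \<prec> f x) \<or> (\<forall>x\<in>carrier \<Lambda>. f x \<prec> x)"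
    and a: "a \<in> carrier \<Lambda>" and b: "b \<in> carrier \<Lambda>"
  shows "\<not> f ` ogroup_interval \<Lambda> a b \<subset> ogroup_interval \<Lambda> a b"
proof
  assume sub: "f ` ogroup_interval \<Lambda> a b \<subset> ogroup_interval \<Lambda> a b"
  then obtain x where "x \<in> ogroup_interval \<Lambda> a b" by blast
  then have "a \<preceq> b" using a b le_trans unfolding ogroup_interval_def by blast
  then have "a \<in> ogroup_interval \<Lambda> a b" "b \<in> ogroup_interval \<Lambda> a b"
    using a b le_refl by (auto simp: ogroup_interval_def)
  then have "f a \<in> ogroup_interval \<Lambda> a b" "f b \<in> ogroup_interval \<Lambda> a b" using sub by auto
  then have "a \<preceq> f a" "f b \<preceq> b" by (auto simp: ogroup_interval_def)
  then show False using dir a b f le_antisym unfolding lt_def by metis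
qed

text \<open>The set \<open>P\<close> consists of the elements of \<open>D\<close> that are to become non-negative; elements of
\<open>P \<inter> - P\<close> are to become zero. The group acts on \<open>D\<close> by \<open>x \<mapsto> a g x + \<tau> g\<close>, so that \<open>\<tau>\<close> is a
cocycle.\<close>

locale cone_action = group G for G :: "('g, 'm) monoid_scheme" (structure) +
  fixes D P :: "'b::ab_group_add set" and a :: "'g \<Rightarrow> 'b \<Rightarrow> 'b" and \<tau> :: "'g \<Rightarrow> 'b"
  assumes D_zero: "0 \<in> D"
    and D_add: "x \<in> D \<Longrightarrow> y \<in> D \<Longrightarrow> x + y \<in> D"
    and D_uminus: "x \<in> D \<Longrightarrow> - x \<in> D"
    and P_subset: "P \<subseteq> D"
    and P_add: "x \<in> P \<Longrightarrow> y \<in> P \<Longrightarrow> x + y \<in> P"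
    and P_total: "x \<in> D \<Longrightarrow> x \<in> P \<or> - x \<in> P"
    and a_closed: "g \<in> carrier G \<Longrightarrow> x \<in> D \<Longrightarrow> a g x \<in> D"
    and a_add: "g \<in> carrier G \<Longrightarrow> x \<in> D \<Longrightarrow> y \<in> D \<Longrightarrow> a g (x + y) = a g x + a g y"
    and a_one: "x \<in> D \<Longrightarrow> a \<one> x = x"
    and a_mult: "g \<in> carrier G \<Longrightarrow> h \<in> carrier G \<Longrightarrow> x \<in> D \<Longrightarrow> a (g \<otimes> h) x = a g (a h x)"
    and a_P: "g \<in> carrier G \<Longrightarrow> x \<in> P \<Longrightarrow> a g x \<in> P"
    and \<tau>_closed: "g \<in> carrier G \<Longrightarrow> \<tau> g \<in> D"
    and \<tau>_mult: "g \<in> carrier G \<Longrightarrow> h \<in> carrier G \<Longrightarrow> \<tau> (g \<otimes> h) = a g (\<tau> h) + \<tau> g"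
    and moves: "g \<in> carrier G \<Longrightarrow> g \<noteq> \<one> \<Longrightarrow>
      (\<forall>x\<in>D. a g x + \<tau> g - x \<in> P \<and> x - (a g x + \<tau> g) \<notin> P) \<or>
      (\<forall>x\<in>D. x - (a g x + \<tau> g) \<in> P \<and> a g x + \<tau> g - x \<notin> P)"
begin

lemma P_zero: "0 \<in> P" using P_total[OF D_zero] by simp
lemma D_diff: "x \<in> D \<Longrightarrow> y \<in> D \<Longrightarrow> x - y \<in> D"
  using D_add[OF _ D_uminus] by (metis diff_conv_add_uminus)

lemma P_trans: "x - y \<in> P \<Longrightarrow> y - z \<in> P \<Longrightarrow> x - z \<in> P"
  using P_add[of "x - y" "y - z"] by simp

lemma a_zero: "g \<in> carrier G \<Longrightarrow> a g 0 = 0"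
  using a_add[of g 0 0] D_zero by simp

lemma a_uminus: "g \<in> carrier G \<Longrightarrow> x \<in> D \<Longrightarrow> a g (- x) = - a g x"
  using a_add[of g x "- x"] D_uminus a_zero[of g] by (simp add: eq_neg_iff_add_eq_0 add.commute)

lemma a_diff: "g \<in> carrier G \<Longrightarrow> x \<in> D \<Longrightarrow> y \<in> D \<Longrightarrow> a g (x - y) = a g x - a g y"
  using a_add[of g x "- y"] D_uminus a_uminus by simp

definition coset :: "'b \<Rightarrow> 'b set" where
  "coset x = {y \<in> D. x - y \<in> P \<and> y - x \<in> P}"

lemma coset_eq_iff:
  assumes "x \<in> D" "y \<in> D"
  shows "coset x = coset y \<longleftrightarrow> x - y \<in> P \<and> y - x \<in> P"
proof
  assume eq: "coset x = coset y"
  have "y \<in> coset x" unfolding eq using assms P_zero by (simp add: coset_def)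
  then show "x - y \<in> P \<and> y - x \<in> P" by (simp add: coset_def)
next
  assume xy: "x - y \<in> P \<and> y - x \<in> P"
  have "x - z \<in> P \<longleftrightarrow> y - z \<in> P" "z - x \<in> P \<longleftrightarrow> z - y \<in> P" for z
    using xy P_trans[of x y z] P_trans[of y x z] P_trans[of z x y] P_trans[of z y x] by blast+
  then show "coset x = coset y" by (simp add: coset_def)
qed

definition rep :: "'b set \<Rightarrow> 'b" where
  "rep A = (SOME x. x \<in> D \<and> A = coset x)"

lemma rep:
  assumes "x \<in> D"
  shows "rep (coset x) \<in> D" "coset (rep (coset x)) = coset x"
proof -
  have "\<exists>y. y \<in> D \<and> coset x = coset y" using assms by blast
  from someI_ex[OF this] show "rep (coset x) \<in> D" "coset (rep (coset x)) = coset x"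
    unfolding rep_def by auto
qed

lemma rep_diff:
  assumes "x \<in> D"
  shows "x - rep (coset x) \<in> P" "rep (coset x) - x \<in> P"
  using rep[OF assms] assms by (auto simp: coset_eq_iff)

definition \<Lambda> :: "'b set ogroup" where
  "\<Lambda> = \<lparr>carrier = coset ` D, monoid.mult = (\<lambda>A B. coset (rep A + rep B)), one = coset 0,
         le = (\<lambda>A B. rep B - rep A \<in> P)\<rparr>"

lemma carrier_\<Lambda>: "carrier \<Lambda> = coset ` D" and one_\<Lambda>: "\<one>\<^bsub>\<Lambda>\<^esub> = coset 0"
  by (simp_all add: \<Lambda>_def)

lemma mult_\<Lambda>:
  assumes [simp]: "x \<in> D" "y \<in> D"
  shows "coset x \<otimes>\<^bsub>\<Lambda>\<^esub> coset y = coset (x + y)"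
proof -
  have "rep (coset x) + rep (coset y) - (x + y) \<in> P"
    using P_add[OF rep_diff(2)[of x] rep_diff(2)[of y]] by (simp add: algebra_simps)
  moreover have "x + y - (rep (coset x) + rep (coset y)) \<in> P"
    using P_add[OF rep_diff(1)[of x] rep_diff(1)[of y]] by (simp add: algebra_simps)
  ultimately show ?thesis using rep D_add by (simp add: \<Lambda>_def coset_eq_iff)
qed

lemma le_\<Lambda>:
  assumes [simp]: "x \<in> D" "y \<in> D"
  shows "coset x \<preceq>\<^bsub>\<Lambda>\<^esub> coset y \<longleftrightarrow> y - x \<in> P"
proof -
  have "rep (coset y) - rep (coset x) \<in> P \<longleftrightarrow> y - x \<in> P"
    using rep_diff[of x] rep_diff[of y] assms P_trans[of "rep (coset y)" y x]
      P_trans[of "rep (coset y)" x "rep (coset x)"] P_trans[of y "rep (coset y)" "rep (coset x)"]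
      P_trans[of y "rep (coset x)" x] by blast
  then show ?thesis by (simp add: \<Lambda>_def)
qed

lemma ordered_\<Lambda>: "ordered_abelian_group \<Lambda>"
proof -
  have cg: "comm_group \<Lambda>"
  proof (rule comm_groupI)
    fix A assume "A \<in> carrier \<Lambda>"
    then obtain x where "x \<in> D" "A = coset x" by (auto simp: carrier_\<Lambda>)
    then show "\<exists>B\<in>carrier \<Lambda>. B \<otimes>\<^bsub>\<Lambda>\<^esub> A = \<one>\<^bsub>\<Lambda>\<^esub>"
      using D_uminus by (intro bexI[of _ "coset (- x)"]) (auto simp: carrier_\<Lambda> mult_\<Lambda> one_\<Lambda>)
  qed (auto simp: carrier_\<Lambda> mult_\<Lambda> one_\<Lambda> D_add D_zero algebra_simps)
  show ?thesis
  proof (intro ordered_abelian_group.intro cg ordered_abelian_group_axioms.intro)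
    fix A B assume "A \<in> carrier \<Lambda>" "B \<in> carrier \<Lambda>"
    then obtain x y where xy: "x \<in> D" "A = coset x" "y \<in> D" "B = coset y" by (auto simp: carrier_\<Lambda>)
    show "A \<preceq>\<^bsub>\<Lambda>\<^esub> B \<or> B \<preceq>\<^bsub>\<Lambda>\<^esub> A" using xy P_total[OF D_diff[of x y]] by (auto simp: le_\<Lambda>)
    show "A = B" if "A \<preceq>\<^bsub>\<Lambda>\<^esub> B" "B \<preceq>\<^bsub>\<Lambda>\<^esub> A" using that xy by (simp add: le_\<Lambda> coset_eq_iff)
  next
    fix A B C assume "A \<in> carrier \<Lambda>" "B \<in> carrier \<Lambda>" "C \<in> carrier \<Lambda>"
    then obtain x y z where xyz: "x \<in> D" "A = coset x" "y \<in> D" "B = coset y" "z \<in> D" "C = coset z"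
      by (auto simp: carrier_\<Lambda>)
    show "A \<preceq>\<^bsub>\<Lambda>\<^esub> C" if "A \<preceq>\<^bsub>\<Lambda>\<^esub> B" "B \<preceq>\<^bsub>\<Lambda>\<^esub> C"
      using that xyz P_trans by (auto simp: le_\<Lambda>)
    show "C \<otimes>\<^bsub>\<Lambda>\<^esub> A \<preceq>\<^bsub>\<Lambda>\<^esub> C \<otimes>\<^bsub>\<Lambda>\<^esub> B" if "A \<preceq>\<^bsub>\<Lambda>\<^esub> B"
      using that xyz by (auto simp: le_\<Lambda> mult_\<Lambda> D_add)
  qed
qed

sublocale L: ordered_abelian_group \<Lambda> by (rule ordered_\<Lambda>)

lemma inv_\<Lambda>: "x \<in> D \<Longrightarrow> inv\<^bsub>\<Lambda>\<^esub> coset x = coset (- x)"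
  using D_uminus by (intro L.inv_equality) (auto simp: carrier_\<Lambda> mult_\<Lambda> one_\<Lambda>)

definition \<alpha> :: "'g \<Rightarrow> 'b set \<Rightarrow> 'b set" where
  "\<alpha> g = restrict (\<lambda>A. coset (a g (rep A))) (coset ` D)"

definition \<phi> :: "'g \<Rightarrow> 'b set \<Rightarrow> 'b set" where
  "\<phi> g = restrict (\<lambda>A. coset (a g (rep A) + \<tau> g)) (coset ` D)"

lemma \<alpha>_coset:
  assumes "g \<in> carrier G" "x \<in> D"
  shows "\<alpha> g (coset x) = coset (a g x)"
proof -
  have "a g (rep (coset x)) - a g x \<in> P" "a g x - a g (rep (coset x)) \<in> P"
    using a_P[OF assms(1) rep_diff(1)[OF assms(2)]] a_P[OF assms(1) rep_diff(2)[OF assms(2)]]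
      a_diff rep assms by simp_all
  then show ?thesis using assms rep a_closed by (simp add: \<alpha>_def coset_eq_iff)
qed

lemma \<phi>_coset:
  assumes "g \<in> carrier G" "x \<in> D"
  shows "\<phi> g (coset x) = coset (a g x + \<tau> g)"
proof -
  have "\<phi> g (coset x) = \<alpha> g (coset x) \<otimes>\<^bsub>\<Lambda>\<^esub> coset (\<tau> g)"
    using assms rep a_closed \<tau>_closed by (simp add: \<phi>_def \<alpha>_def mult_\<Lambda>)
  then show ?thesis using assms a_closed \<tau>_closed by (simp add: \<alpha>_coset mult_\<Lambda>)
qed

lemma \<alpha>_hom: "\<alpha> \<in> hom G (Aut_plus \<Lambda>)"
proof -
  have B: "\<alpha> \<in> hom G (BijGroup (carrier \<Lambda>))"
    by (rule hom_BijGroup_I)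
       (auto simp: carrier_\<Lambda> \<alpha>_coset a_closed a_one a_mult, auto simp: \<alpha>_def)
  have "\<alpha> g \<in> hom \<Lambda> \<Lambda>" if "g \<in> carrier G" for g
    using that by (auto simp: hom_def carrier_\<Lambda> \<alpha>_coset a_closed mult_\<Lambda> D_add a_add)
  moreover have "\<alpha> g A \<preceq>\<^bsub>\<Lambda>\<^esub> \<alpha> g B"
    if "g \<in> carrier G" "A \<in> carrier \<Lambda>" "B \<in> carrier \<Lambda>" "A \<preceq>\<^bsub>\<Lambda>\<^esub> B" for g A B
    using that a_P by (auto simp: carrier_\<Lambda> \<alpha>_coset le_\<Lambda> a_closed simp flip: a_diff)
  ultimately show ?thesis
    using B by (auto simp: hom_def Aut_plus_def AutoGroup_def auto_def BijGroup_def)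
qed

lemma \<phi>_hom: "group_action G (carrier \<Lambda>) \<phi>"
proof -
  have "\<tau> \<one> = 0" using \<tau>_mult[of \<one> \<one>] a_one[OF \<tau>_closed[of \<one>]] by simp
  then have "\<phi> \<in> hom G (BijGroup (carrier \<Lambda>))"
    by (intro hom_BijGroup_I)
       (auto simp: carrier_\<Lambda> \<phi>_coset a_closed \<tau>_closed D_add a_one a_add a_mult \<tau>_mult add.assoc,
        auto simp: \<phi>_def)
  then show ?thesis
    using group_BijGroup is_group
    by (intro group_action.intro group_hom.intro group_hom_axioms.intro)
qed

lemma abs_\<Lambda>: "x \<in> D \<Longrightarrow> ogroup_abs \<Lambda> (coset x) = coset (if x \<in> P then x else - x)"
  using D_zero by (simp add: ogroup_abs_def one_\<Lambda> le_\<Lambda> inv_\<Lambda>)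

lemma linear_affine: "linear_affine_action G \<Lambda> \<alpha> \<phi>"
proof -
  have "ogroup_dist \<Lambda> (\<phi> g A) (\<phi> g B) = \<alpha> g (ogroup_dist \<Lambda> A B)"
    if g: "g \<in> carrier G" and AB: "A \<in> carrier \<Lambda>" "B \<in> carrier \<Lambda>" for g A B
  proof -
    obtain x y where xy: "x \<in> D" "A = coset x" "y \<in> D" "B = coset y"
      using AB by (auto simp: carrier_\<Lambda>)
    define z where "z = x - y"
    have z: "z \<in> D" using xy D_diff by (simp add: z_def)
    have 1: "A \<otimes>\<^bsub>\<Lambda>\<^esub> inv\<^bsub>\<Lambda>\<^esub> B = coset z"
      using xy D_uminus by (simp add: inv_\<Lambda> mult_\<Lambda> z_def)
    have 2: "\<phi> g A \<otimes>\<^bsub>\<Lambda>\<^esub> inv\<^bsub>\<Lambda>\<^esub> \<phi> g B = coset (a g z)"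
      using xy g D_uminus D_diff D_add a_closed \<tau>_closed
      by (simp add: \<phi>_coset inv_\<Lambda> mult_\<Lambda> z_def a_diff)
    have "coset (if a g z \<in> P then a g z else - a g z) = coset (a g (if z \<in> P then z else - z))"
    proof (cases "z \<in> P")
      case True
      then show ?thesis using a_P[OF g] by simp
    next
      case False
      then have "- a g z \<in> P" using a_P[OF g, of "- z"] P_total[OF z] a_uminus[OF g z] by simp
      then have "coset (a g z) = coset (- a g z)" if "a g z \<in> P"
        using that P_add[of "a g z" "a g z"] P_add[of "- a g z" "- a g z"] a_closed[OF g z] D_uminus
        by (simp add: coset_eq_iff)
      then show ?thesis using False a_uminus[OF g z] by simp
    qed
    then show ?thesis
      unfolding ogroup_dist_def 1 2 using abs_\<Lambda> z a_closed[OF g z] g D_uminus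
      by (auto simp: \<alpha>_coset)
  qed
  moreover have "\<phi> g A \<preceq>\<^bsub>\<Lambda>\<^esub> \<phi> g B"
    if "g \<in> carrier G" "A \<in> carrier \<Lambda>" "B \<in> carrier \<Lambda>" "A \<preceq>\<^bsub>\<Lambda>\<^esub> B" for g A B
    using that a_P
    by (auto simp: carrier_\<Lambda> \<phi>_coset le_\<Lambda> a_closed \<tau>_closed D_add simp flip: a_diff)
  ultimately show ?thesis
    using \<alpha>_hom \<phi>_hom by (simp add: linear_affine_action_def affine_action_def)
qed

lemma essentially_free: "linear_essentially_free G \<Lambda> \<phi>"
  unfolding linear_essentially_free_def
proof (intro ballI impI)
  have dir: "(\<forall>A\<in>carrier \<Lambda>. A \<prec>\<^bsub>\<Lambda>\<^esub> \<phi> g A) \<or> (\<forall>A\<in>carrier \<Lambda>. \<phi> g A \<prec>\<^bsub>\<Lambda>\<^esub> A)"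
    if "g \<in> carrier G" "g \<noteq> \<one>" for g
    using moves[OF that] that(1)
    by (auto simp: carrier_\<Lambda> \<phi>_coset lt_def le_\<Lambda> a_closed \<tau>_closed D_add coset_eq_iff)
  fix g assume g: "g \<in> carrier G" "g \<noteq> \<one>"
  have cl: "\<phi> g A \<in> carrier \<Lambda>" if "g \<in> carrier G" "A \<in> carrier \<Lambda>" for g A
    using that by (auto simp: carrier_\<Lambda> \<phi>_coset a_closed \<tau>_closed D_add)
  have g': "inv g \<in> carrier G" "inv g \<noteq> \<one>" using g by auto
  have "linear_hyperbolic \<Lambda> \<phi> g"
    using dir[OF g] by (auto simp: linear_hyperbolic_def lt_def)
  moreover have "linear_rigid G \<Lambda> \<phi> g"
    unfolding linear_rigid_def
    by (intro ballI conjI L.interval_not_shrunk cl dir g g')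
  ultimately show "linear_hyperbolic \<Lambda> \<phi> g \<and> linear_rigid G \<Lambda> \<phi> g" ..
qed

theorem linear_action_exists:
  "\<exists>(\<Lambda> :: 'b set ogroup) \<alpha> \<phi>. ordered_abelian_group \<Lambda> \<and> linear_affine_action G \<Lambda> \<alpha> \<phi> \<and>
     linear_essentially_free G \<Lambda> \<phi>"
  using ordered_\<Lambda> linear_affine essentially_free by blast

end

section \<open>The augmentation ideal\<close>

text \<open>Functions are treated as vectors; they are evaluated at points only on demand.\<close>

lemmas pointwise = plus_fun_apply zero_fun_apply minus_apply uminus_apply
declare pointwise [simp del]

text \<open>Elements of the group ring are integer-valued functions on the type of group elements, which
makes the cosets that form \<open>\<Lambda>\<close> elements of \<^typ>\<open>'a universe\<close>. The elements \<open>g - 1\<close> span the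
augmentation ideal.\<close>

definition eps :: "('a, 'm) monoid_scheme \<Rightarrow> 'a \<Rightarrow> 'a \<Rightarrow> int" where
  "eps G g = (\<lambda>h. of_bool (h = g) - of_bool (h = \<one>\<^bsub>G\<^esub>))"

definition left_mult :: "('a, 'm) monoid_scheme \<Rightarrow> 'a \<Rightarrow> ('a \<Rightarrow> int) \<Rightarrow> 'a \<Rightarrow> int" where
  "left_mult G g x = (\<lambda>h. if h \<in> carrier G then x (inv\<^bsub>G\<^esub> g \<otimes>\<^bsub>G\<^esub> h) else 0)"

text \<open>The subset \<open>H\<close> will be a subgroup of \<open>G\<close>. Ideals of different subgroups thus lie in one
and the same group ring, where they can be compared.\<close>

inductive in_aug :: "('a, 'm) monoid_scheme \<Rightarrow> 'a set \<Rightarrow> ('a \<Rightarrow> int) \<Rightarrow> bool"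
  for G :: "('a, 'm) monoid_scheme" and H :: "'a set" where
  zero: "in_aug G H 0"
| add: "in_aug G H x \<Longrightarrow> h \<in> H \<Longrightarrow> in_aug G H (x + eps G h)"
| sub: "in_aug G H x \<Longrightarrow> h \<in> H \<Longrightarrow> in_aug G H (x - eps G h)"

definition aug :: "('a, 'm) monoid_scheme \<Rightarrow> 'a set \<Rightarrow> ('a \<Rightarrow> int) set" where
  "aug G H = Collect (in_aug G H)"

lemma aug_zero: "0 \<in> aug G H"
  by (simp add: aug_def in_aug.zero)

lemma aug_plus_eps: "x \<in> aug G H \<Longrightarrow> h \<in> H \<Longrightarrow> x + eps G h \<in> aug G H"
  by (simp add: aug_def in_aug.add)

lemma aug_minus_eps: "x \<in> aug G H \<Longrightarrow> h \<in> H \<Longrightarrow> x - eps G h \<in> aug G H"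
  by (simp add: aug_def in_aug.sub)

lemma aug_induct [consumes 1, case_names zero add sub, induct set: aug]:
  assumes "x \<in> aug G H" "Q 0"
    and "\<And>x h. x \<in> aug G H \<Longrightarrow> Q x \<Longrightarrow> h \<in> H \<Longrightarrow> Q (x + eps G h)"
    and "\<And>x h. x \<in> aug G H \<Longrightarrow> Q x \<Longrightarrow> h \<in> H \<Longrightarrow> Q (x - eps G h)"
  shows "Q x"
proof -
  have "in_aug G H x" using assms(1) by (simp add: aug_def)
  then show ?thesis
  proof induction
    case zero
    show ?case by (rule assms(2))
  next
    case (add x h)
    show ?case by (rule assms(3)) (use add in \<open>simp_all add: aug_def\<close>)
  next
    case (sub x h)
    show ?case by (rule assms(4)) (use sub in \<open>simp_all add: aug_def\<close>)
  qed
qed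

lemma aug_eps: "h \<in> H \<Longrightarrow> eps G h \<in> aug G H"
  using aug_plus_eps[OF aug_zero] by (simp only: add_0_left)

lemma aug_add: "y \<in> aug G H \<Longrightarrow> x \<in> aug G H \<Longrightarrow> x + y \<in> aug G H"
proof (induction rule: aug_induct)
  case zero
  then show ?case by (simp only: add_0_right)
next
  case (add y h)
  from aug_plus_eps[OF add.IH[OF add.prems] add.hyps(2)] show ?case by (simp only: add.assoc)
next
  case (sub y h)
  from aug_minus_eps[OF sub.IH[OF sub.prems] sub.hyps(2)] show ?case by (simp only: add_diff_eq)
qed

lemma aug_uminus: "x \<in> aug G H \<Longrightarrow> - x \<in> aug G H"
proof (induction rule: aug_induct)
  case zero
  then show ?case by (simp only: minus_zero aug_zero)
next
  case (add x h)
  have "- (x + eps G h) = - x - eps G h" by (simp add: fun_eq_iff pointwise)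
  then show ?case using aug_minus_eps[OF add.IH add.hyps(2)] by (simp only:)
next
  case (sub x h)
  have "- (x - eps G h) = - x + eps G h" by (simp add: fun_eq_iff pointwise)
  then show ?case using aug_plus_eps[OF sub.IH sub.hyps(2)] by (simp only:)
qed

lemma aug_diff: "x \<in> aug G H \<Longrightarrow> y \<in> aug G H \<Longrightarrow> x - y \<in> aug G H"
  using aug_add[OF aug_uminus, of y G H x] by (simp only: diff_conv_add_uminus)

lemma aug_finite_support: "x \<in> aug G H \<Longrightarrow> finite {h. x h \<noteq> 0}"
proof (induction rule: aug_induct)
  case (add x h)
  have "{k. (x + eps G h) k \<noteq> 0} \<subseteq> {k. x k \<noteq> 0} \<union> {h, \<one>\<^bsub>G\<^esub>}" by (auto simp: eps_def pointwise)
  then show ?case using add by (metis finite.emptyI finite_Un finite_insert finite_subset)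
next
  case (sub x h)
  have "{k. (x - eps G h) k \<noteq> 0} \<subseteq> {k. x k \<noteq> 0} \<union> {h, \<one>\<^bsub>G\<^esub>}" by (auto simp: eps_def pointwise)
  then show ?case using sub by (metis finite.emptyI finite_Un finite_insert finite_subset)
qed (simp add: pointwise)

lemma aug_support: "x \<in> aug G H \<Longrightarrow> \<one>\<^bsub>G\<^esub> \<in> H \<Longrightarrow> h \<notin> H \<Longrightarrow> x h = 0"
  by (induction rule: aug_induct) (auto simp: eps_def pointwise)

lemma left_mult_add: "left_mult G g (x + y) = left_mult G g x + left_mult G g y"
  by (auto simp: left_mult_def fun_eq_iff pointwise)

lemma left_mult_diff: "left_mult G g (x - y) = left_mult G g x - left_mult G g y"
  by (auto simp: left_mult_def fun_eq_iff pointwise)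

lemma left_mult_zero: "left_mult G g 0 = 0"
  by (auto simp: left_mult_def fun_eq_iff pointwise)

context group
begin

lemma left_mult_eps:
  assumes "g \<in> carrier G" "h \<in> carrier G"
  shows "left_mult G g (eps G h) = eps G (g \<otimes> h) - eps G g"
proof
  fix k
  show "left_mult G g (eps G h) k = (eps G (g \<otimes> h) - eps G g) k"
  proof (cases "k \<in> carrier G")
    case True
    then have *: "inv g \<otimes> k = z \<longleftrightarrow> k = g \<otimes> z" if "z \<in> carrier G" for z
      using assms that by auto
    have "inv g \<otimes> k = h \<longleftrightarrow> k = g \<otimes> h" "inv g \<otimes> k = \<one> \<longleftrightarrow> k = g"
      using *[of h] *[of \<one>] assms by simp_all
    then show ?thesis using True by (simp add: left_mult_def eps_def pointwise)
  next
    case False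
    then have "k \<noteq> g \<otimes> h" "k \<noteq> g" using assms by auto
    then show ?thesis using False by (simp add: left_mult_def eps_def pointwise)
  qed
qed

lemma left_mult_closed:
  assumes H: "subgroup H G" and g: "g \<in> H"
  shows "x \<in> aug G H \<Longrightarrow> left_mult G g x \<in> aug G H"
proof (induction rule: aug_induct)
  case zero
  then show ?case by (simp add: left_mult_zero aug_zero)
next
  case (add x h)
  then show ?case
    using g subgroup.mem_carrier[OF H] subgroup.m_closed[OF H]
    by (simp add: left_mult_add left_mult_eps aug_add aug_diff aug_eps)
next
  case (sub x h)
  then show ?case
    using g subgroup.mem_carrier[OF H] subgroup.m_closed[OF H]
    by (simp add: left_mult_diff left_mult_eps aug_diff aug_eps)
qed

lemma left_mult_one: "x \<in> aug G (carrier G) \<Longrightarrow> left_mult G \<one> x = x"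
  using aug_support[of x G "carrier G"] by (auto simp: left_mult_def fun_eq_iff pointwise)

lemma left_mult_mult:
  "g \<in> carrier G \<Longrightarrow> h \<in> carrier G \<Longrightarrow>
     left_mult G (g \<otimes> h) x = left_mult G g (left_mult G h x)"
  by (auto simp: left_mult_def fun_eq_iff inv_mult_group m_assoc)

end

section \<open>Evaluating functions on the augmentation ideal\<close>

definition pairing :: "('a \<Rightarrow> rat) \<Rightarrow> ('a \<Rightarrow> int) \<Rightarrow> rat" where
  "pairing f x = (\<Sum>h | x h \<noteq> 0. of_int (x h) * f h)"

lemma pairing_superset:
  assumes "finite S" "{h. x h \<noteq> 0} \<subseteq> S"
  shows "pairing f x = (\<Sum>h\<in>S. of_int (x h) * f h)"
  unfolding pairing_def by (rule sum.mono_neutral_left) (use assms in auto)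

lemma pairing_add:
  assumes "x \<in> aug G H" "y \<in> aug G H"
  shows "pairing f (x + y) = pairing f x + pairing f y"
proof -
  let ?S = "{h. x h \<noteq> 0} \<union> {h. y h \<noteq> 0}"
  have S: "finite ?S" using assms aug_finite_support by auto
  have "{h. (x + y) h \<noteq> 0} \<subseteq> ?S" by (auto simp: pointwise)
  then show ?thesis
    using pairing_superset[OF S, of x f] pairing_superset[OF S, of y f]
      pairing_superset[OF S, of "x + y" f]
    by (auto simp: sum.distrib algebra_simps pointwise)
qed

lemma pairing_uminus: "pairing f (- x) = - pairing f x"
  by (simp add: pairing_def sum_negf pointwise)

lemma pairing_diff:
  assumes "x \<in> aug G H" "y \<in> aug G H"
  shows "pairing f (x - y) = pairing f x - pairing f y"
  using pairing_add[OF assms(1) aug_uminus[OF assms(2)], of f] by (simp add: pairing_uminus)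

lemma pairing_zero: "pairing f 0 = 0"
  by (simp add: pairing_def pointwise)

lemma pairing_eps: "pairing f (eps G g) = f g - f \<one>\<^bsub>G\<^esub>"
proof (cases "g = \<one>\<^bsub>G\<^esub>")
  case False
  have "pairing f (eps G g) = (\<Sum>h\<in>{g, \<one>\<^bsub>G\<^esub>}. of_int (eps G g h) * f h)"
    by (rule pairing_superset) (auto simp: eps_def pointwise)
  also have "\<dots> = f g - f \<one>\<^bsub>G\<^esub>" using False by (auto simp: eps_def pointwise)
  finally show ?thesis .
qed (simp add: eps_def pairing_def)

lemma aug_pairing_eqI:
  assumes x: "x \<in> aug G H" and eps: "\<And>h. h \<in> H \<Longrightarrow> f h - f \<one>\<^bsub>G\<^esub> = 0"
  shows "pairing f x = 0"
  using x
  by induction (simp_all add: pairing_zero pairing_add pairing_diff aug_eps pairing_eps eps)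

lemma pairing_fun_diff: "pairing (\<lambda>h. f h - f' h) x = pairing f x - pairing f' x"
  by (simp add: pairing_def right_diff_distrib sum_subtractf)

lemma (in group) pairing_left_mult:
  assumes H: "subgroup H G" and g: "g \<in> H"
  shows "x \<in> aug G H \<Longrightarrow> pairing f (left_mult G g x) = pairing (\<lambda>h. f (g \<otimes> h)) x"
proof (induction rule: aug_induct)
  case zero
  then show ?case by (simp add: left_mult_zero pairing_zero)
next
  case (add x h)
  note c = subgroup.mem_carrier[OF H]
  have "g \<otimes> h \<in> H" using g add.hyps subgroup.m_closed[OF H] by blast
  then show ?case
    using add g c left_mult_closed[OF H g add.hyps(1)]
      pairing_add[OF left_mult_closed[OF H g add.hyps(1)] aug_diff[OF aug_eps aug_eps], of "g \<otimes> h" g f]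
    by (simp add: left_mult_add left_mult_eps pairing_add aug_eps pairing_diff[OF aug_eps aug_eps]
        pairing_eps)
next
  case (sub x h)
  note c = subgroup.mem_carrier[OF H]
  have "g \<otimes> h \<in> H" using g sub.hyps subgroup.m_closed[OF H] by blast
  then show ?case
    using sub g c left_mult_closed[OF H g sub.hyps(1)]
      pairing_diff[OF left_mult_closed[OF H g sub.hyps(1)] aug_diff[OF aug_eps aug_eps], of "g \<otimes> h" g f]
    by (simp add: left_mult_diff left_mult_eps pairing_diff aug_eps pairing_diff[OF aug_eps aug_eps]
        pairing_eps)
qed

section \<open>Invariant cones\<close>

definition displacement :: "('a, 'm) monoid_scheme \<Rightarrow> 'a \<Rightarrow> ('a \<Rightarrow> int) \<Rightarrow> 'a \<Rightarrow> int" where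
  "displacement G g y = left_mult G g y + eps G g - y"

text \<open>The last condition says that \<open>g\<close> moves all points strictly in the same direction.\<close>

definition cone :: "('a, 'm) monoid_scheme \<Rightarrow> 'a set \<Rightarrow> ('a \<Rightarrow> int) set \<Rightarrow> bool" where
  "cone G H P \<longleftrightarrow> P \<subseteq> aug G H \<and> (\<forall>x\<in>P. \<forall>y\<in>P. x + y \<in> P) \<and>
     (\<forall>x\<in>aug G H. x \<in> P \<or> - x \<in> P) \<and> (\<forall>g\<in>H. \<forall>x\<in>P. left_mult G g x \<in> P) \<and>
     (\<forall>g\<in>H. g \<noteq> \<one>\<^bsub>G\<^esub> \<longrightarrow>
        (\<forall>y\<in>aug G H. displacement G g y \<in> P \<and> - displacement G g y \<notin> P) \<or>
        (\<forall>y\<in>aug G H. - displacement G g y \<in> P \<and> displacement G g y \<notin> P))"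

lemma (in group) displacement_closed:
  assumes "subgroup H G" "g \<in> H" "y \<in> aug G H"
  shows "displacement G g y \<in> aug G H"
  unfolding displacement_def using left_mult_closed[OF assms] assms by (simp add: aug_add aug_diff aug_eps)

lemma cone_action_of_cone:
  assumes G: "group G" and P: "cone G (carrier G) P"
  shows "cone_action G (aug G (carrier G)) P (left_mult G) (eps G)"
proof -
  interpret group G by (rule G)
  note P = P[unfolded cone_def]
  have sg: "subgroup (carrier G) G" by (rule subgroup_self)
  show ?thesis
  proof (intro cone_action.intro G cone_action_axioms.intro)
    fix g assume "g \<in> carrier G" "g \<noteq> \<one>\<^bsub>G\<^esub>"
    moreover have "y - (left_mult G g y + eps G g) = - displacement G g y" for y
      by (simp add: displacement_def)
    ultimately show "(\<forall>x\<in>aug G (carrier G). left_mult G g x + eps G g - x \<in> P \<and>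
        x - (left_mult G g x + eps G g) \<notin> P) \<or>
      (\<forall>x\<in>aug G (carrier G). x - (left_mult G g x + eps G g) \<in> P \<and>
        left_mult G g x + eps G g - x \<notin> P)"
      using P unfolding displacement_def by simp
  qed (use P in \<open>auto simp: left_mult_add left_mult_one left_mult_mult left_mult_eps aug_zero
         aug_uminus aug_eps left_mult_closed[OF sg] intro: aug_add\<close>)
qed

text \<open>A polynomial function \<open>f\<close> leads \<open>x\<close> if it is the first one with \<open>pairing f x \<noteq> 0\<close>, where functions
of lower degree come first; \<open>x\<close> is non-negative if its leading value is positive or does not exist.
By \<open>pairing_left_mult\<close>, passing from \<open>x\<close> to \<open>g x\<close> adds to \<open>pairing f x\<close> the value of a left difference
of \<open>f\<close> on \<open>x\<close>, which is zero for the leading function and all before it. So \<open>g x\<close> has the same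
leading function and value as \<open>x\<close>. In the same way all displacements by \<open>g\<close> have the leading
function and value of \<open>g - 1\<close>, since the value of a left difference along \<open>g\<close> on \<open>h - 1\<close> is the
value of a right difference along \<open>h\<close> on \<open>g - 1\<close>.\<close>

theorem (in group) cone_of_poly_separated:
  assumes H: "subgroup H G" and sep: "poly_separated (G\<lparr>carrier := H\<rparr>)"
  shows "\<exists>P. cone G H P"
proof -
  let ?K = "G\<lparr>carrier := H\<rparr>"
  interpret F: filtered_group ?K "trivial_filtration ?K"
    by (rule filtered_group_trivial[OF subgroup.subgroup_is_group[OF H is_group]])
  have H1: "\<one> \<in> H" by (rule subgroup.one_closed[OF H])
  define isP where "isP f \<longleftrightarrow> (\<exists>n. poly_fun ?K n f)" for f
  define deg where "deg f = (LEAST n. poly_fun ?K n f)" for f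
  have deg: "poly_fun ?K (deg f) f" if "isP f" for f
    using LeastI_ex[OF that[unfolded isP_def]] unfolding deg_def .
  have deg_le: "isP f \<and> deg f \<le> n" if "poly_fun ?K n f" for n f
    using that Least_le[of "\<lambda>n. poly_fun ?K n f" n] unfolding isP_def deg_def by blast
  obtain r :: "('a \<Rightarrow> rat) rel" where "well_order_on UNIV r" using well_order_on by blast
  then have wf_r: "wf (r - Id)" and tot_r: "\<And>x y. x \<noteq> y \<Longrightarrow> (x, y) \<in> r \<or> (y, x) \<in> r"
    and anti_r: "antisym r"
    by (auto simp: well_order_on_def linear_order_on_def partial_order_on_def total_on_def)
  define B where "B = inv_image (less_than <*lex*> (r - Id)) (\<lambda>f. (deg f, f))"
  have wf_B: "wf B" unfolding B_def by (intro wf_inv_image wf_lex_prod wf_less_than wf_r)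
  have B: "(f', f) \<in> B \<longleftrightarrow> deg f' < deg f \<or> deg f' = deg f \<and> (f', f) \<in> r - Id" for f f'
    by (simp add: B_def)
  have B_total: "(f', f) \<in> B \<or> (f, f') \<in> B" if "f \<noteq> f'" for f f'
    using tot_r[OF that] that by (auto simp: B)
  define lead where "lead x f \<longleftrightarrow> isP f \<and> pairing f x \<noteq> 0 \<and>
    (\<forall>f'. isP f' \<and> (f', f) \<in> B \<longrightarrow> pairing f' x = 0)" for x f
  have lead_unique: "f = f'" if "lead x f" "lead x f'" for x f f'
    using that B_total[of f f'] unfolding lead_def by blast
  have lead_exists: "\<exists>f. lead x f" if "isP f" "pairing f x \<noteq> 0" for x f
  proof -
    have "\<exists>f. isP f \<and> pairing f x \<noteq> 0" using that by blast
    then obtain m where "m \<in> {f. isP f \<and> pairing f x \<noteq> 0}"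
      "\<And>f'. (f', m) \<in> B \<Longrightarrow> f' \<notin> {f. isP f \<and> pairing f x \<noteq> 0}"
      using wfE_min[OF wf_B, of _ "{f. isP f \<and> pairing f x \<noteq> 0}"] by blast
    then show ?thesis unfolding lead_def by blast
  qed
  have lead_transfer: "lead y f"
    if "lead x f" "pairing f y \<noteq> 0" "\<And>f'. isP f' \<Longrightarrow> (f', f) \<in> B \<Longrightarrow> pairing f' y = pairing f' x"
    for x y f
    using that unfolding lead_def by auto
  have lead_uminus: "lead (- x) f" if "lead x f" for x f
    using that by (auto simp: lead_def pairing_uminus)
  define P where "P = {x \<in> aug G H. \<forall>f. lead x f \<longrightarrow> pairing f x > 0}"
  have P_iff: "x \<in> P \<longleftrightarrow> pairing f x > 0" if "lead x f" "x \<in> aug G H" for x f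
    using that lead_unique unfolding P_def by blast
  have add: "x + y \<in> P" if xy: "x \<in> P" "y \<in> P" for x y
  proof -
    have xyA: "x \<in> aug G H" "y \<in> aug G H" using xy by (auto simp: P_def)
    have "pairing f (x + y) > 0" if f: "lead (x + y) f" for f
    proof -
      \<comment> \<open>The first function with a non-zero value on \<open>x\<close> or on \<open>y\<close> is positive on one of them and
        non-negative on the other, so its values do not cancel and it leads \<open>x + y\<close>.\<close>
      let ?S = "{f. isP f \<and> (pairing f x \<noteq> 0 \<or> pairing f y \<noteq> 0)}"
      have fS: "f \<in> ?S" using f pairing_add[OF xyA, of f] by (auto simp: lead_def)
      obtain m where m: "m \<in> ?S" "\<And>f'. (f', m) \<in> B \<Longrightarrow> f' \<notin> ?S"
        by (rule wfE_min[OF wf_B fS]) (erule that)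
      have "pairing m x \<ge> 0" if "x \<in> P" "\<And>f'. isP f' \<Longrightarrow> (f', m) \<in> B \<Longrightarrow> pairing f' x = 0" for x
      proof (cases "pairing m x = 0")
        case False
        then have "lead x m" using that m unfolding lead_def by blast
        then show ?thesis using that(1) unfolding P_def by force
      qed simp
      then have "pairing m x \<ge> 0" "pairing m y \<ge> 0" using xy m(2) by blast+
      then have pos: "pairing m (x + y) > 0" using m(1) pairing_add[OF xyA, of m] by auto
      then have "lead (x + y) m"
        using m unfolding lead_def by (auto simp: pairing_add[OF xyA])
      then show ?thesis using lead_unique[OF f] pos by blast
    qed
    then show ?thesis using aug_add[OF xyA(2,1)] by (simp add: P_def)
  qed
  have total: "x \<in> P \<or> - x \<in> P" if x: "x \<in> aug G H" for x
  proof (rule disjCI)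
    assume "- x \<notin> P"
    then obtain f where f: "lead (- x) f" "\<not> pairing f (- x) > 0"
      using aug_uminus[OF x] unfolding P_def by blast
    then have "pairing f x > 0" by (auto simp: lead_def pairing_uminus)
    then show "x \<in> P" using P_iff[of x f] lead_uminus[OF f(1)] x by simp
  qed
  have ldiff_zero: "pairing (\<lambda>h. f (g \<otimes> h) - f h) x = 0"
    if f: "isP f" and g: "g \<in> H" and x: "x \<in> aug G H"
      and low: "\<And>f'. isP f' \<Longrightarrow> deg f' < deg f \<Longrightarrow> pairing f' x = 0" for f g x
  proof (cases "deg f")
    case 0
    then have "\<And>h. h \<in> H \<Longrightarrow> f h = 0" using deg[OF f] by simp
    then show ?thesis using g H1 subgroup.m_closed[OF H]
      by (intro aug_pairing_eqI[OF x]) auto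
  next
    case (Suc n)
    have "poly_fun ?K n (\<lambda>h. f (g \<otimes> h) - f h)"
      using F.poly_below_ldiff[of n f g] deg[OF f] Suc g by simp
    from deg_le[OF this] show ?thesis using low Suc by (metis less_Suc_eq_le)
  qed
  have rdiff_zero: "pairing (\<lambda>x. f (x \<otimes> h) - f x) y = 0"
    if f: "isP f" and h: "h \<in> H" and y: "y \<in> aug G H"
      and low: "\<And>f'. isP f' \<Longrightarrow> deg f' < deg f \<Longrightarrow> pairing f' y = 0" for f h y
  proof (cases "deg f")
    case 0
    then have "\<And>h. h \<in> H \<Longrightarrow> f h = 0" using deg[OF f] by simp
    then show ?thesis using h H1 subgroup.m_closed[OF H]
      by (intro aug_pairing_eqI[OF y]) auto
  next
    case (Suc n)
    have "poly_fun ?K n (\<lambda>x. f (x \<otimes> h) - f x)"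
      using F.poly_below_rdiff[of n f h] deg[OF f] Suc h by simp
    from deg_le[OF this] show ?thesis using low Suc by (metis less_Suc_eq_le)
  qed
  have inv: "left_mult G g x \<in> P" if g: "g \<in> H" and x: "x \<in> P" for g x
  proof -
    have xA: "x \<in> aug G H" using x by (simp add: P_def)
    have pl: "pairing f (left_mult G g x) = pairing f x + pairing (\<lambda>h. f (g \<otimes> h) - f h) x" for f
      using pairing_left_mult[OF H g xA] by (simp add: pairing_fun_diff)
    show ?thesis
    proof (cases "\<exists>f. isP f \<and> pairing f x \<noteq> 0")
      case True
      then obtain f where f: "lead x f" using lead_exists by blast
      have eq: "pairing f' (left_mult G g x) = pairing f' x" if "isP f'" "f' = f \<or> (f', f) \<in> B" for f'
      proof -
        have "pairing (\<lambda>h. f' (g \<otimes> h) - f' h) x = 0"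
          using that f by (intro ldiff_zero g xA) (auto simp: lead_def B)
        then show ?thesis using pl by simp
      qed
      have fP: "isP f" "pairing f x \<noteq> 0" using f by (auto simp: lead_def)
      have "lead (left_mult G g x) f" using lead_transfer[OF f] eq fP by auto
      then show ?thesis
        using P_iff[OF f xA] P_iff[of "left_mult G g x" f] x eq[OF fP(1)] left_mult_closed[OF H g xA]
        by simp
    next
      case False
      have "pairing f (left_mult G g x) = 0" if "isP f" for f
        using pl[of f] ldiff_zero[OF that g xA] False that by auto
      then show ?thesis using left_mult_closed[OF H g xA] by (auto simp: P_def lead_def)
    qed
  qed
  have moves: "(\<forall>y\<in>aug G H. displacement G g y \<in> P \<and> - displacement G g y \<notin> P) \<or>
      (\<forall>y\<in>aug G H. - displacement G g y \<in> P \<and> displacement G g y \<notin> P)"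
    if g: "g \<in> H" "g \<noteq> \<one>" for g
  proof -
    have "\<exists>n f. poly_fun ?K n f \<and> f g \<noteq> f \<one>"
      using sep g unfolding poly_separated_def by simp
    then obtain f0 where "isP f0" "f0 g \<noteq> f0 \<one>" unfolding isP_def by blast
    then obtain f where f: "lead (eps G g) f"
      using lead_exists[of f0 "eps G g"] by (auto simp: pairing_eps)
    then have fP: "isP f" and f0: "pairing f (eps G g) \<noteq> 0" by (auto simp: lead_def)
    have eq: "pairing f' (displacement G g y) = pairing f' (eps G g)"
      if f': "isP f'" "f' = f \<or> (f', f) \<in> B" and y: "y \<in> aug G H" for f' y
    proof -
      have "pairing (\<lambda>h. f' (g \<otimes> h) - f' h) y = 0"
      proof (rule aug_pairing_eqI[OF y])
        fix h assume h: "h \<in> H"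
        have "pairing (\<lambda>x. f' (x \<otimes> h) - f' x) (eps G g) = 0"
          using f' f by (intro rdiff_zero h aug_eps g) (auto simp: lead_def B)
        then show "f' (g \<otimes> h) - f' h - (f' (g \<otimes> \<one>) - f' \<one>) = 0"
          using subgroup.mem_carrier[OF H] g h by (simp add: pairing_eps)
      qed
      then have "pairing f' (left_mult G g y) = pairing f' y"
        using pairing_left_mult[OF H g(1) y] by (simp add: pairing_fun_diff)
      moreover have "pairing f' (displacement G g y) =
          pairing f' (left_mult G g y) + pairing f' (eps G g) - pairing f' y"
      proof -
        note gx = left_mult_closed[OF H g(1) y] and ge = aug_eps[OF g(1), of G]
        show ?thesis
          unfolding displacement_def pairing_diff[OF aug_add[OF ge gx] y] pairing_add[OF gx ge] ..
      qed
      ultimately show ?thesis by simp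
    qed
    have "displacement G g y \<in> P \<longleftrightarrow> pairing f (eps G g) > 0"
      "- displacement G g y \<in> P \<longleftrightarrow> pairing f (eps G g) < 0" if y: "y \<in> aug G H" for y
    proof -
      have l: "lead (displacement G g y) f"
        using lead_transfer[OF f] eq fP f0 y by auto
      note d = displacement_closed[OF H g(1) y]
      show "displacement G g y \<in> P \<longleftrightarrow> pairing f (eps G g) > 0"
        using P_iff[OF l d] eq[OF fP _ y] by simp
      show "- displacement G g y \<in> P \<longleftrightarrow> pairing f (eps G g) < 0"
        using P_iff[OF lead_uminus[OF l] aug_uminus[OF d]] eq[OF fP _ y] by (simp add: pairing_uminus)
    qed
    then show ?thesis using f0 by force
  qed
  have "cone G H P"
    unfolding cone_def using add total inv moves by (auto simp: P_def)
  then show ?thesis ..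
qed

section \<open>Limits of cones along an ultrafilter\<close>

lemma ultrafilter_below:
  fixes F :: "'i filter"
  assumes F: "F \<noteq> bot"
  obtains U where "U \<le> F" "U \<noteq> bot" "\<And>P. eventually P U \<or> eventually (\<lambda>x. \<not> P x) U"
proof -
  let ?A = "{U. U \<noteq> bot \<and> U \<le> F}"
  let ?le = "\<lambda>U V. V \<le> U"
  have "\<exists>U\<in>?A. \<forall>V\<in>?A. ?le U V \<longrightarrow> V = U"
  proof (rule predicate_Zorn)
    show "partial_order_on ?A (relation_of ?le ?A)"
      by (auto simp: partial_order_on_def preorder_on_def refl_on_def trans_def antisym_def
          relation_of_def)
    fix C assume C: "C \<in> Chains (relation_of ?le ?A)"
    then have CA: "V \<noteq> bot \<and> V \<le> F" if "V \<in> C" for V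
      using that by (auto simp: Chains_def relation_of_def)
    show "\<exists>U\<in>?A. \<forall>V\<in>C. ?le V U"
    proof (cases "C = {}")
      case True
      then show ?thesis using F by auto
    next
      case False
      have "Inf C \<noteq> bot"
      proof
        assume "Inf C = bot"
        then have "eventually (\<lambda>_. False) (Inf C)" by simp
        moreover have "\<exists>W\<in>C. W \<le> inf V V'" if "V \<in> C" "V' \<in> C" for V V'
          using C that by (force simp: Chains_def relation_of_def)
        ultimately obtain V where "V \<in> C" "eventually (\<lambda>_. False) V"
          using eventually_Inf_base[OF False] by blast
        then show False using CA[of V] by (simp add: trivial_limit_def)
      qed
      moreover have "Inf C \<le> F" using False CA by (meson Inf_lower2 ex_in_conv)
      ultimately show ?thesis by (auto intro: Inf_lower)
    qed
  qed
  then obtain U where U: "U \<noteq> bot" "U \<le> F" "\<And>V. V \<noteq> bot \<Longrightarrow> V \<le> F \<Longrightarrow> V \<le> U \<Longrightarrow> V = U" by blast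
  have "eventually P U" if "\<not> eventually (\<lambda>x. \<not> P x) U" for P
  proof -
    let ?V = "inf U (principal {x. P x})"
    have "?V \<noteq> bot" using that by (simp add: trivial_limit_def eventually_inf_principal)
    then have "?V = U" using U(2) by (intro U(3)) (auto intro: le_infI1)
    moreover have "eventually P ?V" by (simp add: eventually_inf_principal)
    ultimately show ?thesis by simp
  qed
  then show thesis using that U by blast
qed

text \<open>An element of the limit cone is one that lies in the cones of almost all finitely generated
subgroups, with respect to an ultrafilter that contains all sets of the form
\<open>{S. S \<supseteq> S\<^sub>0}\<close>. Every condition on a cone involves finitely many elements, or, in the case of the
direction in which \<open>g\<close> moves the points, a choice between two alternatives, one of which holds almost
everywhere.\<close>

theorem (in group) cone_of_local_cones:
  assumes loc: "\<And>S. finite S \<Longrightarrow> S \<subseteq> carrier G \<Longrightarrow> \<exists>P. cone G (generate G S) P"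
  shows "\<exists>P. cone G (carrier G) P"
proof -
  define Q where "Q S = (SOME P. cone G (generate G S) P)" for S
  have Q: "cone G (generate G S) (Q S)" if "finite S" "S \<subseteq> carrier G" for S
    using someI_ex[OF loc[OF that]] unfolding Q_def .
  obtain U where U: "U \<le> finite_subsets_at_top (carrier G)" "U \<noteq> bot"
    and ultra: "\<And>P. eventually P U \<or> eventually (\<lambda>x. \<not> P x) U"
    using ultrafilter_below[of "finite_subsets_at_top (carrier G)"] by auto
  have evI: "eventually R U" if "\<And>S. finite S \<Longrightarrow> S \<subseteq> carrier G \<Longrightarrow> T \<subseteq> S \<Longrightarrow> R S"
    "finite T" "T \<subseteq> carrier G" for R T
  proof -
    have "eventually R (finite_subsets_at_top (carrier G))"
      unfolding eventually_finite_subsets_at_top using that by auto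
    then show ?thesis using U(1) by (rule filter_leD[rotated])
  qed
  have ev_not: "\<not> eventually R U" if "eventually (\<lambda>S. \<not> R S) U" for R
    using that U(2) eventually_conj[of R U "\<lambda>S. \<not> R S"] by (auto simp: trivial_limit_def)
  have ev_gen: "\<forall>\<^sub>F S in U. g \<in> generate G S" if "g \<in> carrier G" for g
    by (rule evI[of "{g}"]) (use that in \<open>auto intro: generate.incl\<close>)
  have ev_cone: "\<forall>\<^sub>F S in U. cone G (generate G S) (Q S)"
    by (rule evI[of "{}"]) (use Q in auto)
  have ev_aug: "\<forall>\<^sub>F S in U. x \<in> aug G (generate G S)" if "x \<in> aug G (carrier G)" for x
    using that
  proof induction
    case zero
    then show ?case by (simp add: aug_zero)
  next
    case (add x h)
    show ?case using add.IH ev_gen[OF add.hyps(2)] by eventually_elim (rule aug_plus_eps)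
  next
    case (sub x h)
    show ?case using sub.IH ev_gen[OF sub.hyps(2)] by eventually_elim (rule aug_minus_eps)
  qed
  define P where "P = {x \<in> aug G (carrier G). \<forall>\<^sub>F S in U. x \<in> Q S}"
  have add: "x + y \<in> P" if "x \<in> P" "y \<in> P" for x y
  proof -
    have "\<forall>\<^sub>F S in U. x \<in> Q S" "\<forall>\<^sub>F S in U. y \<in> Q S" using that by (auto simp: P_def)
    then have "\<forall>\<^sub>F S in U. x + y \<in> Q S" using ev_cone
      by eventually_elim (auto simp: cone_def)
    then show ?thesis using that aug_add by (auto simp: P_def)
  qed
  have total: "x \<in> P \<or> - x \<in> P" if x: "x \<in> aug G (carrier G)" for x
  proof (cases "\<forall>\<^sub>F S in U. x \<in> Q S")
    case False
    then have "\<forall>\<^sub>F S in U. x \<notin> Q S" using ultra by blast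
    then have "\<forall>\<^sub>F S in U. - x \<in> Q S" using ev_aug[OF x] ev_cone
      by eventually_elim (auto simp: cone_def)
    then show ?thesis using aug_uminus[OF x] by (simp add: P_def)
  qed (use x in \<open>simp add: P_def\<close>)
  have inv: "left_mult G g x \<in> P" if "g \<in> carrier G" "x \<in> P" for g x
  proof -
    have "\<forall>\<^sub>F S in U. x \<in> Q S" using that by (auto simp: P_def)
    then have "\<forall>\<^sub>F S in U. left_mult G g x \<in> Q S" using ev_cone ev_gen[OF that(1)]
      by eventually_elim (auto simp: cone_def)
    then show ?thesis using that left_mult_closed[OF subgroup_self] by (auto simp: P_def)
  qed
  have moves: "(\<forall>y\<in>aug G (carrier G). displacement G g y \<in> P \<and> - displacement G g y \<notin> P) \<or>
      (\<forall>y\<in>aug G (carrier G). - displacement G g y \<in> P \<and> displacement G g y \<notin> P)"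
    if g: "g \<in> carrier G" "g \<noteq> \<one>" for g
  proof -
    let ?up = "\<lambda>S. \<forall>y\<in>aug G (generate G S). displacement G g y \<in> Q S \<and> - displacement G g y \<notin> Q S"
    let ?dn = "\<lambda>S. \<forall>y\<in>aug G (generate G S). - displacement G g y \<in> Q S \<and> displacement G g y \<notin> Q S"
    have cl: "displacement G g y \<in> aug G (carrier G)" "- displacement G g y \<in> aug G (carrier G)"
      if "y \<in> aug G (carrier G)" for y
      using displacement_closed[OF subgroup_self g(1) that] aug_uminus by auto
    have ud: "\<forall>\<^sub>F S in U. ?up S \<or> ?dn S" using ev_gen[OF g(1)] ev_cone
      by eventually_elim (use g(2) in \<open>simp add: cone_def\<close>)
    have "eventually ?dn U" if "eventually (\<lambda>S. \<not> ?up S) U"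
      using that ud by eventually_elim blast
    then have "eventually ?up U \<or> eventually ?dn U" using ultra[of ?up] by blast
    then show ?thesis
    proof
      assume up: "eventually ?up U"
      have "displacement G g y \<in> P \<and> - displacement G g y \<notin> P" if y: "y \<in> aug G (carrier G)" for y
      proof -
        have "\<forall>\<^sub>F S in U. displacement G g y \<in> Q S" "\<forall>\<^sub>F S in U. - displacement G g y \<notin> Q S"
          using eventually_conj[OF up ev_aug[OF y]] by (auto elim!: eventually_mono)
        then show ?thesis using ev_not cl[OF y] by (auto simp: P_def)
      qed
      then show ?thesis by blast
    next
      assume dn: "eventually ?dn U"
      have "- displacement G g y \<in> P \<and> displacement G g y \<notin> P" if y: "y \<in> aug G (carrier G)" for y
      proof -
        have "\<forall>\<^sub>F S in U. - displacement G g y \<in> Q S" "\<forall>\<^sub>F S in U. displacement G g y \<notin> Q S"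
          using eventually_conj[OF dn ev_aug[OF y]] by (auto elim!: eventually_mono)
        then show ?thesis using ev_not cl[OF y] by (auto simp: P_def)
      qed
      then show ?thesis by blast
    qed
  qed
  have "cone G (carrier G) P"
    unfolding cone_def using add total inv moves by (auto simp: P_def)
  then show ?thesis ..
qed

section \<open>Actions\<close>

lemma linear_action_of_cone:
  fixes G :: "('a, 'm) monoid_scheme"
  assumes "group G" "cone G (carrier G) P"
  shows "\<exists>(\<Lambda> :: 'a universe ogroup) \<alpha> \<phi>. ordered_abelian_group \<Lambda> \<and>
    linear_affine_action G \<Lambda> \<alpha> \<phi> \<and> linear_essentially_free G \<Lambda> \<phi>"
  using cone_action.linear_action_exists[OF cone_action_of_cone[OF assms]] .

lemma poly_separated_ATFe:
  fixes G :: "('a, 'm) monoid_scheme"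
  assumes sep: "poly_separated G"
  shows "ATFe G"
proof -
  interpret group G using sep by (simp add: poly_separated_def)
  obtain P where "cone G (carrier G) P" using cone_of_poly_separated[OF subgroup_self] sep by auto
  then obtain \<Lambda> :: "'a universe ogroup" and \<alpha> \<phi> where L: "ordered_abelian_group \<Lambda>"
    "linear_affine_action G \<Lambda> \<alpha> \<phi>" "linear_essentially_free G \<Lambda> \<phi>"
    using linear_action_of_cone[OF is_group] by blast
  have "Lambda_tree \<Lambda> (carrier \<Lambda>) (ogroup_dist \<Lambda>)"
    by (rule ordered_abelian_group.Lambda_tree_self[OF L(1)])
  moreover have "affine_action G \<Lambda> (carrier \<Lambda>) (ogroup_dist \<Lambda>) \<alpha> \<phi>"
    using L(2) by (simp add: linear_affine_action_def)
  moreover have "tree_essentially_free G \<Lambda> (carrier \<Lambda>) (ogroup_dist \<Lambda>) \<alpha> \<phi>"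
    using tree_essentially_free_linear_iff[OF L(1,2)] L(3) by simp
  ultimately show ?thesis using L(1) unfolding ATFe_def by blast
qed

theorem corollary0p2:
  fixes G :: "('a, 'm) monoid_scheme"
  shows
    "(locally_residually_torsion_free_nilpotent G \<longrightarrow>
        (\<exists>(\<Lambda> :: 'a universe ogroup) \<alpha> \<phi>.
           ordered_abelian_group \<Lambda> \<and> linear_affine_action G \<Lambda> \<alpha> \<phi> \<and>
           linear_essentially_free G \<Lambda> \<phi>)) \<and>
     (\<forall>(V :: 'v set) E. right_angled_artin_group V E G \<longrightarrow> ATFe G) \<and>
     (residually_free G \<longrightarrow> ATFe G) \<and>
     (\<forall>(I :: 'i set) (H :: 'i \<Rightarrow> ('h, 'k) monoid_scheme).
        (\<forall>i\<in>I. residually_free (H i)) \<and> free_product I H G \<longrightarrow> ATFe G)"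
proof (intro conjI allI impI)
  assume loc: "locally_residually_torsion_free_nilpotent G"
  then interpret group G by (simp add: locally_residually_torsion_free_nilpotent_def)
  have "\<exists>P. cone G (generate G S) P" if "finite S" "S \<subseteq> carrier G" for S
    using cone_of_poly_separated[OF generate_is_subgroup[OF that(2)]
        finitely_generated_subgroup_poly_separated[OF loc that]] .
  then obtain P where "cone G (carrier G) P" using cone_of_local_cones by blast
  then show "\<exists>(\<Lambda> :: 'a universe ogroup) \<alpha> \<phi>. ordered_abelian_group \<Lambda> \<and>
      linear_affine_action G \<Lambda> \<alpha> \<phi> \<and> linear_essentially_free G \<Lambda> \<phi>"
    by (rule linear_action_of_cone[OF is_group])
next
  show "ATFe G" if "right_angled_artin_group V E G" for V :: "'v set" and E
    by (rule poly_separated_ATFe[OF raag_poly_separated[OF that]])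
  show "ATFe G" if "residually_free G"
    by (rule poly_separated_ATFe[OF residually_free_poly_separated[OF that]])
  show "ATFe G" if "(\<forall>i\<in>I. residually_free (H i)) \<and> free_product I H G"
    for I :: "'i set" and H :: "'i \<Rightarrow> ('h, 'k) monoid_scheme"
    using that free_product_poly_separated residually_free_poly_separated
    by (intro poly_separated_ATFe) blast
qed

end
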